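(* Let $H=-\Delta+V$ be a Schrödinger operator on $\mathbb{R}^n$, with real-valued potential $V$, selfadjoint in $L_2(\mathbb{R}^n)$, satisfying the Kernel Decay Assumption stated in the context. Let $\{\varphi_j\}_{j\in\mathbb{Z}}$ be a dyadic system satisfying (i), (ii), (iii) of the context, and for $s>0$ let $\varphi^*_{j,s}f$ be the Peetre maximal functions associated with $H$. a) If $0<p\le\infty$, $0<q\le\infty$, $\alpha\in\mathbb{R}$ and $s>n/p$ (with $n/\infty=0$), then $$\|f\|_{\dot B^{\alpha,q}_p(H)}\approx \|\{2^{j\alpha}\varphi^*_{j,s}f\}\|_{\ell^q(L_p)}:=\Big(\sum_{j=-\infty}^\infty 2^{j\alpha q}\,\|\varphi^*_{j,s}f\|_{L_p(\mathbb{R}^n)}^q\Big)^{1/q}.$$ b) If $0<p<\infty$, $0<q\le\infty$, $\alpha\in\mathbb{R}$ and $s>n/\min(p,q)$, then $$\|f\|_{\dot F^{\alpha,q}_p(H)}\approx \|\{2^{j\alpha}\varphi^*_{j,s}f\}\|_{L_p(\ell^q)}:=\Big\|\Big(\sum_{j=-\infty}^\infty 2^{j\alpha q}\,|\varphi^*_{j,s}f(\cdot)|^q\Big)^{1/q}\Big\|_{L_p(\mathbb{R}^n)}.$$ Here $f\in\mathcal{S}(\mathbb{R}^n)$, and $A(f)\approx B(f)$ means that there is a constant $C\ge 1$ independent of $f$ with $C^{-1}A(f)\le B(f)\le C\,A(f)$ for all such $f$ (values in $[0,\infty]$); for $q=\infty$ the $\ell^q$ sums are replaced by suprema over $j$.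
   Context: Functional calculus: for Borel measurable $\phi:\mathbb{R}\to\mathbb{C}$, $\phi(H)=\int_{-\infty}^\infty\phi(\lambda)\,dE_\lambda$, where $dE_\lambda$ is the spectral measure of $H$; $\phi(H)(x,y)$ denotes the integral kernel of $\phi(H)$. Dyadic system: a family $\{\varphi_j\}_{j\in\mathbb{Z}}\subset C_0^\infty(\mathbb{R})$ such that (i) $\operatorname{supp}\varphi_j\subset\{x:2^{j-2}\le|x|\le2^j\}$; (ii) for every $k\in\mathbb{N}_0=\{0\}\cup\mathbb{N}$ there is a constant $c_k$ with $|\varphi_j^{(k)}(x)|\le c_k2^{-kj}$ for all $j\in\mathbb{Z}$ and all $x$; (iii) $\sum_{j=-\infty}^\infty\varphi_j(x)\approx c>0$ for all $x\ne0$, i.e. the sum is bounded above and below by positive constants independent of $x\neq 0$. Kernel Decay Assumption on $H$: whenever $\{\phi_j\}_{j\in\mathbb{Z}}\subset C_0^\infty(\mathbb{R})$ satisfies (i) and (ii), then for every $N\in\mathbb{N}_0$ there is a constant $c_N>0$ such that for all $j\in\mathbb{Z}$ and $x,y\in\mathbb{R}^n$ $$|\phi_j(H)(x,y)|\le c_N\frac{2^{nj/2}}{(1+2^{j/2}|x-y|)^N},\qquad |\nabla_x\phi_j(H)(x,y)|\le c_N\frac{2^{(n+1)j/2}}{(1+2^{j/2}|x-y|)^N}.$$ Peetre maximal function: for $j\in\mathbb{Z}$, $s>0$, $$\varphi^*_{j,s}f(x)=\sup_{t\in\mathbb{R}^n}\frac{|\varphi_j(H)f(t)|}{(1+2^{j/2}|x-t|)^s}.$$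 Quasi-norms: for $0<p<\infty$, $0<q\le\infty$, $\alpha\in\mathbb{R}$, the homogeneous Triebel-Lizorkin space $\dot F^{\alpha,q}_p(H)$ is the completion of the Schwartz class $\mathcal{S}(\mathbb{R}^n)$ with respect to $$\|f\|_{\dot F^{\alpha,q}_p(H)}=\Big\|\Big(\sum_{j=-\infty}^\infty2^{j\alpha q}|\varphi_j(H)f(\cdot)|^q\Big)^{1/q}\Big\|_{L_p(\mathbb{R}^n)};$$ for $0<p\le\infty$, $0<q\le\infty$, $\alpha\in\mathbb{R}$, the homogeneous Besov space $\dot B^{\alpha,q}_p(H)$ is defined similarly by $$\|f\|_{\dot B^{\alpha,q}_p(H)}=\Big(\sum_{j=-\infty}^\infty2^{j\alpha q}\|\varphi_j(H)f\|_{L_p(\mathbb{R}^n)}^q\Big)^{1/q}$$ (with the usual modification for $q=\infty$). *)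

theory Defs
  imports "HOL-Probability.Essential_Supremum"
begin

section \<open>Smooth functions\<close>

text \<open>For a function of one real variable, \<open>partial_derivs (replicate k 1)\<close> is the
  \<open>k\<close>-th derivative.\<close>

primrec partial_derivs ::
    "'a::euclidean_space list \<Rightarrow> ('a \<Rightarrow> complex) \<Rightarrow> 'a \<Rightarrow> complex" where
  "partial_derivs [] f = f"
| "partial_derivs (b # bs) f = (\<lambda>x. frechet_derivative (partial_derivs bs f) (at x) b)"

definition smooth :: "('a::euclidean_space \<Rightarrow> complex) \<Rightarrow> bool" where
  "smooth f \<longleftrightarrow> (\<forall>bs x. set bs \<subseteq> Basis \<longrightarrow> partial_derivs bs f differentiable (at x))"

definition test_function :: "('a::euclidean_space \<Rightarrow> complex) \<Rightarrow> bool" where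
  "test_function f \<longleftrightarrow> smooth f \<and> compact (closure {x. f x \<noteq> 0})"

definition schwartz_class :: "('a::euclidean_space \<Rightarrow> complex) set" where
  "schwartz_class = {f. smooth f \<and>
     (\<forall>bs (N::nat). set bs \<subseteq> Basis \<longrightarrow>
        (\<exists>C. \<forall>x. (1 + norm x) ^ N * norm (partial_derivs bs f x) \<le> C))}"

definition laplacian :: "('a::euclidean_space \<Rightarrow> complex) \<Rightarrow> 'a \<Rightarrow> complex" where
  "laplacian f x = (\<Sum>b\<in>Basis. partial_derivs [b, b] f x)"

definition gradient :: "(real^'n \<Rightarrow> complex) \<Rightarrow> real^'n \<Rightarrow> complex^'n" where
  "gradient f x = (\<chi> i. frechet_derivative f (at x) (axis i 1))"


section \<open>Operators in \<open>L\<^sub>2\<close>\<close>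

text \<open>Elements of \<open>L\<^sub>2\<close> are represented by Borel measurable, square integrable functions, and
  identities between them are required almost everywhere.\<close>

definition L2 :: "('a::euclidean_space \<Rightarrow> complex) set" where
  "L2 = {f. f \<in> borel_measurable lborel \<and> integrable lborel (\<lambda>x. (norm (f x))\<^sup>2)}"

definition L2_inner :: "('a::euclidean_space \<Rightarrow> complex) \<Rightarrow> ('a \<Rightarrow> complex) \<Rightarrow> complex" where
  "L2_inner f g = (LINT x|lborel. f x * cnj (g x))"

definition L2_norm :: "('a::euclidean_space \<Rightarrow> complex) \<Rightarrow> real" where
  "L2_norm f = sqrt (LINT x|lborel. (norm (f x))\<^sup>2)"

definition ae_eq :: "('a::euclidean_space \<Rightarrow> complex) \<Rightarrow> ('a \<Rightarrow> complex) \<Rightarrow> bool" where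
  "ae_eq f g \<longleftrightarrow> (AE x in lborel. f x = g x)"

text \<open>A linear operator, not necessarily bounded, with domain \<open>D\<close> and action \<open>A\<close>. The values of
  \<open>A\<close> outside \<open>D\<close> are irrelevant.\<close>

definition L2_operator ::
    "('a::euclidean_space \<Rightarrow> complex) set \<Rightarrow> (('a \<Rightarrow> complex) \<Rightarrow> 'a \<Rightarrow> complex) \<Rightarrow> bool" where
  "L2_operator D A \<longleftrightarrow>
     D \<subseteq> L2 \<and> (\<lambda>x. 0) \<in> D \<and> (\<forall>f\<in>D. A f \<in> L2) \<and>
     (\<forall>f\<in>D. \<forall>g\<in>L2. ae_eq f g \<longrightarrow> g \<in> D \<and> ae_eq (A f) (A g)) \<and>
     (\<forall>f\<in>D. \<forall>g\<in>D. \<forall>c. (\<lambda>x. f x + c * g x) \<in> D \<and>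
        ae_eq (A (\<lambda>x. f x + c * g x)) (\<lambda>x. A f x + c * A g x))"

definition L2_dense :: "('a::euclidean_space \<Rightarrow> complex) set \<Rightarrow> bool" where
  "L2_dense D \<longleftrightarrow> (\<forall>f\<in>L2. \<forall>e>0. \<exists>g\<in>D. L2_norm (\<lambda>x. f x - g x) < e)"

definition operator_graph ::
    "('a::euclidean_space \<Rightarrow> complex) set \<Rightarrow> (('a \<Rightarrow> complex) \<Rightarrow> 'a \<Rightarrow> complex) \<Rightarrow>
     (('a \<Rightarrow> complex) \<times> ('a \<Rightarrow> complex)) set" where
  "operator_graph D A = {(f, u). f \<in> D \<and> u \<in> L2 \<and> ae_eq u (A f)}"

definition adjoint_graph ::
    "('a::euclidean_space \<Rightarrow> complex) set \<Rightarrow> (('a \<Rightarrow> complex) \<Rightarrow> 'a \<Rightarrow> complex) \<Rightarrow>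
     (('a \<Rightarrow> complex) \<times> ('a \<Rightarrow> complex)) set" where
  "adjoint_graph D A =
     {(g, v). g \<in> L2 \<and> v \<in> L2 \<and> (\<forall>f\<in>D. L2_inner (A f) g = L2_inner f v)}"

definition selfadjoint ::
    "('a::euclidean_space \<Rightarrow> complex) set \<Rightarrow> (('a \<Rightarrow> complex) \<Rightarrow> 'a \<Rightarrow> complex) \<Rightarrow> bool" where
  "selfadjoint D A \<longleftrightarrow>
     L2_operator D A \<and> L2_dense D \<and> adjoint_graph D A = operator_graph D A"

text \<open>A selfadjoint realization of \<open>- \<Delta> + V\<close>: on its domain the operator acts as \<open>- \<Delta> + V\<close> in
  the sense of distributions, the product of \<open>V\<close> and \<open>f\<close> being locally integrable.\<close>

definition schroedinger_operator ::
    "('a::euclidean_space \<Rightarrow> real) \<Rightarrow> ('a \<Rightarrow> complex) set \<Rightarrow>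
     (('a \<Rightarrow> complex) \<Rightarrow> 'a \<Rightarrow> complex) \<Rightarrow> bool" where
  "schroedinger_operator V D H \<longleftrightarrow>
     V \<in> borel_measurable lborel \<and> selfadjoint D H \<and>
     (\<forall>f\<in>D. \<forall>\<psi>. test_function \<psi> \<longrightarrow>
        integrable lborel (\<lambda>x. of_real (V x) * f x * \<psi> x) \<and>
        (LINT x|lborel. H f x * \<psi> x) =
          (LINT x|lborel. f x * (- laplacian \<psi> x)) +
          (LINT x|lborel. of_real (V x) * f x * \<psi> x))"


section \<open>Spectral measures and functional calculus\<close>

definition projection_valued_measure ::
    "(real set \<Rightarrow> ('a::euclidean_space \<Rightarrow> complex) \<Rightarrow> 'a \<Rightarrow> complex) \<Rightarrow> bool" where
  "projection_valued_measure E \<longleftrightarrow>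
     (\<forall>B\<in>sets borel. L2_operator L2 (E B) \<and>
        (\<forall>f\<in>L2. ae_eq (E B (E B f)) (E B f)) \<and>
        (\<forall>f\<in>L2. \<forall>g\<in>L2. L2_inner (E B f) g = L2_inner f (E B g))) \<and>
     (\<forall>f\<in>L2. ae_eq (E {} f) (\<lambda>x. 0)) \<and>
     (\<forall>f\<in>L2. ae_eq (E UNIV f) f) \<and>
     (\<forall>A\<in>sets borel. \<forall>B\<in>sets borel. \<forall>f\<in>L2. ae_eq (E (A \<inter> B) f) (E A (E B f))) \<and>
     (\<forall>A :: nat \<Rightarrow> real set. range A \<subseteq> sets borel \<longrightarrow> disjoint_family A \<longrightarrow>
        (\<forall>f\<in>L2. (\<lambda>m. L2_norm (\<lambda>x. (\<Sum>i<m. E (A i) f x) - E (\<Union>i. A i) f x)) \<longlonglongrightarrow> 0))"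

text \<open>The finite positive measure \<open>B \<mapsto> \<langle>E(B)f, f\<rangle>\<close>.\<close>

definition scalar_spectral_measure ::
    "(real set \<Rightarrow> ('a::euclidean_space \<Rightarrow> complex) \<Rightarrow> 'a \<Rightarrow> complex) \<Rightarrow>
     ('a \<Rightarrow> complex) \<Rightarrow> real measure" where
  "scalar_spectral_measure E f =
     measure_of UNIV (sets borel) (\<lambda>B. ennreal (Re (L2_inner (E B f) f)))"

text \<open>The integral of \<open>\<phi>\<close> against the complex measure \<open>B \<mapsto> \<langle>E(B)f, g\<rangle>\<close>, written by
  polarization as a combination of integrals against positive measures.\<close>

definition spectral_form ::
    "(real set \<Rightarrow> ('a::euclidean_space \<Rightarrow> complex) \<Rightarrow> 'a \<Rightarrow> complex) \<Rightarrow>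
     (real \<Rightarrow> complex) \<Rightarrow> ('a \<Rightarrow> complex) \<Rightarrow> ('a \<Rightarrow> complex) \<Rightarrow> complex" where
  "spectral_form E \<phi> f g =
     (\<Sum>k<4. \<i> ^ k * (LINT t|scalar_spectral_measure E (\<lambda>x. f x + \<i> ^ k * g x). \<phi> t)) / 4"

definition spectral_integral_domain ::
    "(real set \<Rightarrow> ('a::euclidean_space \<Rightarrow> complex) \<Rightarrow> 'a \<Rightarrow> complex) \<Rightarrow>
     (real \<Rightarrow> complex) \<Rightarrow> ('a \<Rightarrow> complex) set" where
  "spectral_integral_domain E \<phi> =
     {f \<in> L2. (\<integral>\<^sup>+t. ennreal ((norm (\<phi> t))\<^sup>2) \<partial>scalar_spectral_measure E f) < \<infinity>}"

text \<open>The graph of the operator \<open>\<integral> \<phi>(t) dE(t)\<close>. Testing against \<open>g\<close> in the dense domain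
  determines \<open>u\<close> up to null sets; for bounded \<open>\<phi>\<close> the domain is all of \<open>L\<^sub>2\<close>.\<close>

definition spectral_integral ::
    "(real set \<Rightarrow> ('a::euclidean_space \<Rightarrow> complex) \<Rightarrow> 'a \<Rightarrow> complex) \<Rightarrow>
     (real \<Rightarrow> complex) \<Rightarrow> (('a \<Rightarrow> complex) \<times> ('a \<Rightarrow> complex)) set" where
  "spectral_integral E \<phi> =
     {(f, u). f \<in> spectral_integral_domain E \<phi> \<and> u \<in> L2 \<and>
        (\<forall>g\<in>spectral_integral_domain E \<phi>. L2_inner u g = spectral_form E \<phi> f g)}"

definition is_spectral_measure_of ::
    "(real set \<Rightarrow> ('a::euclidean_space \<Rightarrow> complex) \<Rightarrow> 'a \<Rightarrow> complex) \<Rightarrow>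
     ('a \<Rightarrow> complex) set \<Rightarrow> (('a \<Rightarrow> complex) \<Rightarrow> 'a \<Rightarrow> complex) \<Rightarrow> bool" where
  "is_spectral_measure_of E D H \<longleftrightarrow>
     projection_valued_measure E \<and>
     operator_graph D H = spectral_integral E complex_of_real"

text \<open>The function \<open>\<phi>(H)f\<close>. The Peetre maximal function needs its values at every point, so the
  continuous representative, which is unique, is chosen whenever there is one. Under the kernel
  decay assumption \<open>\<phi>\<^sub>j(H)f\<close> always has one, namely \<open>x \<mapsto> \<integral> \<phi>\<^sub>j(H)(x,y) f(y) dy\<close>.\<close>

definition fun_calc ::
    "(real set \<Rightarrow> ('a::euclidean_space \<Rightarrow> complex) \<Rightarrow> 'a \<Rightarrow> complex) \<Rightarrow>
     (real \<Rightarrow> complex) \<Rightarrow> ('a \<Rightarrow> complex) \<Rightarrow> 'a \<Rightarrow> complex" where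
  "fun_calc E \<phi> f =
     (SOME u. (f, u) \<in> spectral_integral E \<phi> \<and>
        ((\<exists>v. (f, v) \<in> spectral_integral E \<phi> \<and> continuous_on UNIV v) \<longrightarrow> continuous_on UNIV u))"

definition is_integral_kernel ::
    "(('a::euclidean_space \<Rightarrow> complex) \<Rightarrow> 'a \<Rightarrow> complex) \<Rightarrow> ('a \<Rightarrow> 'a \<Rightarrow> complex) \<Rightarrow> bool" where
  "is_integral_kernel T K \<longleftrightarrow>
     (\<lambda>(x, y). K x y) \<in> borel_measurable (lborel \<Otimes>\<^sub>M lborel) \<and>
     (\<forall>f\<in>L2. AE x in lborel. integrable lborel (\<lambda>y. K x y * f y) \<and>
        T f x = (LINT y|lborel. K x y * f y))"


section \<open>Dyadic systems and the kernel decay assumption\<close>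

definition dyadic_support_decay :: "(int \<Rightarrow> real \<Rightarrow> complex) \<Rightarrow> bool" where
  "dyadic_support_decay \<phi> \<longleftrightarrow>
     (\<forall>j. test_function (\<phi> j)) \<and>
     (\<forall>j. closure {x. \<phi> j x \<noteq> 0} \<subseteq> {x. 2 powi (j - 2) \<le> \<bar>x\<bar> \<and> \<bar>x\<bar> \<le> 2 powi j}) \<and>
     (\<forall>k::nat. \<exists>c. \<forall>j x.
        norm (partial_derivs (replicate k 1) (\<phi> j) x) \<le> c * 2 powi (- (int k * j)))"

definition dyadic_system :: "(int \<Rightarrow> real \<Rightarrow> complex) \<Rightarrow> bool" where
  "dyadic_system \<phi> \<longleftrightarrow>
     dyadic_support_decay \<phi> \<and>
     (\<exists>c\<^sub>1>0. \<exists>c\<^sub>2. \<forall>x. x \<noteq> 0 \<longrightarrow>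
        (\<exists>r. c\<^sub>1 \<le> r \<and> r \<le> c\<^sub>2 \<and> ((\<lambda>j. \<phi> j x) has_sum complex_of_real r) UNIV))"

definition kernel_decay ::
    "(real set \<Rightarrow> (real^'n \<Rightarrow> complex) \<Rightarrow> real^'n \<Rightarrow> complex) \<Rightarrow> bool" where
  "kernel_decay E \<longleftrightarrow>
     (\<forall>\<phi>. dyadic_support_decay \<phi> \<longrightarrow>
        (\<exists>K :: int \<Rightarrow> real^'n \<Rightarrow> real^'n \<Rightarrow> complex.
           (\<forall>j. is_integral_kernel (fun_calc E (\<phi> j)) (K j)) \<and>
           (\<forall>j x y. (\<lambda>z. K j z y) differentiable (at x)) \<and>
           (\<forall>N::nat. \<exists>c>0. \<forall>j x y.
              norm (K j x y) \<le>
                c * 2 powr (real CARD('n) * real_of_int j / 2)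
                  / (1 + 2 powr (real_of_int j / 2) * norm (x - y)) ^ N \<and>
              norm (gradient (\<lambda>z. K j z y) x) \<le>
                c * 2 powr ((real CARD('n) + 1) * real_of_int j / 2)
                  / (1 + 2 powr (real_of_int j / 2) * norm (x - y)) ^ N)))"


section \<open>Quasi-norms\<close>

definition ennreal_powr :: "ennreal \<Rightarrow> real \<Rightarrow> ennreal" where
  "ennreal_powr a r = (if a = \<infinity> then \<infinity> else ennreal (enn2real a powr r))"
  \<comment> \<open>used only for \<open>r > 0\<close>\<close>

definition Lp_qnorm :: "ennreal \<Rightarrow> ('a::euclidean_space \<Rightarrow> ennreal) \<Rightarrow> ennreal" where
  "Lp_qnorm p F =
     (if p = \<infinity> then esssup lborel F
      else ennreal_powr (\<integral>\<^sup>+x. ennreal_powr (F x) (enn2real p) \<partial>lborel) (1 / enn2real p))"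

definition lq_qnorm :: "ennreal \<Rightarrow> (int \<Rightarrow> ennreal) \<Rightarrow> ennreal" where
  "lq_qnorm q a =
     (if q = \<infinity> then (SUP j. a j)
      else ennreal_powr (\<Sum>\<^sub>\<infinity>j. ennreal_powr (a j) (enn2real q)) (1 / enn2real q))"

definition peetre_maximal ::
    "(real set \<Rightarrow> ('a::euclidean_space \<Rightarrow> complex) \<Rightarrow> 'a \<Rightarrow> complex) \<Rightarrow>
     (int \<Rightarrow> real \<Rightarrow> complex) \<Rightarrow> int \<Rightarrow> real \<Rightarrow> ('a \<Rightarrow> complex) \<Rightarrow> 'a \<Rightarrow> ennreal" where
  "peetre_maximal E \<phi> j s f x =
     (SUP t. ennreal (norm (fun_calc E (\<phi> j) f t)
                / (1 + 2 powr (real_of_int j / 2) * norm (x - t)) powr s))"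

definition besov_qnorm ::
    "(real set \<Rightarrow> ('a::euclidean_space \<Rightarrow> complex) \<Rightarrow> 'a \<Rightarrow> complex) \<Rightarrow>
     (int \<Rightarrow> real \<Rightarrow> complex) \<Rightarrow> real \<Rightarrow> ennreal \<Rightarrow> ennreal \<Rightarrow> ('a \<Rightarrow> complex) \<Rightarrow> ennreal" where
  "besov_qnorm E \<phi> \<alpha> p q f =
     lq_qnorm q (\<lambda>j. ennreal (2 powr (real_of_int j * \<alpha>)) *
       Lp_qnorm p (\<lambda>x. ennreal (norm (fun_calc E (\<phi> j) f x))))"

definition triebel_lizorkin_qnorm ::
    "(real set \<Rightarrow> ('a::euclidean_space \<Rightarrow> complex) \<Rightarrow> 'a \<Rightarrow> complex) \<Rightarrow>
     (int \<Rightarrow> real \<Rightarrow> complex) \<Rightarrow> real \<Rightarrow> ennreal \<Rightarrow> ennreal \<Rightarrow> ('a \<Rightarrow> complex) \<Rightarrow> ennreal" where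
  "triebel_lizorkin_qnorm E \<phi> \<alpha> p q f =
     Lp_qnorm p (\<lambda>x. lq_qnorm q (\<lambda>j. ennreal (2 powr (real_of_int j * \<alpha>)) *
       ennreal (norm (fun_calc E (\<phi> j) f x))))"

definition comparable_on :: "'b set \<Rightarrow> ('b \<Rightarrow> ennreal) \<Rightarrow> ('b \<Rightarrow> ennreal) \<Rightarrow> bool" where
  "comparable_on S A B \<longleftrightarrow>
     (\<exists>C::real. C \<ge> 1 \<and>
        (\<forall>f\<in>S. ennreal (1 / C) * A f \<le> B f \<and> B f \<le> ennreal C * A f))"

end

theory Submission
  imports Defs "HOL-Library.Nat_Bijection"
begin

text \<open>
  Write \<open>u = \<phi>\<^sub>j(H)f\<close> and \<open>a = 2\<^bsup>j/2\<^esup>\<close>. A smooth dyadic partition of unity \<open>(\<psi>\<^sub>i)\<close> gives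
  \<open>u = \<Sum>\<^bsub>\<bar>i - j\<bar> \<le> 1\<^esub> \<psi>\<^sub>i(H)u\<close>, so the kernel decay of the \<open>\<psi>\<^sub>i(H)\<close> bounds \<open>\<bar>u\<bar>\<close> by its own convolution
  with \<open>a\<^sup>n(1 + a\<bar>x\<bar>)\<^bsup>-N\<^esup>\<close> for every \<open>N\<close>. Splitting \<open>\<bar>u\<bar> = \<bar>u\<bar>\<^sup>r\<bar>u\<bar>\<^bsup>1-r\<^esup>\<close> (for \<open>r < 1\<close>; Jensen's inequality for
  \<open>r \<ge> 1\<close>) and absorbing a power of the finite maximal function \<open>u\<^sup>*\<close> yields the pointwise estimate
  \<open>(u\<^sup>*)\<^sup>r \<le> C a\<^sup>n(1 + a\<bar>x\<bar>)\<^bsup>-sr\<^esup> * \<bar>u\<bar>\<^sup>r\<close>.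
  For Besov norms take \<open>r = p\<close> and integrate. For Triebel-Lizorkin norms with \<open>q \<le> p\<close> take
  \<open>r = q\<close> and dualize against the Hardy-Littlewood maximal function; with \<open>p < q\<close> take
  \<open>n/s < r < p\<close>, put \<open>P = p/r\<close>, \<open>Q = q/r\<close>,
  \<open>h\<^sub>j = (2\<^bsup>j\<alpha>\<^esup>\<bar>\<phi>\<^sub>j(H)f\<bar>)\<^sup>r\<close>, and factor \<open>h\<^sub>j = A\<^sub>j\<^bsup>P/Q\<^esup> S\<^bsup>1-P/Q\<^esup>\<close> with \<open>S\<close> the \<open>\<ell>\<^sup>Q\<close> norm of \<open>(h\<^sub>j)\<close>,
  so that Hoelder's inequality reduces everything to the scalar maximal theorem.
\<close>

section \<open>Real powers of extended nonnegative reals\<close>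

text \<open>One inequality is immediate, since t = x is allowed in the supremum; the work is in
  bounding the maximal function. Two obstacles shape it. \<open>fun_calc\<close> only chooses a
  representative, so the reproducing identity holds for almost every t while the supremum sees every
  t; kernel decay yields a continuous representative, and continuity turns almost everywhere bounds
  into pointwise ones. And absorption needs a finite maximal function, which holds because Schwartz
  functions are bounded and the kernels integrable. Only the spectral measure is given, so
  existence, multiplicativity and the norm identity of \<phi>(H) for bounded \<phi> are derived from
  the polarized form. The predicate \<open>reproducing N C j g\<close> carries all that the
  real-variable part learns about g = |\<phi>_j(H)f|; N is fixed by the exponents before C is known.
  The exponent r must satisfy s r > n, so that the kernel is integrable, and keep p/r in the range
  of the norm bound at hand: p/r = 1 for Besov with finite p, p/q \<ge> 1 by duality, p/r > 1
  otherwise. The bump behind the partition is grown from one of the given \<phi>_j.\<close>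

lemma ennreal_powr_top [simp]: "ennreal_powr \<infinity> r = \<infinity>" "ennreal_powr top r = top"
  by (simp_all add: ennreal_powr_def)

lemma ennreal_powr_ennreal: "0 \<le> x \<Longrightarrow> ennreal_powr (ennreal x) r = ennreal (x powr r)"
  by (simp add: ennreal_powr_def)

lemma ennreal_powr_0 [simp]: "ennreal_powr 0 r = 0"
  using ennreal_powr_ennreal[of 0 r] by simp

lemma ennreal_powr_1 [simp]: "ennreal_powr 1 r = 1"
  using ennreal_powr_ennreal[of 1 r] by simp

lemma ennreal_powr_one [simp]: "ennreal_powr a 1 = a"
  by (cases a) (auto simp: ennreal_powr_ennreal)

lemma ennreal_powr_eq_0_iff [simp]: "ennreal_powr a r = 0 \<longleftrightarrow> a = 0"
  by (cases a) (auto simp: ennreal_powr_ennreal ennreal_eq_0_iff not_le order_less_le)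

lemma ennreal_powr_eq_top_iff [simp]: "ennreal_powr a r = \<infinity> \<longleftrightarrow> a = \<infinity>" "ennreal_powr a r = top \<longleftrightarrow> a = top"
  by (cases a; auto simp: ennreal_powr_ennreal)+

lemma ennreal_powr_mono: "a \<le> b \<Longrightarrow> 0 \<le> r \<Longrightarrow> ennreal_powr a r \<le> ennreal_powr b r"
  by (cases a; cases b) (auto simp: ennreal_powr_ennreal ennreal_leI powr_mono2 top_unique)

lemma ennreal_powr_powr: "ennreal_powr (ennreal_powr a r) t = ennreal_powr a (r * t)"
  by (cases a) (auto simp: ennreal_powr_ennreal powr_powr)

lemma ennreal_powr_le_iff:
  assumes "0 < r" shows "ennreal_powr a r \<le> b \<longleftrightarrow> a \<le> ennreal_powr b (1 / r)"
  using ennreal_powr_mono[of "ennreal_powr a r" b "1/r"] ennreal_powr_mono[of a "ennreal_powr b (1/r)" r] assms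
  by (auto simp: ennreal_powr_powr)

lemma ennreal_powr_mult:
  assumes "0 < r" shows "ennreal_powr (a * b) r = ennreal_powr a r * ennreal_powr b r"
proof (cases "a = 0 \<or> b = 0")
  case False
  then show ?thesis using assms
    by (cases a; cases b)
      (auto simp: ennreal_powr_ennreal ennreal_mult[symmetric] powr_mult ennreal_mult_top ennreal_top_mult)
qed auto

lemma ennreal_powr_add:
  assumes "0 \<le> r" "0 \<le> t" shows "ennreal_powr a (r + t) = ennreal_powr a r * ennreal_powr a t"
proof (cases a)
  case (real x)
  then show ?thesis using assms
    by (cases "x = 0") (auto simp: ennreal_powr_ennreal powr_add ennreal_mult[symmetric])
qed (auto simp: ennreal_top_mult)

lemma ennreal_powr_divide:
  assumes "0 < r" shows "ennreal_powr (a / b) r = ennreal_powr a r / ennreal_powr b r"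
proof -
  have "ennreal_powr (inverse b) r = inverse (ennreal_powr b r)"
  proof (cases b)
    case (real x)
    then show ?thesis
      by (cases "x = 0") (auto simp: ennreal_powr_ennreal inverse_ennreal powr_minus inverse_powr)
  qed auto
  then show ?thesis by (simp add: divide_ennreal_def ennreal_powr_mult assms)
qed

lemma ennreal_powr_SUP:
  assumes "0 < r" shows "ennreal_powr (SUP i\<in>I. f i) r = (SUP i\<in>I. ennreal_powr (f i) r)"
proof (rule antisym)
  show "(SUP i\<in>I. ennreal_powr (f i) r) \<le> ennreal_powr (SUP i\<in>I. f i) r"
    using assms by (intro SUP_least ennreal_powr_mono SUP_upper) auto
  have "f i \<le> ennreal_powr (SUP i\<in>I. ennreal_powr (f i) r) (1 / r)" if "i \<in> I" for i
    using that assms by (subst ennreal_powr_le_iff[symmetric]) (auto intro: SUP_upper)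
  then show "ennreal_powr (SUP i\<in>I. f i) r \<le> (SUP i\<in>I. ennreal_powr (f i) r)"
    using assms by (subst ennreal_powr_le_iff) (auto intro: SUP_least)
qed

lemma borel_measurable_ennreal_powr [measurable (raw)]:
  assumes [measurable]: "f \<in> borel_measurable M"
  shows "(\<lambda>x. ennreal_powr (f x) r) \<in> borel_measurable M"
  unfolding ennreal_powr_def by measurable

section \<open>Hoelder and Jensen inequalities for extended nonnegative integrands\<close>

lemma ennreal_weighted_amgm:
  assumes "0 < \<theta>" "\<theta> < 1"
  shows "ennreal_powr a \<theta> * ennreal_powr b (1 - \<theta>) \<le> ennreal \<theta> * a + ennreal (1 - \<theta>) * b"
proof (cases a; cases b)
  fix x y :: real assume xy: "0 \<le> x" "a = ennreal x" "0 \<le> y" "b = ennreal y"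
  have "x powr \<theta> * y powr (1 - \<theta>) \<le> \<theta> * x + (1 - \<theta>) * y"
    using Youngs_inequality_0[of \<theta> "1 - \<theta>" x y] xy assms by (cases "x = 0 \<or> y = 0") auto
  then show ?thesis using xy assms
    by (simp add: ennreal_powr_ennreal ennreal_mult[symmetric] ennreal_plus[symmetric] del: ennreal_plus)
qed (use assms in \<open>auto simp: ennreal_mult_top ennreal_powr_ennreal\<close>)

text \<open>Normalize both integrals to 1 and integrate the weighted arithmetic-geometric mean
  inequality. The degenerate cases are separate: a vanishing integral makes the left integrand
  vanish almost everywhere, and otherwise an infinite integral makes the right side infinite.
  Weights \<theta> and 1 - \<theta> replace a pair of conjugate exponents.\<close>

lemma Hoelder_nn_integral:
  assumes [measurable]: "f \<in> borel_measurable M" "g \<in> borel_measurable M"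
    and \<theta>: "0 < \<theta>" "\<theta> < 1"
  shows "(\<integral>\<^sup>+x. ennreal_powr (f x) \<theta> * ennreal_powr (g x) (1 - \<theta>) \<partial>M)
    \<le> ennreal_powr (\<integral>\<^sup>+x. f x \<partial>M) \<theta> * ennreal_powr (\<integral>\<^sup>+x. g x \<partial>M) (1 - \<theta>)"
proof -
  define F where "F = (\<integral>\<^sup>+x. f x \<partial>M)"
  define G where "G = (\<integral>\<^sup>+x. g x \<partial>M)"
  consider "F = 0 \<or> G = 0" | "F \<noteq> 0" "G \<noteq> 0" "F = \<infinity> \<or> G = \<infinity>"
    | "F \<noteq> 0" "G \<noteq> 0" "F \<noteq> \<infinity>" "G \<noteq> \<infinity>" by blast
  then show ?thesis
  proof cases
    case 1
    then have "AE x in M. ennreal_powr (f x) \<theta> * ennreal_powr (g x) (1 - \<theta>) = 0"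
      by (auto simp: F_def G_def nn_integral_0_iff_AE elim: eventually_mono)
    then have "(\<integral>\<^sup>+x. ennreal_powr (f x) \<theta> * ennreal_powr (g x) (1 - \<theta>) \<partial>M) = 0"
      by (subst nn_integral_0_iff_AE) simp_all
    then show ?thesis by simp
  next
    case 2
    then have "ennreal_powr F \<theta> * ennreal_powr G (1 - \<theta>) = \<infinity>"
      by (auto simp: ennreal_mult_eq_top_iff)
    then show ?thesis unfolding F_def G_def by simp
  next
    case 3
    have eq: "f x = F * (f x / F)" "g x = G * (g x / G)" for x
      using 3 by (simp_all add: ennreal_times_divide mult_divide_eq_ennreal mult.commute[of F] mult.commute[of G])
    have "(\<integral>\<^sup>+x. ennreal_powr (f x) \<theta> * ennreal_powr (g x) (1 - \<theta>) \<partial>M)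
        = (\<integral>\<^sup>+x. (ennreal_powr F \<theta> * ennreal_powr G (1 - \<theta>)) *
            (ennreal_powr (f x / F) \<theta> * ennreal_powr (g x / G) (1 - \<theta>)) \<partial>M)"
      by (subst eq(1), subst eq(2)) (use \<theta> in \<open>simp add: ennreal_powr_mult mult_ac\<close>)
    also have "\<dots> = (ennreal_powr F \<theta> * ennreal_powr G (1 - \<theta>)) *
        (\<integral>\<^sup>+x. ennreal_powr (f x / F) \<theta> * ennreal_powr (g x / G) (1 - \<theta>) \<partial>M)"
      by (rule nn_integral_cmult) measurable
    also have "(\<integral>\<^sup>+x. ennreal_powr (f x / F) \<theta> * ennreal_powr (g x / G) (1 - \<theta>) \<partial>M)
        \<le> (\<integral>\<^sup>+x. ennreal \<theta> * (f x / F) + ennreal (1 - \<theta>) * (g x / G) \<partial>M)"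
      by (intro nn_integral_mono ennreal_weighted_amgm \<theta>)
    also have "\<dots> = ennreal \<theta> * (F / F) + ennreal (1 - \<theta>) * (G / G)"
      by (simp add: nn_integral_add nn_integral_cmult nn_integral_divide F_def G_def)
    also have "\<dots> = 1"
      using 3 \<theta> by (simp add: ennreal_divide_self ennreal_plus[symmetric] less_top del: ennreal_plus)
    finally show ?thesis by (simp add: F_def G_def mult_left_mono)
  qed
qed

text \<open>Hoelder with \<theta> = 1/r for the factorization k f = (k f^r)^(1/r) k^(1 - 1/r). The
  case r = 1 lies outside the open interval of admissible \<theta>.\<close>

lemma Jensen_powr_nn_integral:
  assumes [measurable]: "k \<in> borel_measurable M" "f \<in> borel_measurable M" and r: "1 \<le> r"
  shows "ennreal_powr (\<integral>\<^sup>+x. k x * f x \<partial>M) r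
    \<le> ennreal_powr (\<integral>\<^sup>+x. k x \<partial>M) (r - 1) * (\<integral>\<^sup>+x. k x * ennreal_powr (f x) r \<partial>M)"
proof (cases "r = 1")
  case True
  show ?thesis
  \<comment> \<open>\<open>ennreal_powr 0 0\<close> is 0 and not 1, so for r = 1 the factor in front
    is 0 when k has integral 0; the left side then vanishes too.\<close>
  proof (cases "(\<integral>\<^sup>+x. k x \<partial>M) = 0")
    case True
    then have "AE x in M. k x * f x = 0" by (auto simp: nn_integral_0_iff_AE elim: eventually_mono)
    then have "(\<integral>\<^sup>+x. k x * f x \<partial>M) = 0" by (subst nn_integral_0_iff_AE) simp_all
    then show ?thesis by simp
  next
    case False
    then have "1 \<le> ennreal_powr (\<integral>\<^sup>+x. k x \<partial>M) 0"
      by (cases "\<integral>\<^sup>+x. k x \<partial>M") (auto simp: ennreal_powr_ennreal)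
    from mult_right_mono[OF this] show ?thesis using True by simp
  qed
next
  case False
  then have \<theta>: "0 < 1 / r" "1 / r < 1" using r by auto
  have "k x * f x = ennreal_powr (k x * ennreal_powr (f x) r) (1 / r) * ennreal_powr (k x) (1 - 1 / r)" for x
    using \<theta> ennreal_powr_add[of "1/r" "1 - 1/r" "k x"] r
    by (simp add: ennreal_powr_mult ennreal_powr_powr mult_ac)
  then have "(\<integral>\<^sup>+x. k x * f x \<partial>M) \<le> ennreal_powr (\<integral>\<^sup>+x. k x * ennreal_powr (f x) r \<partial>M) (1 / r)
     * ennreal_powr (\<integral>\<^sup>+x. k x \<partial>M) (1 - 1 / r)"
    using Hoelder_nn_integral[of "\<lambda>x. k x * ennreal_powr (f x) r" M k "1/r"] \<theta> by simp
  then have "ennreal_powr (\<integral>\<^sup>+x. k x * f x \<partial>M) r \<le>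
    ennreal_powr (ennreal_powr (\<integral>\<^sup>+x. k x * ennreal_powr (f x) r \<partial>M) (1 / r)
     * ennreal_powr (\<integral>\<^sup>+x. k x \<partial>M) (1 - 1 / r)) r"
    using r by (intro ennreal_powr_mono) auto
  also have "\<dots> = (\<integral>\<^sup>+x. k x * ennreal_powr (f x) r \<partial>M) * ennreal_powr (\<integral>\<^sup>+x. k x \<partial>M) (r - 1)"
    using r by (simp add: ennreal_powr_mult ennreal_powr_powr right_diff_distrib mult.commute)
  finally show ?thesis by (simp add: mult.commute)
qed

text \<open>The l^q sums are defined by unordered summation. As integrals against counting measure
  on the integers they fall under Tonelli and Hoelder.\<close>

lemma infsum_int_eq_nn_integral:
  fixes f :: "int \<Rightarrow> ennreal"
  shows "(\<Sum>\<^sub>\<infinity>j. f j) = (\<integral>\<^sup>+j. f j \<partial>count_space UNIV)"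
proof -
  have "(\<Sum>\<^sub>\<infinity>j. f j) = (\<Sum>\<^sub>\<infinity>n. f (int_decode n))"
    using infsum_reindex_bij_betw[OF bij_int_decode, of f] by simp
  also have "\<dots> = (\<Sum>n. f (int_decode n))"
    using has_sum_imp_sums[OF has_sum_infsum[OF nonneg_summable_on_complete[of UNIV "\<lambda>n. f (int_decode n)"]]]
    by (simp add: sums_iff)
  also have "\<dots> = (\<integral>\<^sup>+n. f (int_decode n) \<partial>count_space UNIV)"
    by (simp add: nn_integral_count_space_nat)
  also have "\<dots> = (\<integral>\<^sup>+j. f j \<partial>count_space UNIV)"
    by (rule nn_integral_bij_count_space[OF bij_int_decode])
  finally show ?thesis .
qed

section \<open>The Hardy-Littlewood maximal function\<close>

text \<open>The radii are discrete, which gives measurability at once and suffices because every kernel at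
  scale \<open>2\<^bsup>j/2\<^esup>\<close> is dominated by a sum over balls of radius \<open>2\<^bsup>k - j/2\<^esup>\<close>. The normalization omits
  the volume of the unit ball.\<close>

definition HL_max :: "('a::euclidean_space \<Rightarrow> ennreal) \<Rightarrow> 'a \<Rightarrow> ennreal" where
  "HL_max f x = (SUP i::int. (\<integral>\<^sup>+y. f y * indicator (ball x (2 powr (i/2))) y \<partial>lborel)
     / ennreal ((2 powr (i/2)) ^ DIM('a)))"

lemma ennreal_less_divide_iff:
  assumes "0 < c" "0 \<le> t" shows "ennreal t < y / ennreal c \<longleftrightarrow> ennreal (t * c) < y"
proof (cases y)
  case (real x)
  then show ?thesis using assms by (simp add: divide_ennreal ennreal_less_iff pos_less_divide_eq)
qed (use assms in \<open>simp add: ennreal_top_divide\<close>)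

lemma ball_in_sets_borel [measurable]: "ball x r \<in> sets borel"
  by simp

text \<open>Membership in the ball is rewritten as a condition on \<open>dist x y\<close>, which is
  jointly measurable in x and y, before y is integrated out.\<close>

lemma borel_measurable_ball_integral:
  fixes f :: "'a::euclidean_space \<Rightarrow> ennreal"
  assumes [measurable]: "f \<in> borel_measurable borel"
  shows "(\<lambda>x. \<integral>\<^sup>+y. f y * indicator (ball x r) y \<partial>lborel) \<in> borel_measurable borel"
proof -
  have "(\<lambda>x. \<integral>\<^sup>+y. f y * (if dist x y < r then 1 else 0) \<partial>lborel) \<in> borel_measurable borel"
    by measurable
  also have "(\<lambda>x y. f y * (if dist x y < r then 1 else 0)) = (\<lambda>x y. f y * indicator (ball x r) y)"
    by (auto simp: fun_eq_iff)
  finally show ?thesis .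
qed

lemma borel_measurable_HL_max [measurable]:
  fixes f :: "'a::euclidean_space \<Rightarrow> ennreal"
  assumes [measurable]: "f \<in> borel_measurable borel"
  shows "HL_max f \<in> borel_measurable borel"
  unfolding HL_max_def[abs_def] using borel_measurable_ball_integral[OF assms] by measurable

lemma nn_integral_ball_const:
  fixes x :: "'a::euclidean_space"
  assumes "0 \<le> r"
  shows "(\<integral>\<^sup>+y. c * indicator (ball x r) y \<partial>lborel) = c * ennreal (unit_ball_vol DIM('a) * r ^ DIM('a))"
  using assms by (simp add: nn_integral_cmult_indicator emeasure_ball)

lemma HL_max_const_le:
  fixes x :: "'a::euclidean_space"
  shows "HL_max (\<lambda>_. c) x \<le> ennreal (unit_ball_vol DIM('a)) * c"
  unfolding HL_max_def nn_integral_ball_const[OF powr_ge_zero]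
  by (intro SUP_least)
    (auto simp: ennreal_mult[symmetric] ennreal_times_divide[symmetric] divide_ennreal mult.commute)

lemma HL_max_mono:
  assumes "\<And>x. f x \<le> g x" shows "HL_max f x \<le> HL_max g x"
  unfolding HL_max_def
  by (intro SUP_mono' divide_right_mono_ennreal nn_integral_mono mult_right_mono assms) auto

lemma HL_max_add_le:
  fixes f g :: "'a::euclidean_space \<Rightarrow> ennreal"
  assumes [measurable]: "f \<in> borel_measurable borel" "g \<in> borel_measurable borel"
  shows "HL_max (\<lambda>x. f x + g x) x \<le> HL_max f x + HL_max g x"
proof -
  have "(\<integral>\<^sup>+y. (f y + g y) * indicator (ball x r) y \<partial>lborel)
     = (\<integral>\<^sup>+y. f y * indicator (ball x r) y \<partial>lborel) + (\<integral>\<^sup>+y. g y * indicator (ball x r) y \<partial>lborel)" for r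
    unfolding distrib_right by (rule nn_integral_add) measurable
  then show ?thesis
    unfolding HL_max_def by (auto simp: add_divide_distrib_ennreal intro!: SUP_least add_mono SUP_upper)
qed

text \<open>Each point of the level set K is the centre of a ball of some radius r with t r^n below
  the mass of f in it. When f is integrable these radii are bounded, so Vitali's lemma selects
  countably many disjoint balls whose fivefold enlargements cover K; disjointness lets the masses
  add up to at most the integral of f.\<close>

lemma HL_max_weak_type:
  fixes f :: "'a::euclidean_space \<Rightarrow> ennreal"
  assumes [measurable]: "f \<in> borel_measurable borel" and t: "0 < t"
  shows "emeasure lborel {x. ennreal t < HL_max f x}
     \<le> ennreal (5 ^ DIM('a) * unit_ball_vol DIM('a) / t) * (\<integral>\<^sup>+x. f x \<partial>lborel)"
proof (cases "(\<integral>\<^sup>+x. f x \<partial>lborel) = \<infinity>")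
  case True
  then show ?thesis using t unit_ball_vol_pos[of "real DIM('a)"]
    by (simp add: ennreal_mult_top del: unit_ball_vol_pos)
next
  case False
  define F where "F = enn2real (\<integral>\<^sup>+x. f x \<partial>lborel)"
  have F: "(\<integral>\<^sup>+x. f x \<partial>lborel) = ennreal F" "0 \<le> F"
    using False by (auto simp: F_def less_top)
  define K where "K = {x. ennreal t < HL_max f x}"
  have [measurable]: "K \<in> sets borel" unfolding K_def by measurable
  have "\<exists>r>0. ennreal (t * r ^ DIM('a)) < (\<integral>\<^sup>+y. f y * indicator (ball x r) y \<partial>lborel)" if x: "x \<in> K" for x
  proof -
    obtain i :: int where "ennreal t < (\<integral>\<^sup>+y. f y * indicator (ball x (2 powr (i/2))) y \<partial>lborel)
       / ennreal ((2 powr (i/2)) ^ DIM('a))"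
      using x by (auto simp: K_def HL_max_def less_SUP_iff)
    then show ?thesis using t
      by (intro exI[of _ "2 powr (i/2)"]) (simp add: ennreal_less_divide_iff)
  qed
  then obtain r where r: "\<And>x. x \<in> K \<Longrightarrow> 0 < r x"
    "\<And>x. x \<in> K \<Longrightarrow> ennreal (t * r x ^ DIM('a)) < (\<integral>\<^sup>+y. f y * indicator (ball x (r x)) y \<partial>lborel)"
    by metis
  \<comment> \<open>From t r^n < F comes r^n \<le> F/t; the maximum with 1 is there because r \<le>
    r^n only for r \<ge> 1.\<close>
  have bd: "0 < r x \<and> r x \<le> max 1 (F / t)" if "x \<in> K" for x
  proof -
    have "ennreal (t * r x ^ DIM('a)) < (\<integral>\<^sup>+y. f y * indicator (ball x (r x)) y \<partial>lborel)"
      using r that by auto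
    also have "\<dots> \<le> (\<integral>\<^sup>+y. f y \<partial>lborel)"
      by (intro nn_integral_mono) (auto split: split_indicator)
    finally have "t * r x ^ DIM('a) < F"
      using F t r(1)[OF that] by (simp add: ennreal_less_iff)
    then have *: "r x ^ DIM('a) \<le> F / t" using t by (simp add: field_simps)
    have "r x \<le> r x ^ DIM('a)" if "1 \<le> r x"
      using that power_increasing[of 1 "DIM('a)" "r x"] by (simp add: DIM_positive Suc_leI)
    then show ?thesis using * r(1)[OF that] by fastforce
  qed
  obtain C where C: "countable C" "C \<subseteq> K"
    "pairwise (\<lambda>i j. disjnt (ball i (r i)) (ball j (r j))) C"
    "K \<subseteq> (\<Union>i\<in>C. ball i (5 * r i))"
    by (rule Vitali_covering_lemma_balls[of K "\<lambda>i. i" r K "max 1 (F / t)", OF _ bd])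
      (use r(1) in \<open>auto intro!: exI\<close>)
  have C0: "0 < r i" if "i \<in> C" for i using C(2) r(1) that by auto
  let ?A = "5 ^ DIM('a) * unit_ball_vol DIM('a) / t"
  have A0: "0 \<le> ?A" using t by simp
  have disj: "(\<integral>\<^sup>+i. indicator (ball i (r i)) x \<partial>count_space C) \<le> (1::ennreal)" for x
  proof (cases "\<exists>i\<in>C. x \<in> ball i (r i)")
    case True
    then obtain i where i: "i \<in> C" "x \<in> ball i (r i)" by blast
    have "indicator (ball j (r j)) x \<le> (indicator {i} j :: ennreal)" if "j \<in> C" for j
    proof (cases "x \<in> ball j (r j)")
      case True
      then have "i = j" using C(3) i that unfolding pairwise_def disjnt_def by blast
      then show ?thesis by (simp add: indicator_def)
    qed simp
    then have "(\<integral>\<^sup>+i. indicator (ball i (r i)) x \<partial>count_space C) \<le> (\<integral>\<^sup>+j. indicator {i} j \<partial>count_space C)"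
      by (intro nn_integral_mono) auto
    also have "\<dots> = 1" using i by (simp add: emeasure_count_space_finite)
    finally show ?thesis .
  next
    case False
    then have "(\<integral>\<^sup>+i. indicator (ball i (r i)) x \<partial>count_space C) = (\<integral>\<^sup>+i. 0 \<partial>count_space C)"
      by (intro nn_integral_cong) (auto split: split_indicator)
    then show ?thesis by simp
  qed
  \<comment> \<open>Sums over C are integrals against \<open>count_space C\<close>, so exchanging
    them with Lebesgue integrals is Tonelli for a countable index set.\<close>
  have "emeasure lborel K = (\<integral>\<^sup>+x. indicator K x \<partial>lborel)" by simp
  also have "\<dots> \<le> (\<integral>\<^sup>+x. \<integral>\<^sup>+i. indicator (ball i (5 * r i)) x \<partial>count_space C \<partial>lborel)"
  proof (intro nn_integral_mono)
    fix x
    show "indicator K x \<le> (\<integral>\<^sup>+i. indicator (ball i (5 * r i)) x \<partial>count_space C :: ennreal)"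
    proof (cases "x \<in> K")
      case True
      then obtain i where "i \<in> C" "x \<in> ball i (5 * r i)" using C(4) by blast
      then show ?thesis
        using nn_integral_ge_point[of i C "\<lambda>i. indicator (ball i (5 * r i)) x"] True by auto
    qed simp
  qed
  also have "\<dots> = (\<integral>\<^sup>+i. \<integral>\<^sup>+x. indicator (ball i (5 * r i)) x \<partial>lborel \<partial>count_space C)"
    by (rule nn_integral_count_space_nn_integral) (auto simp: C)
  also have "\<dots> = (\<integral>\<^sup>+i. ennreal ?A * ennreal (t * r i ^ DIM('a)) \<partial>count_space C)"
    using C0 t by (intro nn_integral_cong)
      (simp add: emeasure_ball less_imp_le ennreal_mult[symmetric] power_mult_distrib mult_ac)
  also have "\<dots> \<le> (\<integral>\<^sup>+i. ennreal ?A * (\<integral>\<^sup>+y. f y * indicator (ball i (r i)) y \<partial>lborel) \<partial>count_space C)"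
    using C(2) r(2) by (intro nn_integral_mono mult_left_mono) (auto intro: less_imp_le)
  also have "\<dots> = ennreal ?A * (\<integral>\<^sup>+i. \<integral>\<^sup>+y. f y * indicator (ball i (r i)) y \<partial>lborel \<partial>count_space C)"
    by (rule nn_integral_cmult) simp
  also have "(\<integral>\<^sup>+i. \<integral>\<^sup>+y. f y * indicator (ball i (r i)) y \<partial>lborel \<partial>count_space C)
     = (\<integral>\<^sup>+y. \<integral>\<^sup>+i. f y * indicator (ball i (r i)) y \<partial>count_space C \<partial>lborel)"
    by (rule nn_integral_count_space_nn_integral[symmetric]) (auto simp: C)
  also have "\<dots> = (\<integral>\<^sup>+y. f y * (\<integral>\<^sup>+i. indicator (ball i (r i)) y \<partial>count_space C) \<partial>lborel)"
    by (simp add: nn_integral_cmult)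
  also have "\<dots> \<le> (\<integral>\<^sup>+y. f y * 1 \<partial>lborel)"
    by (intro nn_integral_mono mult_left_mono disj) simp
  finally show ?thesis by (simp add: K_def mult_left_mono)
qed

section \<open>Layer cake formula and the strong type inequality\<close>

lemma nn_integral_powr_from_0:
  assumes "-1 < a" "0 \<le> c"
  shows "(\<integral>\<^sup>+t. ennreal (t powr a) * indicator {0..c} t \<partial>lborel) = ennreal (c powr (a + 1) / (a + 1))"
  using nn_integral_has_integral_lebesgue[OF _ has_integral_powr_from_0[OF assms]]
  by (simp add: nn_integral_set_ennreal mult.commute)

text \<open>For finite c below y the integral of P t^(P-1) over [0, c] is c^P, and it stays below
  the right side because the endpoints are null sets. Taking c = y settles finite y; for infinite y
  let c run through all values x^(1/P), which forces the right side above every x.\<close>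

lemma layer_cake_le:
  assumes "0 < P"
  shows "ennreal_powr y P \<le> ennreal P * (\<integral>\<^sup>+t. ennreal (t powr (P - 1)) * (if 0 < t \<and> ennreal t < y then 1 else 0) \<partial>lborel)"
proof -
  have *: "ennreal (c powr P) \<le> ennreal P * (\<integral>\<^sup>+t. ennreal (t powr (P - 1)) * (if 0 < t \<and> ennreal t < y then 1 else 0) \<partial>lborel)"
    if c: "0 \<le> c" "ennreal c \<le> y" for c
  proof -
    have "ennreal (c powr P) = ennreal P * (\<integral>\<^sup>+t. ennreal (t powr (P - 1)) * indicator {0..c} t \<partial>lborel)"
      using assms c nn_integral_powr_from_0[of "P - 1" c] by (simp add: ennreal_mult[symmetric])
    also have "(\<integral>\<^sup>+t. ennreal (t powr (P - 1)) * indicator {0..c} t \<partial>lborel)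
      \<le> (\<integral>\<^sup>+t. ennreal (t powr (P - 1)) * (if 0 < t \<and> ennreal t < y then 1 else 0) \<partial>lborel)"
    proof (rule nn_integral_mono_AE)
      have "AE t in lborel. t \<noteq> c" "AE t in lborel. t \<noteq> 0" by (auto simp: AE_lborel_singleton)
      then show "AE t in lborel. ennreal (t powr (P - 1)) * indicator {0..c} t
         \<le> ennreal (t powr (P - 1)) * (if 0 < t \<and> ennreal t < y then 1 else 0)"
      proof eventually_elim
        case (elim t)
        have "ennreal t < y" if "0 \<le> t" "t \<le> c"
          using that elim c by (intro order.strict_trans2[OF _ c(2)]) (auto simp: ennreal_less_iff)
        then show ?case using elim by (auto split: split_indicator)
      qed
    qed
    finally show ?thesis by (simp add: mult_left_mono)
  qed
  show ?thesis
  proof (cases y)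
    case (real c)
    then show ?thesis using *[of c] by (simp add: ennreal_powr_ennreal)
  next
    case top
    have "ennreal x \<le> ennreal P * (\<integral>\<^sup>+t. ennreal (t powr (P - 1)) * (if 0 < t \<and> ennreal t < y then 1 else 0) \<partial>lborel)"
      if "0 \<le> x" for x
      using *[of "x powr (1 / P)"] that top assms by (simp add: powr_powr)
    then have "ennreal P * (\<integral>\<^sup>+t. ennreal (t powr (P - 1)) * (if 0 < t \<and> ennreal t < y then 1 else 0) \<partial>lborel) = top"
      (is "?I = top")
    proof (rule_tac ccontr)
      assume *: "\<And>x. 0 \<le> x \<Longrightarrow> ennreal x \<le> ?I" and "?I \<noteq> top"
      then obtain v where "0 \<le> v" "?I = ennreal v" by (cases ?I) auto
      with *[of "v + 1"] show False by (simp add: ennreal_le_iff del: ennreal_plus)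
    qed
    then show ?thesis by simp
  qed
qed

text \<open>Marcinkiewicz interpolation between the weak type bound and the bound for constants. At
  height t split f into its part above t and a remainder of size at most t; the remainder
  contributes at most V t to the maximal function, so exceeding (V + 1) t forces the maximal
  function of the first part above t. Layer cake and Tonelli then integrate the weak bound over all
  heights.\<close>

lemma HL_max_strong_type:
  assumes P: "1 < P"
  shows "\<exists>C\<ge>0. \<forall>f :: 'a::euclidean_space \<Rightarrow> ennreal. f \<in> borel_measurable borel \<longrightarrow>
    (\<integral>\<^sup>+x. ennreal_powr (HL_max f x) P \<partial>lborel) \<le> ennreal C * (\<integral>\<^sup>+x. ennreal_powr (f x) P \<partial>lborel)"
proof -
  define V where "V = unit_ball_vol DIM('a)"
  define A where "A = 5 ^ DIM('a) * V"
  define c where "c = V + 1"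
  have V: "0 < V" and A: "0 < A" and c: "0 < c" by (auto simp: V_def A_def c_def add_pos_pos)
  have lvl: "emeasure lborel {x. ennreal (c * t) < HL_max f x}
     \<le> ennreal (A / t) * (\<integral>\<^sup>+x. f x * (if ennreal t < f x then 1 else 0) \<partial>lborel)"
    if [measurable]: "f \<in> borel_measurable borel" and t: "0 < t" for f :: "'a \<Rightarrow> ennreal" and t
  proof -
    let ?g = "\<lambda>x. f x * (if ennreal t < f x then 1 else 0)"
    have "ennreal t < HL_max ?g x" if "ennreal (c * t) < HL_max f x" for x
    proof (rule ccontr)
      assume "\<not> ennreal t < HL_max ?g x"
      moreover have "HL_max f x \<le> HL_max (\<lambda>x. ?g x + ennreal t) x"
        by (rule HL_max_mono) auto
      moreover have "\<dots> \<le> HL_max ?g x + HL_max (\<lambda>_. ennreal t) x"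
        by (rule HL_max_add_le) measurable
      moreover have "HL_max (\<lambda>_. ennreal t) x \<le> ennreal V * ennreal t"
        unfolding V_def by (rule HL_max_const_le)
      ultimately have "HL_max f x \<le> ennreal t + ennreal V * ennreal t"
        by (meson add_mono leI order_trans)
      also have "\<dots> = ennreal (c * t)"
        using V t by (simp add: c_def ennreal_mult[symmetric] ennreal_plus[symmetric] algebra_simps del: ennreal_plus)
      finally show False using that by simp
    qed
    then have "emeasure lborel {x. ennreal (c * t) < HL_max f x} \<le> emeasure lborel {x. ennreal t < HL_max ?g x}"
      by (intro emeasure_mono) (auto simp del: mult_if_delta)
    also have "\<dots> \<le> ennreal (A / t) * (\<integral>\<^sup>+x. ?g x \<partial>lborel)"
      unfolding A_def V_def by (rule HL_max_weak_type) (use t in measurable)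
    finally show ?thesis .
  qed
  have main: "(\<integral>\<^sup>+x. ennreal_powr (HL_max f x) P \<partial>lborel)
     \<le> ennreal (c powr P * P * A / (P - 1)) * (\<integral>\<^sup>+x. ennreal_powr (f x) P \<partial>lborel)"
    if [measurable]: "f \<in> borel_measurable borel" for f :: "'a \<Rightarrow> ennreal"
  proof -
    \<comment> \<open>Dividing the maximal function by c turns the level c t into the level t of the
      layer cake formula.\<close>
    have eq: "ennreal t < HL_max f x / ennreal c \<longleftrightarrow> ennreal (c * t) < HL_max f x" if "0 < t" for t x
      using that c by (simp add: ennreal_less_divide_iff mult.commute)
    have "(\<integral>\<^sup>+x. ennreal_powr (HL_max f x) P \<partial>lborel)
        = (\<integral>\<^sup>+x. ennreal (c powr P) * ennreal_powr (HL_max f x / ennreal c) P \<partial>lborel)"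
    proof (intro nn_integral_cong)
      fix x
      have "ennreal_powr (HL_max f x) P = ennreal_powr (ennreal c * (HL_max f x / ennreal c)) P"
        using c mult_divide_eq_ennreal[of "ennreal c" "HL_max f x"]
        by (simp add: ennreal_times_divide mult.commute)
      then show "ennreal_powr (HL_max f x) P = ennreal (c powr P) * ennreal_powr (HL_max f x / ennreal c) P"
        using c P by (simp add: ennreal_powr_mult ennreal_powr_ennreal)
    qed
    also have "\<dots> = ennreal (c powr P) * (\<integral>\<^sup>+x. ennreal_powr (HL_max f x / ennreal c) P \<partial>lborel)"
      by (rule nn_integral_cmult) measurable
    also have "(\<integral>\<^sup>+x. ennreal_powr (HL_max f x / ennreal c) P \<partial>lborel)
      \<le> (\<integral>\<^sup>+x. ennreal P * (\<integral>\<^sup>+t. ennreal (t powr (P - 1)) *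
           (if 0 < t \<and> ennreal t < HL_max f x / ennreal c then 1 else 0) \<partial>lborel) \<partial>lborel)"
      using P by (intro nn_integral_mono layer_cake_le) auto
    also have "\<dots> = ennreal P * (\<integral>\<^sup>+x. (\<integral>\<^sup>+t. ennreal (t powr (P - 1)) *
           (if 0 < t \<and> ennreal (c * t) < HL_max f x then 1 else 0) \<partial>lborel) \<partial>lborel)"
      by (subst nn_integral_cmult) (auto simp: eq cong: conj_cong)
    also have "(\<integral>\<^sup>+x. (\<integral>\<^sup>+t. ennreal (t powr (P - 1)) *
           (if 0 < t \<and> ennreal (c * t) < HL_max f x then 1 else 0) \<partial>lborel) \<partial>lborel)
       = (\<integral>\<^sup>+t. (\<integral>\<^sup>+x. ennreal (t powr (P - 1)) *
           (if 0 < t \<and> ennreal (c * t) < HL_max f x then 1 else 0) \<partial>lborel) \<partial>lborel)"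
      by (rule lborel_pair.Fubini') measurable
    also have "\<dots> \<le> (\<integral>\<^sup>+t. (\<integral>\<^sup>+x. ennreal A * (f x * (ennreal (t powr (P - 2)) *
           (if 0 < t \<and> ennreal t < f x then 1 else 0))) \<partial>lborel) \<partial>lborel)"
    proof (rule nn_integral_mono)
      fix t
      show "(\<integral>\<^sup>+x. ennreal (t powr (P - 1)) *
           (if 0 < t \<and> ennreal (c * t) < HL_max f x then 1 else 0) \<partial>lborel)
        \<le> (\<integral>\<^sup>+x. ennreal A * (f x * (ennreal (t powr (P - 2)) *
           (if 0 < t \<and> ennreal t < f x then 1 else 0))) \<partial>lborel)"
      proof (cases "0 < t")
        case True
        have "(\<integral>\<^sup>+x. ennreal (t powr (P - 1)) *
           (if 0 < t \<and> ennreal (c * t) < HL_max f x then 1 else 0) \<partial>lborel)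
           = (\<integral>\<^sup>+x. ennreal (t powr (P - 1)) * indicator {x. ennreal (c * t) < HL_max f x} x \<partial>lborel)"
          using True by (intro nn_integral_cong) (auto split: split_indicator)
        also have "\<dots> = ennreal (t powr (P - 1)) * emeasure lborel {x. ennreal (c * t) < HL_max f x}"
          by (rule nn_integral_cmult_indicator) measurable
        also have "\<dots> \<le> ennreal (t powr (P - 1)) *
           (ennreal (A / t) * (\<integral>\<^sup>+x. f x * (if ennreal t < f x then 1 else 0) \<partial>lborel))"
          using True by (intro mult_left_mono lvl) auto
        also have "\<dots> = (ennreal A * ennreal (t powr (P - 2))) *
            (\<integral>\<^sup>+x. f x * (if ennreal t < f x then 1 else 0) \<partial>lborel)"
        proof -
          have "t powr (P - 1) * (A / t) = A * t powr (P - 2)"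
            using True powr_add[of t "P - 2" 1] by (simp add: field_simps)
          then have "ennreal (t powr (P - 1)) * ennreal (A / t) = ennreal A * ennreal (t powr (P - 2))"
            using A True by (simp add: ennreal_mult[symmetric])
          then show ?thesis by (simp add: mult.assoc[symmetric])
        qed
        also have "\<dots> = (\<integral>\<^sup>+x. (ennreal A * ennreal (t powr (P - 2))) *
            (f x * (if ennreal t < f x then 1 else 0)) \<partial>lborel)"
          by (rule nn_integral_cmult[symmetric]) measurable
        also have "\<dots> = (\<integral>\<^sup>+x. ennreal A * (f x * (ennreal (t powr (P - 2)) *
           (if 0 < t \<and> ennreal t < f x then 1 else 0))) \<partial>lborel)"
          using True by (intro nn_integral_cong) (auto simp: mult_ac)
        finally show ?thesis .
      qed simp
    qed
    also have "\<dots> = (\<integral>\<^sup>+x. (\<integral>\<^sup>+t. ennreal A * (f x * (ennreal (t powr (P - 2)) *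
           (if 0 < t \<and> ennreal t < f x then 1 else 0))) \<partial>lborel) \<partial>lborel)"
      by (rule lborel_pair.Fubini') measurable
    \<comment> \<open>After the exchange the inner integral is that of t^(P-2) over (0, f x), namely
      f(x)^(P-1) / (P-1); P > 1 makes it converge at 0.\<close>
    also have "\<dots> \<le> (\<integral>\<^sup>+x. ennreal (A / (P - 1)) * ennreal_powr (f x) P \<partial>lborel)"
    proof (intro nn_integral_mono)
      fix x
      have "(\<integral>\<^sup>+t. ennreal A * (f x * (ennreal (t powr (P - 2)) *
           (if 0 < t \<and> ennreal t < f x then 1 else 0))) \<partial>lborel)
          = ennreal A * (f x * (\<integral>\<^sup>+t. ennreal (t powr (P - 2)) *
           (if 0 < t \<and> ennreal t < f x then 1 else 0) \<partial>lborel))"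
        by (simp add: nn_integral_cmult del: mult_if_delta)
      also have "\<dots> \<le> ennreal (A / (P - 1)) * ennreal_powr (f x) P"
      proof (cases "f x")
        case (real y)
        have "(\<integral>\<^sup>+t. ennreal (t powr (P - 2)) * (if 0 < t \<and> ennreal t < f x then 1 else 0) \<partial>lborel)
          \<le> (\<integral>\<^sup>+t. ennreal (t powr (P - 2)) * indicator {0..y} t \<partial>lborel)"
          using real by (intro nn_integral_mono mult_left_mono) (auto simp: ennreal_less_iff split: split_indicator)
        also have "\<dots> = ennreal (y powr (P - 1) / (P - 1))"
          using nn_integral_powr_from_0[of "P - 2" y] P real by simp
        finally have "ennreal A * (f x * (\<integral>\<^sup>+t. ennreal (t powr (P - 2)) *
           (if 0 < t \<and> ennreal t < f x then 1 else 0) \<partial>lborel))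
           \<le> ennreal A * (ennreal y * ennreal (y powr (P - 1) / (P - 1)))"
          unfolding real by (intro mult_left_mono) auto
        also have "\<dots> = ennreal (A * (y * (y powr (P - 1) / (P - 1))))"
          using A real P by (simp add: ennreal_mult[symmetric])
        also have "A * (y * (y powr (P - 1) / (P - 1))) = A / (P - 1) * y powr P"
          using real P powr_add[of y "P - 1" 1] by (cases "y = 0") (auto simp: field_simps)
        finally show ?thesis using real A P
          by (simp add: ennreal_powr_ennreal ennreal_mult[symmetric])
      next
        case top
        then show ?thesis using A P by (simp add: ennreal_mult_top)
      qed
      finally show "(\<integral>\<^sup>+t. ennreal A * (f x * (ennreal (t powr (P - 2)) *
           (if 0 < t \<and> ennreal t < f x then 1 else 0))) \<partial>lborel) \<le> ennreal (A / (P - 1)) * ennreal_powr (f x) P" .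
    qed
    also have "\<dots> = ennreal (A / (P - 1)) * (\<integral>\<^sup>+x. ennreal_powr (f x) P \<partial>lborel)"
      by (rule nn_integral_cmult) measurable
    finally have "(\<integral>\<^sup>+x. ennreal_powr (HL_max f x) P \<partial>lborel) \<le> ennreal (c powr P) *
       (ennreal P * (ennreal (A / (P - 1)) * (\<integral>\<^sup>+x. ennreal_powr (f x) P \<partial>lborel)))"
      by (simp add: mult_left_mono)
    also have "\<dots> = ennreal (c powr P * P * A / (P - 1)) * (\<integral>\<^sup>+x. ennreal_powr (f x) P \<partial>lborel)"
      using A P by (simp add: mult.assoc[symmetric] ennreal_mult[symmetric])
    finally show ?thesis .
  qed
  show ?thesis using main A P by (intro exI[of _ "c powr P * P * A / (P - 1)"]) auto
qed

section \<open>Polynomially decaying kernels at dyadic scales\<close>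

definition decay_kernel :: "real \<Rightarrow> real \<Rightarrow> 'a::euclidean_space \<Rightarrow> ennreal" where
  "decay_kernel a m z = ennreal (a ^ DIM('a) * (1 + a * norm z) powr (- m))"

lemma borel_measurable_decay_kernel [measurable]: "decay_kernel a m \<in> borel_measurable borel"
  unfolding decay_kernel_def[abs_def] by measurable

lemma decay_kernel_minus: "decay_kernel a m (x - y) = decay_kernel a m (y - x)"
  by (simp add: decay_kernel_def norm_minus_commute)

text \<open>Let k be least with z < 2^k. Either k = 0 and the left side is at most 1, or z \<ge>
  2^(k-1) and hence (1 + z)^(-m) \<le> 2^m 2^(-m k). So the single term with this k already
  dominates.\<close>

lemma powr_neg_le_dyadic_sum:
  fixes z :: real
  assumes "0 \<le> z" "0 < m"
  shows "ennreal ((1 + z) powr (- m)) \<le>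
    (\<Sum>k. ennreal (2 powr m * (2 powr (- m)) ^ k) * (if z < 2 ^ k then 1 else 0))"
proof -
  obtain k where k: "z < 2 ^ k" "(1 + z) powr (- m) \<le> 2 powr m * (2 powr (- m)) ^ k"
  proof (cases "z < 1")
    case True
    have "(1 + z) powr (- m) \<le> 1 powr (- m)"
      using assms by (intro powr_mono2') auto
    also have "\<dots> \<le> 2 powr m" using assms by (simp add: ge_one_powr_ge_zero)
    finally show ?thesis using True by (intro that[of 0]) auto
  next
    case False
    define k where "k = (LEAST k. z < 2 ^ k)"
    have "\<exists>k. z < 2 ^ k" by (simp add: real_arch_pow)
    then have k: "z < 2 ^ k" unfolding k_def by (rule LeastI_ex)
    then obtain l where l: "k = Suc l" using False by (cases k) auto
    have "2 ^ l \<le> z" using not_less_Least[of l "\<lambda>k. z < 2 ^ k"] l by (simp add: k_def)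
    then have "(1 + z) powr (- m) \<le> (2 ^ l) powr (- m)"
      using assms by (intro powr_mono2') auto
    also have "\<dots> = 2 powr m * (2 powr (- m)) ^ k"
      by (simp add: l powr_realpow[symmetric] powr_powr powr_add[symmetric] algebra_simps)
    finally show ?thesis using k that by blast
  qed
  then have "ennreal ((1 + z) powr (- m)) \<le> ennreal (2 powr m * (2 powr (- m)) ^ k) * (if z < 2 ^ k then 1 else 0)"
    by (simp add: ennreal_leI)
  also have "\<dots> \<le> (\<Sum>k. ennreal (2 powr m * (2 powr (- m)) ^ k) * (if z < 2 ^ k then 1 else 0))"
    using sum_le_suminf[of "\<lambda>k. ennreal (2 powr m * (2 powr (- m)) ^ k) * (if z < 2 ^ k then 1 else 0)" "{k}"]
    by simp
  finally show ?thesis .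
qed

text \<open>Decompose the kernel into balls of radius 2^k / a. Each integral over such a ball is at
  most (2^k / a)^n times the maximal function and carries a weight a^n 2^m 2^(-m k), so the terms
  form a geometric series of ratio 2^(n - m), which is where m > n enters.\<close>

lemma decay_conv_le_HL_max:
  assumes m: "real DIM('a) < m"
  shows "\<exists>C\<ge>0. \<forall>(j::int) (f :: 'a::euclidean_space \<Rightarrow> ennreal) x. f \<in> borel_measurable borel \<longrightarrow>
    (\<integral>\<^sup>+y. decay_kernel (2 powr (j/2)) m (x - y) * f y \<partial>lborel) \<le> ennreal C * HL_max f x"
proof (intro exI conjI allI impI)
  define b where "b = 2 powr (real DIM('a) - m)"
  have b: "0 < b" "b < 1" using m by (auto simp: b_def powr_less_one)
  define C where "C = 2 powr m * (1 / (1 - b))"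
  show "0 \<le> C" using b by (simp add: C_def)
  fix j :: int and f :: "'a \<Rightarrow> ennreal" and x
  assume [measurable]: "f \<in> borel_measurable borel"
  define a where "a = 2 powr (j/2)"
  have a: "0 < a" by (simp add: a_def)
  have ball: "(\<integral>\<^sup>+y. f y * indicator (ball x (2 ^ k / a)) y \<partial>lborel) \<le> ennreal ((2 ^ k / a) ^ DIM('a)) * HL_max f x" for k
  proof -
    \<comment> \<open>With a = 2^(j/2) the radii 2^k / a are powers of the square root of 2, which
      is why \<open>HL_max\<close> runs over exponents i/2.\<close>
    have e: "2 ^ k / a = 2 powr ((2 * int k - j) / 2)"
      by (simp add: a_def powr_diff diff_divide_distrib powr_realpow)
    have "(\<integral>\<^sup>+y. f y * indicator (ball x (2 ^ k / a)) y \<partial>lborel) / ennreal ((2 ^ k / a) ^ DIM('a)) \<le> HL_max f x"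
      unfolding HL_max_def e by (rule SUP_upper2[of "2 * int k - j"]) auto
    then have "ennreal ((2 ^ k / a) ^ DIM('a)) * ((\<integral>\<^sup>+y. f y * indicator (ball x (2 ^ k / a)) y \<partial>lborel) / ennreal ((2 ^ k / a) ^ DIM('a)))
       \<le> ennreal ((2 ^ k / a) ^ DIM('a)) * HL_max f x"
      by (rule mult_left_mono) simp
    then show ?thesis
      using a mult_divide_eq_ennreal[of "ennreal ((2 ^ k / a) ^ DIM('a))" "\<integral>\<^sup>+y. f y * indicator (ball x (2 ^ k / a)) y \<partial>lborel"]
      by (simp add: ennreal_times_divide mult.commute)
  qed
  have "(\<integral>\<^sup>+y. decay_kernel a m (x - y) * f y \<partial>lborel) \<le> (\<integral>\<^sup>+y. (\<Sum>k. ennreal (a ^ DIM('a)) *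
     ennreal (2 powr m * (2 powr (- m)) ^ k) * (f y * indicator (ball x (2 ^ k / a)) y)) \<partial>lborel)"
  proof (intro nn_integral_mono)
    fix y
    have "decay_kernel a m (x - y) * f y = ennreal (a ^ DIM('a)) * f y * ennreal ((1 + a * norm (x - y)) powr (- m))"
      using a by (simp add: decay_kernel_def ennreal_mult mult_ac)
    also have "\<dots> \<le> ennreal (a ^ DIM('a)) * f y *
       (\<Sum>k. ennreal (2 powr m * (2 powr (- m)) ^ k) * (if a * norm (x - y) < 2 ^ k then 1 else 0))"
      using a m by (intro mult_left_mono powr_neg_le_dyadic_sum) auto
    also have "\<dots> = (\<Sum>k. ennreal (a ^ DIM('a)) * f y * (ennreal (2 powr m * (2 powr (- m)) ^ k) *
        (if a * norm (x - y) < 2 ^ k then 1 else 0)))"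
      by simp
    also have "\<dots> = (\<Sum>k. ennreal (a ^ DIM('a)) *
      ennreal (2 powr m * (2 powr (- m)) ^ k) * (f y * indicator (ball x (2 ^ k / a)) y))"
    proof (intro suminf_cong)
      fix k
      have "a * norm (x - y) < 2 ^ k \<longleftrightarrow> y \<in> ball x (2 ^ k / a)"
        using a by (simp add: dist_norm field_simps)
      then show "ennreal (a ^ DIM('a)) * f y * (ennreal (2 powr m * (2 powr (- m)) ^ k) *
        (if a * norm (x - y) < 2 ^ k then 1 else 0)) = ennreal (a ^ DIM('a)) *
      ennreal (2 powr m * (2 powr (- m)) ^ k) * (f y * indicator (ball x (2 ^ k / a)) y)"
        by (simp add: mult_ac)
    qed
    finally show "decay_kernel a m (x - y) * f y \<le> \<dots>" .
  qed
  also have "\<dots> = (\<Sum>k. \<integral>\<^sup>+y. ennreal (a ^ DIM('a)) *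
     ennreal (2 powr m * (2 powr (- m)) ^ k) * (f y * indicator (ball x (2 ^ k / a)) y) \<partial>lborel)"
    by (rule nn_integral_suminf) measurable
  also have "\<dots> = (\<Sum>k. ennreal (a ^ DIM('a)) *
     ennreal (2 powr m * (2 powr (- m)) ^ k) * (\<integral>\<^sup>+y. f y * indicator (ball x (2 ^ k / a)) y \<partial>lborel))"
    by (intro suminf_cong nn_integral_cmult) measurable
  also have "\<dots> \<le> (\<Sum>k. ennreal (a ^ DIM('a)) *
     ennreal (2 powr m * (2 powr (- m)) ^ k) * (ennreal ((2 ^ k / a) ^ DIM('a)) * HL_max f x))"
    by (intro suminf_le mult_left_mono ball) auto
  also have "\<dots> = (\<Sum>k. ennreal (2 powr m * b ^ k) * HL_max f x)"
  proof (intro suminf_cong)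
    fix k
    have E: "a ^ DIM('a) * (2 powr m * (2 powr (- m)) ^ k) * (2 ^ k / a) ^ DIM('a) = 2 powr m * b ^ k"
    proof -
      have "b ^ k = (2 powr (- m)) ^ k * (2 ^ DIM('a)) ^ k"
        by (simp add: b_def powr_diff powr_realpow powr_minus field_simps power_divide)
      also have "(2 ^ DIM('a)) ^ k = ((2::real) ^ k) ^ DIM('a)"
        by (simp add: power_mult[symmetric] mult.commute)
      finally show ?thesis using a by (simp add: power_divide)
    qed
    have "ennreal (a ^ DIM('a) * (2 powr m * (2 powr (- m)) ^ k) * (2 ^ k / a) ^ DIM('a)) =
       ennreal (a ^ DIM('a)) * ennreal (2 powr m * (2 powr (- m)) ^ k) * ennreal ((2 ^ k / a) ^ DIM('a))"
      using a by (simp add: ennreal_mult)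
    then show "ennreal (a ^ DIM('a)) * ennreal (2 powr m * (2 powr (- m)) ^ k) * (ennreal ((2 ^ k / a) ^ DIM('a)) * HL_max f x)
       = ennreal (2 powr m * b ^ k) * HL_max f x"
      unfolding E by (simp add: mult.assoc[symmetric])
  qed
  also have "\<dots> = (\<Sum>k. ennreal (2 powr m * b ^ k)) * HL_max f x"
    by simp
  also have "(\<Sum>k. ennreal (2 powr m * b ^ k)) = ennreal C"
    using b sums_mult[OF geometric_sums[of b], of "2 powr m"] unfolding C_def
    by (intro suminf_ennreal_eq) auto
  finally show "(\<integral>\<^sup>+y. decay_kernel (2 powr (j/2)) m (x - y) * f y \<partial>lborel) \<le> ennreal C * HL_max f x"
    by (simp add: a_def)
qed

text \<open>Apply the maximal function bound to the constant 1. The factor a^n in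
  \<open>decay_kernel\<close> is what makes the bound independent of the scale.\<close>

lemma nn_integral_decay_kernel_le:
  assumes m: "real DIM('a) < m"
  shows "\<exists>C\<ge>0. \<forall>(j::int) (x::'a::euclidean_space). (\<integral>\<^sup>+y. decay_kernel (2 powr (j/2)) m (x - y) \<partial>lborel) \<le> ennreal C"
proof -
  obtain C where C: "0 \<le> C" "\<And>(j::int) (f :: 'a::euclidean_space \<Rightarrow> ennreal) x. f \<in> borel_measurable borel \<Longrightarrow>
    (\<integral>\<^sup>+y. decay_kernel (2 powr (j/2)) m (x - y) * f y \<partial>lborel) \<le> ennreal C * HL_max f x"
    using decay_conv_le_HL_max[OF m] by blast
  have "(\<integral>\<^sup>+y. decay_kernel (2 powr (j/2)) m (x - y) \<partial>lborel) \<le> ennreal (C * unit_ball_vol DIM('a))" for j :: int and x :: 'a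
  proof -
    have "(\<integral>\<^sup>+y. decay_kernel (2 powr (j/2)) m (x - y) \<partial>lborel) \<le> ennreal C * HL_max (\<lambda>_. 1) x"
      using C(2)[of "\<lambda>_. 1" j x] by simp
    also have "\<dots> \<le> ennreal C * (ennreal (unit_ball_vol DIM('a)) * 1)"
      by (intro mult_left_mono HL_max_const_le) auto
    finally show ?thesis using C(1) by (simp add: ennreal_mult)
  qed
  with C(1) show ?thesis by (intro exI[of _ "C * unit_ball_vol DIM('a)"]) auto
qed

section \<open>Vector-valued convolution estimates\<close>

definition decay_conv :: "real \<Rightarrow> int \<Rightarrow> ('a::euclidean_space \<Rightarrow> ennreal) \<Rightarrow> 'a \<Rightarrow> ennreal" where
  "decay_conv m j f x = (\<integral>\<^sup>+y. decay_kernel (2 powr (j/2)) m (x - y) * f y \<partial>lborel)"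

lemma borel_measurable_decay_conv [measurable]:
  assumes [measurable]: "f \<in> borel_measurable borel"
  shows "decay_conv m j f \<in> borel_measurable borel"
  unfolding decay_conv_def[abs_def] by measurable

lemma borel_measurable_nn_integral_int [measurable]:
  fixes f :: "int \<Rightarrow> 'b \<Rightarrow> ennreal"
  assumes [measurable]: "\<And>j. f j \<in> borel_measurable M"
  shows "(\<lambda>x. \<integral>\<^sup>+j. f j x \<partial>count_space UNIV) \<in> borel_measurable M"
proof -
  have "(\<integral>\<^sup>+j. f j x \<partial>count_space UNIV) = (\<Sum>n. f (int_decode n) x)" for x
    using nn_integral_bij_count_space[OF bij_int_decode, of "\<lambda>j. f j x"]
    by (simp add: nn_integral_count_space_nat)
  then show ?thesis by simp
qed

lemma decay_conv_mono_AE: "(AE x in lborel. f x \<le> g x) \<Longrightarrow> decay_conv m j f x \<le> decay_conv m j g x"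
  unfolding decay_conv_def by (rule nn_integral_mono_AE) (auto elim!: eventually_mono intro: mult_left_mono)

text \<open>The kernel is even, so Tonelli makes convolution with it symmetric.\<close>

lemma decay_conv_duality:
  fixes f g :: "'a::euclidean_space \<Rightarrow> ennreal"
  assumes [measurable]: "f \<in> borel_measurable borel" "g \<in> borel_measurable borel"
  shows "(\<integral>\<^sup>+x. decay_conv m j f x * g x \<partial>lborel) = (\<integral>\<^sup>+x. f x * decay_conv m j g x \<partial>lborel)"
proof -
  let ?k = "decay_kernel (2 powr (j/2)) m :: 'a \<Rightarrow> ennreal"
  have "(\<integral>\<^sup>+x. decay_conv m j f x * g x \<partial>lborel) = (\<integral>\<^sup>+x. \<integral>\<^sup>+y. ?k (x - y) * f y * g x \<partial>lborel \<partial>lborel)"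
    by (simp add: decay_conv_def nn_integral_multc)
  also have "\<dots> = (\<integral>\<^sup>+y. \<integral>\<^sup>+x. ?k (x - y) * f y * g x \<partial>lborel \<partial>lborel)"
    by (rule lborel_pair.Fubini') measurable
  also have "\<dots> = (\<integral>\<^sup>+y. \<integral>\<^sup>+x. f y * (?k (y - x) * g x) \<partial>lborel \<partial>lborel)"
    by (simp add: mult_ac decay_kernel_minus)
  also have "\<dots> = (\<integral>\<^sup>+x. f x * decay_conv m j g x \<partial>lborel)"
    by (simp add: decay_conv_def nn_integral_cmult)
  finally show ?thesis .
qed

text \<open>Duality against the constant 1 reduces this to the total mass of the kernel, which is
  bounded uniformly in j.\<close>

lemma nn_integral_decay_conv_le:
  assumes m: "real DIM('a) < m"
  shows "\<exists>C\<ge>0. \<forall>(j::int) (f :: 'a::euclidean_space \<Rightarrow> ennreal). f \<in> borel_measurable borel \<longrightarrow>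
    (\<integral>\<^sup>+x. decay_conv m j f x \<partial>lborel) \<le> ennreal C * (\<integral>\<^sup>+x. f x \<partial>lborel)"
proof -
  obtain C where C: "0 \<le> C" "\<And>(j::int) (x::'a). (\<integral>\<^sup>+y. decay_kernel (2 powr (j/2)) m (x - y) \<partial>lborel) \<le> ennreal C"
    using nn_integral_decay_kernel_le[OF m] by blast
  have "(\<integral>\<^sup>+x. decay_conv m j f x \<partial>lborel) \<le> ennreal C * (\<integral>\<^sup>+x. f x \<partial>lborel)"
    if [measurable]: "f \<in> borel_measurable borel" for j and f :: "'a \<Rightarrow> ennreal"
  proof -
    have "(\<integral>\<^sup>+x. decay_conv m j f x \<partial>lborel) = (\<integral>\<^sup>+x. f x * decay_conv m j (\<lambda>_. 1) x \<partial>lborel)"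
      using decay_conv_duality[of f "\<lambda>_. 1" m j] by simp
    also have "\<dots> \<le> (\<integral>\<^sup>+x. f x * ennreal C \<partial>lborel)"
      using C by (intro nn_integral_mono mult_left_mono) (auto simp: decay_conv_def)
    finally show ?thesis by (simp add: nn_integral_cmult mult.commute)
  qed
  then show ?thesis using C(1) by blast
qed

text \<open>Cancel the power of W on the right. Finiteness of W is indispensable, since an infinite
  W satisfies the inequality whenever D is not 0. It serves the truncated integrals of the duality
  argument and, with P = 1/r, the Peetre maximal function.\<close>

lemma ennreal_powr_absorb:
  assumes "W \<noteq> \<infinity>" "W \<le> D * ennreal_powr W (1 - 1 / P)" "1 < P"
  shows "W \<le> ennreal_powr D P"
proof (cases "W = 0")
  case False
  have "ennreal_powr W (1 / P) * ennreal_powr W (1 - 1 / P) \<le> D * ennreal_powr W (1 - 1 / P)"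
    using assms ennreal_powr_add[of "1 / P" "1 - 1 / P" W] by simp
  then have "ennreal_powr W (1 / P) \<le> D"
    using False assms(1) by (simp add: ennreal_mult_le_mult_iff mult.commute[of _ "ennreal_powr W (1 - 1 / P)"])
  then show ?thesis using assms(3) ennreal_powr_le_iff[of "1 / P" W D] by simp
qed simp

text \<open>Truncation in height and in support makes the L^P integrals finite, as absorption
  requires; the truncations increase to G, so monotone convergence removes them afterwards.\<close>

lemma SUP_truncation:
  fixes G :: "'a::real_normed_vector \<Rightarrow> ennreal"
  shows "(SUP N::nat. min (G x) (of_nat N) * indicator (ball 0 (real N)) x) = G x"
proof (rule antisym)
  show "(SUP N::nat. min (G x) (of_nat N) * indicator (ball 0 (real N)) x) \<le> G x"
    by (intro SUP_least) (auto split: split_indicator)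
  obtain N0 :: nat where N0: "norm x < real N0" using reals_Archimedean2 by blast
  \<comment> \<open>The index \<open>max N N0\<close> serves: it is at least N, and the ball of
    radius N0 already contains x.\<close>
  have le: "min (G x) (of_nat N) \<le> (SUP N::nat. min (G x) (of_nat N) * indicator (ball 0 (real N)) x)" for N
    using N0 by (intro SUP_upper2[of "max N N0"])
      (auto simp: min_def split: split_indicator intro: order_trans)
  show "G x \<le> (SUP N::nat. min (G x) (of_nat N) * indicator (ball 0 (real N)) x)"
  proof (cases "G x")
    case (real y)
    obtain N :: nat where "y \<le> real N" using real_arch_simple by blast
    then have "min (G x) (of_nat N) = G x" using real
      by (simp add: min_def ennreal_of_nat_eq_real_of_nat)
    then show ?thesis using le[of N] by simp
  next
    case top
    have "(SUP N. of_nat N :: ennreal) \<le> (SUP N::nat. min (G x) (of_nat N) * indicator (ball 0 (real N)) x)"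
    proof (rule SUP_least)
      fix N
      show "of_nat N \<le> (SUP N::nat. min (G x) (of_nat N) * indicator (ball 0 (real N)) x)"
        using le[of N] unfolding top by simp
    qed
    then show ?thesis unfolding ennreal_SUP_of_nat_eq_top by (rule order_trans[OF top_greatest])
  qed
qed

text \<open>Duality replaces a vector-valued maximal theorem. Test G, the sum of the convolutions,
  against w = v^(P-1) for a truncation v of G, and move every convolution onto w: all are dominated
  by the same multiple of \<open>HL_max w\<close>, so the sum over j falls on the h_j alone. Hoelder
  and the maximal theorem at the conjugate exponent bound W, the integral of v^P, by a constant
  times a lower power of W, which is absorbed. For P = 1 the conjugate exponent is infinite and the
  L^1 bound of each term is enough.\<close>

lemma decay_conv_sum_Lp_bound:
  assumes m: "real DIM('a) < m" and P: "1 \<le> P"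
  shows "\<exists>C\<ge>0. \<forall>h :: int \<Rightarrow> 'a::euclidean_space \<Rightarrow> ennreal. (\<forall>j. h j \<in> borel_measurable borel) \<longrightarrow>
    (\<integral>\<^sup>+x. ennreal_powr (\<integral>\<^sup>+j. decay_conv m j (h j) x \<partial>count_space UNIV) P \<partial>lborel)
      \<le> ennreal C * (\<integral>\<^sup>+x. ennreal_powr (\<integral>\<^sup>+j. h j x \<partial>count_space UNIV) P \<partial>lborel)"
proof (cases "P = 1")
  case True
  obtain C where C: "0 \<le> C" "\<And>(j::int) (f :: 'a \<Rightarrow> ennreal). f \<in> borel_measurable borel \<Longrightarrow>
    (\<integral>\<^sup>+x. decay_conv m j f x \<partial>lborel) \<le> ennreal C * (\<integral>\<^sup>+x. f x \<partial>lborel)"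
    using nn_integral_decay_conv_le[OF m] by blast
  have "(\<integral>\<^sup>+x. \<integral>\<^sup>+j. decay_conv m j (h j) x \<partial>count_space UNIV \<partial>lborel)
      \<le> ennreal C * (\<integral>\<^sup>+x. \<integral>\<^sup>+j. h j x \<partial>count_space UNIV \<partial>lborel)"
    if [measurable]: "\<And>j. h j \<in> borel_measurable borel" for h :: "int \<Rightarrow> 'a \<Rightarrow> ennreal"
  proof -
    have "(\<integral>\<^sup>+x. \<integral>\<^sup>+j. decay_conv m j (h j) x \<partial>count_space UNIV \<partial>lborel)
       = (\<integral>\<^sup>+j. \<integral>\<^sup>+x. decay_conv m j (h j) x \<partial>lborel \<partial>count_space UNIV)"
      by (rule nn_integral_count_space_nn_integral) auto
    also have "\<dots> \<le> (\<integral>\<^sup>+j. ennreal C * (\<integral>\<^sup>+x. h j x \<partial>lborel) \<partial>count_space UNIV)"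
      by (intro nn_integral_mono C) measurable
    also have "\<dots> = ennreal C * (\<integral>\<^sup>+j. \<integral>\<^sup>+x. h j x \<partial>lborel \<partial>count_space UNIV)"
      by (rule nn_integral_cmult) simp
    also have "(\<integral>\<^sup>+j. \<integral>\<^sup>+x. h j x \<partial>lborel \<partial>count_space UNIV) = (\<integral>\<^sup>+x. \<integral>\<^sup>+j. h j x \<partial>count_space UNIV \<partial>lborel)"
      by (rule nn_integral_count_space_nn_integral[symmetric]) auto
    finally show ?thesis .
  qed
  then show ?thesis using C(1) True by auto
next
  case False
  with P have P1: "1 < P" by simp
  define P' where "P' = P / (P - 1)"
  have P': "1 < P'" "(P - 1) * P' = P" "1 - 1 / P = 1 / P'" "1 / P = 1 - 1 / P'"
    using P1 by (auto simp: P'_def field_simps)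
  obtain C where C: "0 \<le> C" "\<And>(j::int) (f :: 'a \<Rightarrow> ennreal) x. f \<in> borel_measurable borel \<Longrightarrow>
    decay_conv m j f x \<le> ennreal C * HL_max f x"
    using decay_conv_le_HL_max[OF m] unfolding decay_conv_def by blast
  obtain B where B: "0 \<le> B" "\<And>f :: 'a \<Rightarrow> ennreal. f \<in> borel_measurable borel \<Longrightarrow>
    (\<integral>\<^sup>+x. ennreal_powr (HL_max f x) P' \<partial>lborel) \<le> ennreal B * (\<integral>\<^sup>+x. ennreal_powr (f x) P' \<partial>lborel)"
    using HL_max_strong_type[OF P'(1)] by blast
  \<comment> \<open>Obtained by raising W^(1/P) \<le> C B^(1/P') V to the power P, where V is the
    L^P norm of the sum of the h_j.\<close>
  define D where "D = (C * B powr (1 / P')) powr P"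
  have "(\<integral>\<^sup>+x. ennreal_powr (\<integral>\<^sup>+j. decay_conv m j (h j) x \<partial>count_space UNIV) P \<partial>lborel)
      \<le> ennreal D * (\<integral>\<^sup>+x. ennreal_powr (\<integral>\<^sup>+j. h j x \<partial>count_space UNIV) P \<partial>lborel)"
    if [measurable]: "\<And>j. h j \<in> borel_measurable borel" for h :: "int \<Rightarrow> 'a \<Rightarrow> ennreal"
  proof -
    define G where "G x = (\<integral>\<^sup>+j. decay_conv m j (h j) x \<partial>count_space UNIV)" for x
    define F where "F x = (\<integral>\<^sup>+j. h j x \<partial>count_space UNIV)" for x
    have [measurable]: "F \<in> borel_measurable borel" "G \<in> borel_measurable borel"
      unfolding F_def[abs_def] G_def[abs_def] by measurable
    define v where "v N x = min (G x) (of_nat N) * indicator (ball 0 (real N)) x" for N :: nat and x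
    have [measurable]: "v N \<in> borel_measurable borel" for N
      unfolding v_def[abs_def] by measurable
    have bound: "(\<integral>\<^sup>+x. ennreal_powr (v N x) P \<partial>lborel) \<le> ennreal D * (\<integral>\<^sup>+x. ennreal_powr (F x) P \<partial>lborel)" for N
    proof -
      \<comment> \<open>The extremal dual function: w^(P') = v^P, so the maximal theorem returns W
        itself.\<close>
      define w where "w x = ennreal_powr (v N x) (P - 1)" for x
      have [measurable]: "w \<in> borel_measurable borel" unfolding w_def[abs_def] by measurable
      define W where "W = (\<integral>\<^sup>+x. ennreal_powr (v N x) P \<partial>lborel)"
      have wP': "ennreal_powr (w x) P' = ennreal_powr (v N x) P" for x
        using P' by (simp add: w_def ennreal_powr_powr)
      have "W \<le> (\<integral>\<^sup>+x. ennreal (real N powr P) * indicator (ball 0 (real N)) (x::'a) \<partial>lborel)"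
        unfolding W_def
      proof (intro nn_integral_mono)
        fix x :: 'a
        have "ennreal_powr (v N x) P \<le> ennreal_powr (of_nat N) P" if "x \<in> ball 0 (real N)"
          using P that by (intro ennreal_powr_mono) (auto simp: v_def)
        then show "ennreal_powr (v N x) P \<le> ennreal (real N powr P) * indicator (ball 0 (real N)) x"
          by (auto simp: v_def ennreal_of_nat_eq_real_of_nat ennreal_powr_ennreal split: split_indicator)
      qed
      also have "\<dots> < \<infinity>" by (subst nn_integral_ball_const) (auto simp: ennreal_mult_less_top)
      finally have Wfin: "W \<noteq> \<infinity>" by simp
      have "W \<le> (\<integral>\<^sup>+x. G x * w x \<partial>lborel)"
        unfolding W_def
      proof (rule nn_integral_mono)
        fix x
        have "ennreal_powr (v N x) P = v N x * w x"
          using P1 ennreal_powr_add[of 1 "P - 1" "v N x"] by (simp add: w_def)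
        also have "\<dots> \<le> G x * w x" by (intro mult_right_mono) (auto simp: v_def split: split_indicator)
        finally show "ennreal_powr (v N x) P \<le> G x * w x" .
      qed
      also have "\<dots> = (\<integral>\<^sup>+x. \<integral>\<^sup>+j. decay_conv m j (h j) x * w x \<partial>count_space UNIV \<partial>lborel)"
        by (simp add: G_def nn_integral_multc)
      also have "\<dots> = (\<integral>\<^sup>+j. \<integral>\<^sup>+x. decay_conv m j (h j) x * w x \<partial>lborel \<partial>count_space UNIV)"
        by (rule nn_integral_count_space_nn_integral) auto
      also have "\<dots> = (\<integral>\<^sup>+j. \<integral>\<^sup>+x. h j x * decay_conv m j w x \<partial>lborel \<partial>count_space UNIV)"
        by (simp add: decay_conv_duality)
      also have "\<dots> \<le> (\<integral>\<^sup>+j. \<integral>\<^sup>+x. h j x * (ennreal C * HL_max w x) \<partial>lborel \<partial>count_space UNIV)"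
        by (intro nn_integral_mono mult_left_mono C) auto
      also have "\<dots> = (\<integral>\<^sup>+x. \<integral>\<^sup>+j. h j x * (ennreal C * HL_max w x) \<partial>count_space UNIV \<partial>lborel)"
        by (rule nn_integral_count_space_nn_integral[symmetric]) auto
      also have "\<dots> = (\<integral>\<^sup>+x. ennreal C * (F x * HL_max w x) \<partial>lborel)"
        by (simp add: F_def nn_integral_cmult mult_ac)
      also have "\<dots> = ennreal C * (\<integral>\<^sup>+x. F x * HL_max w x \<partial>lborel)"
        by (rule nn_integral_cmult) measurable
      finally have W1: "W \<le> ennreal C * (\<integral>\<^sup>+x. F x * HL_max w x \<partial>lborel)" .
      let ?V = "ennreal_powr (\<integral>\<^sup>+x. ennreal_powr (F x) P \<partial>lborel) (1 / P)"
      have "(\<integral>\<^sup>+x. F x * HL_max w x \<partial>lborel) =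
         (\<integral>\<^sup>+x. ennreal_powr (ennreal_powr (F x) P) (1 / P) * ennreal_powr (ennreal_powr (HL_max w x) P') (1 - 1 / P) \<partial>lborel)"
      proof -
        have e: "P * (1 / P) = 1" "P' * (1 - 1 / P) = 1" using P1 P'(1) by (auto simp: P'(3))
        show ?thesis by (simp only: ennreal_powr_powr e ennreal_powr_one)
      qed
      also have "\<dots> \<le> ?V * ennreal_powr (\<integral>\<^sup>+x. ennreal_powr (HL_max w x) P' \<partial>lborel) (1 - 1 / P)"
        using P1 by (intro Hoelder_nn_integral) auto
      also have "\<dots> \<le> ?V * ennreal_powr (ennreal B * W) (1 - 1 / P)"
        using B(2)[of w] P1 by (intro mult_left_mono ennreal_powr_mono) (auto simp: wP' W_def)
      also have "ennreal_powr (ennreal B * W) (1 - 1 / P) = ennreal (B powr (1 / P')) * ennreal_powr W (1 - 1 / P)"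
        using B(1) P'(1,3) by (simp add: ennreal_powr_mult ennreal_powr_ennreal)
      finally have W2: "(\<integral>\<^sup>+x. F x * HL_max w x \<partial>lborel)
         \<le> ?V * (ennreal (B powr (1 / P')) * ennreal_powr W (1 - 1 / P))" .
      have "W \<le> (ennreal (C * B powr (1 / P')) * ?V) * ennreal_powr W (1 - 1 / P)"
        using order_trans[OF W1 mult_left_mono[OF W2]] C(1) by (simp add: ennreal_mult mult_ac)
      from ennreal_powr_absorb[OF Wfin this P1]
      have "W \<le> ennreal_powr (ennreal (C * B powr (1 / P')) * ennreal_powr (\<integral>\<^sup>+x. ennreal_powr (F x) P \<partial>lborel) (1 / P)) P" .
      also have "\<dots> = ennreal D * (\<integral>\<^sup>+x. ennreal_powr (F x) P \<partial>lborel)"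
        using P1 C(1) by (simp add: ennreal_powr_mult ennreal_powr_powr ennreal_powr_ennreal D_def)
      finally show ?thesis by (simp add: W_def)
    qed
    have inc: "v N x \<le> v M x" if "N \<le> M" for N M x
      using that by (auto simp: v_def min_def split: split_indicator intro: order_trans)
    have "(\<integral>\<^sup>+x. ennreal_powr (G x) P \<partial>lborel) = (\<integral>\<^sup>+x. (SUP N. ennreal_powr (v N x) P) \<partial>lborel)"
      using P1 by (simp add: ennreal_powr_SUP[symmetric] v_def SUP_truncation)
    also have "\<dots> = (SUP N. \<integral>\<^sup>+x. ennreal_powr (v N x) P \<partial>lborel)"
      using P1 by (intro nn_integral_monotone_convergence_SUP)
        (auto simp: incseq_def le_fun_def intro!: ennreal_powr_mono inc)
    also have "\<dots> \<le> ennreal D * (\<integral>\<^sup>+x. ennreal_powr (F x) P \<partial>lborel)"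
      by (intro SUP_least bound)
    finally show ?thesis by (simp add: G_def F_def)
  qed
  then show ?thesis by (intro exI[of _ D]) (auto simp: D_def)
qed

text \<open>The endpoint Q = \<infinity>: each h_j is below the supremum, so one scalar maximal
  function dominates all convolutions.\<close>

lemma decay_conv_SUP_Lp_bound:
  assumes m: "real DIM('a) < m" and P: "1 < P"
  shows "\<exists>C\<ge>0. \<forall>h :: int \<Rightarrow> 'a::euclidean_space \<Rightarrow> ennreal. (\<forall>j. h j \<in> borel_measurable borel) \<longrightarrow>
    (\<integral>\<^sup>+x. ennreal_powr (SUP j. decay_conv m j (h j) x) P \<partial>lborel)
      \<le> ennreal C * (\<integral>\<^sup>+x. ennreal_powr (SUP j. h j x) P \<partial>lborel)"
proof -
  obtain C where C: "0 \<le> C" "\<And>(j::int) (f :: 'a \<Rightarrow> ennreal) x. f \<in> borel_measurable borel \<Longrightarrow>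
    decay_conv m j f x \<le> ennreal C * HL_max f x"
    using decay_conv_le_HL_max[OF m] unfolding decay_conv_def by blast
  obtain B where B: "0 \<le> B" "\<And>f :: 'a \<Rightarrow> ennreal. f \<in> borel_measurable borel \<Longrightarrow>
    (\<integral>\<^sup>+x. ennreal_powr (HL_max f x) P \<partial>lborel) \<le> ennreal B * (\<integral>\<^sup>+x. ennreal_powr (f x) P \<partial>lborel)"
    using HL_max_strong_type[OF P] by blast
  have "(\<integral>\<^sup>+x. ennreal_powr (SUP j. decay_conv m j (h j) x) P \<partial>lborel)
      \<le> ennreal (C powr P * B) * (\<integral>\<^sup>+x. ennreal_powr (SUP j. h j x) P \<partial>lborel)"
    if [measurable]: "\<And>j. h j \<in> borel_measurable borel" for h :: "int \<Rightarrow> 'a \<Rightarrow> ennreal"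
  proof -
    have "(SUP j. decay_conv m j (h j) x) \<le> ennreal C * HL_max (\<lambda>x. SUP j. h j x) x" for x
    proof (rule SUP_least)
      fix j
      have "decay_conv m j (h j) x \<le> ennreal C * HL_max (h j) x" by (rule C) measurable
      also have "\<dots> \<le> ennreal C * HL_max (\<lambda>x. SUP j. h j x) x"
        by (intro mult_left_mono HL_max_mono SUP_upper) auto
      finally show "decay_conv m j (h j) x \<le> \<dots>" .
    qed
    then have "(\<integral>\<^sup>+x. ennreal_powr (SUP j. decay_conv m j (h j) x) P \<partial>lborel)
      \<le> (\<integral>\<^sup>+x. ennreal (C powr P) * ennreal_powr (HL_max (\<lambda>x. SUP j. h j x) x) P \<partial>lborel)"
      using P C(1) by (intro nn_integral_mono) (auto simp: ennreal_powr_ennreal[symmetric] ennreal_powr_mult[symmetric]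
         intro!: ennreal_powr_mono)
    also have "\<dots> = ennreal (C powr P) * (\<integral>\<^sup>+x. ennreal_powr (HL_max (\<lambda>x. SUP j. h j x) x) P \<partial>lborel)"
      by (rule nn_integral_cmult) measurable
    also have "\<dots> \<le> ennreal (C powr P) * (ennreal B * (\<integral>\<^sup>+x. ennreal_powr (SUP j. h j x) P \<partial>lborel))"
      by (intro mult_left_mono B) auto
    finally show ?thesis using B(1) by (simp add: ennreal_mult mult.assoc)
  qed
  then show ?thesis using B(1) by (intro exI[of _ "C powr P * B"]) auto
qed

text \<open>With \<theta> = P/Q, Hoelder inside the convolution K at scale j gives K h_j \<le> (K
  A_j)^\<theta> (K S)^(1-\<theta>). Raised to the power Q and summed, this is at most M^(Q-P) times
  the sum of the P-th powers of the functions C \<open>HL_max (A j)\<close>, where M = C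
  \<open>HL_max S\<close>. The A_j are normalized so that their P-th powers sum to at most S^P;
  hence the scalar maximal theorem applies term by term, and a second Hoelder inequality in x
  combines the two factors.\<close>

lemma decay_conv_lq_Lp_bound:
  assumes m: "real DIM('a) < m" and PQ: "1 < P" "P < Q"
  shows "\<exists>C\<ge>0. \<forall>h :: int \<Rightarrow> 'a::euclidean_space \<Rightarrow> ennreal. (\<forall>j. h j \<in> borel_measurable borel) \<longrightarrow>
    (\<integral>\<^sup>+x. ennreal_powr (\<integral>\<^sup>+j. ennreal_powr (decay_conv m j (h j) x) Q \<partial>count_space UNIV) (P / Q) \<partial>lborel)
      \<le> ennreal C * (\<integral>\<^sup>+x. ennreal_powr (\<integral>\<^sup>+j. ennreal_powr (h j x) Q \<partial>count_space UNIV) (P / Q) \<partial>lborel)"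
proof -
  define \<theta> where "\<theta> = P / Q"
  have \<theta>: "0 < \<theta>" "\<theta> < 1" "\<theta> * Q = P" "(1 - \<theta>) * Q = Q - P" "(Q - P) * \<theta> = P * (1 - \<theta>)"
    using PQ by (auto simp: \<theta>_def field_simps)
  obtain C where C: "0 \<le> C" "\<And>(j::int) (f :: 'a \<Rightarrow> ennreal) x. f \<in> borel_measurable borel \<Longrightarrow>
    decay_conv m j f x \<le> ennreal C * HL_max f x"
    using decay_conv_le_HL_max[OF m] unfolding decay_conv_def by blast
  obtain B where B: "0 \<le> B" "\<And>f :: 'a \<Rightarrow> ennreal. f \<in> borel_measurable borel \<Longrightarrow>
    (\<integral>\<^sup>+x. ennreal_powr (HL_max f x) P \<partial>lborel) \<le> ennreal B * (\<integral>\<^sup>+x. ennreal_powr (f x) P \<partial>lborel)"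
    using HL_max_strong_type[OF PQ(1)] by blast
  \<comment> \<open>The summand 1 keeps D positive, so that the right side is infinite when I
    is.\<close>
  define D where "D = C powr P * B + 1"
  have D: "0 < D" using B(1) by (auto simp: D_def add_nonneg_pos)
  have T: "(\<integral>\<^sup>+x. ennreal_powr (ennreal C * HL_max f x) P \<partial>lborel) \<le> ennreal D * (\<integral>\<^sup>+x. ennreal_powr (f x) P \<partial>lborel)"
    if [measurable]: "f \<in> borel_measurable borel" for f :: "'a \<Rightarrow> ennreal"
  proof -
    have "(\<integral>\<^sup>+x. ennreal_powr (ennreal C * HL_max f x) P \<partial>lborel)
       = (\<integral>\<^sup>+x. ennreal (C powr P) * ennreal_powr (HL_max f x) P \<partial>lborel)"
      using PQ C(1) by (simp add: ennreal_powr_mult ennreal_powr_ennreal)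
    also have "\<dots> = ennreal (C powr P) * (\<integral>\<^sup>+x. ennreal_powr (HL_max f x) P \<partial>lborel)"
      by (rule nn_integral_cmult) measurable
    also have "\<dots> \<le> ennreal (C powr P) * (ennreal B * (\<integral>\<^sup>+x. ennreal_powr (f x) P \<partial>lborel))"
      by (intro mult_left_mono B) auto
    also have "\<dots> = ennreal (C powr P * B) * (\<integral>\<^sup>+x. ennreal_powr (f x) P \<partial>lborel)"
      using B(1) by (simp add: ennreal_mult mult.assoc)
    also have "\<dots> \<le> ennreal D * (\<integral>\<^sup>+x. ennreal_powr (f x) P \<partial>lborel)"
      by (intro mult_right_mono ennreal_leI) (auto simp: D_def)
    finally show ?thesis .
  qed
  have "(\<integral>\<^sup>+x. ennreal_powr (\<integral>\<^sup>+j. ennreal_powr (decay_conv m j (h j) x) Q \<partial>count_space UNIV) \<theta> \<partial>lborel)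
      \<le> ennreal D * (\<integral>\<^sup>+x. ennreal_powr (\<integral>\<^sup>+j. ennreal_powr (h j x) Q \<partial>count_space UNIV) \<theta> \<partial>lborel)"
    if h [measurable]: "\<And>j. h j \<in> borel_measurable borel" for h :: "int \<Rightarrow> 'a \<Rightarrow> ennreal"
  proof -
    define S where "S x = ennreal_powr (\<integral>\<^sup>+j. ennreal_powr (h j x) Q \<partial>count_space UNIV) (1 / Q)" for x
    have [measurable]: "S \<in> borel_measurable borel" unfolding S_def[abs_def] by measurable
    have SQ: "(\<integral>\<^sup>+j. ennreal_powr (h j x) Q \<partial>count_space UNIV) = ennreal_powr (S x) Q" for x
      using PQ by (simp add: S_def ennreal_powr_powr)
    define I where "I = (\<integral>\<^sup>+x. ennreal_powr (S x) P \<partial>lborel)"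
    have Ieq: "(\<integral>\<^sup>+x. ennreal_powr (\<integral>\<^sup>+j. ennreal_powr (h j x) Q \<partial>count_space UNIV) \<theta> \<partial>lborel) = I"
      using PQ by (simp add: SQ I_def ennreal_powr_powr \<theta>_def)
    show ?thesis
    proof (cases "I = \<infinity>")
      case True
      then show ?thesis unfolding Ieq using D by (simp add: ennreal_mult_top)
    next
      case False
      have "AE x in lborel. ennreal_powr (S x) P \<noteq> \<infinity>"
        using False unfolding I_def by (intro nn_integral_PInf_AE) auto
      then have Sfin: "AE x in lborel. S x \<noteq> \<infinity>" by simp
      have hS: "h j x \<le> S x" for j x
      proof -
        have "ennreal_powr (h j x) Q \<le> ennreal_powr (S x) Q"
          unfolding SQ[symmetric] by (rule nn_integral_ge_point) simp
        then show ?thesis using PQ by (simp add: ennreal_powr_le_iff ennreal_powr_powr)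
      qed
      \<comment> \<open>Solve h = A^\<theta> S^(1-\<theta>) for A. This recovers h_j where S is
        finite and nonzero; S is finite almost everywhere, and where S = 0 also h_j = 0.\<close>
      define A where "A j x = ennreal_powr (h j x) (Q / P) / ennreal_powr (S x) (Q / P - 1)" for j x
      have [measurable]: "A j \<in> borel_measurable borel" for j unfolding A_def[abs_def] by measurable
      have hA: "AE x in lborel. h j x \<le> ennreal_powr (A j x) \<theta> * ennreal_powr (S x) (1 - \<theta>)" for j
        using Sfin
      proof eventually_elim
        case (elim x)
        show ?case
        proof (cases "S x = 0")
          case True
          then show ?thesis using hS[of j x] by simp
        next
          case False
          have "(Q / P - 1) * \<theta> = 1 - \<theta>" "Q / P * \<theta> = 1" using PQ by (auto simp: \<theta>_def field_simps)
          then have "ennreal_powr (A j x) \<theta> * ennreal_powr (S x) (1 - \<theta>) =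
             h j x / ennreal_powr (S x) (1 - \<theta>) * ennreal_powr (S x) (1 - \<theta>)"
            using \<theta>(1) by (simp add: A_def ennreal_powr_divide ennreal_powr_powr del: times_divide_eq_left)
          also have "\<dots> = h j x"
            using elim False mult_divide_eq_ennreal[of "ennreal_powr (S x) (1 - \<theta>)" "h j x"]
            by (simp add: ennreal_times_divide mult.commute)
          finally show ?thesis by simp
        qed
      qed
      have AS: "(\<integral>\<^sup>+j. ennreal_powr (A j x) P \<partial>count_space UNIV) \<le> ennreal_powr (S x) P" for x
      proof -
        have "(\<integral>\<^sup>+j. ennreal_powr (A j x) P \<partial>count_space UNIV)
           = (\<integral>\<^sup>+j. ennreal_powr (h j x) Q / ennreal_powr (S x) (Q - P) \<partial>count_space UNIV)"
          using PQ by (simp add: A_def ennreal_powr_divide ennreal_powr_powr left_diff_distrib)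
        also have "\<dots> = ennreal_powr (S x) Q / ennreal_powr (S x) (Q - P)"
          by (simp add: nn_integral_divide SQ)
        also have "\<dots> \<le> ennreal_powr (S x) P"
        proof (cases "S x = 0 \<or> S x = \<infinity>")
          case False
          then show ?thesis
            using PQ ennreal_powr_add[of P "Q - P" "S x"] by (simp add: mult_divide_eq_ennreal)
        qed (auto simp: divide_ennreal_def)
        finally show ?thesis .
      qed
      define M where "M x = ennreal C * HL_max S x" for x
      have [measurable]: "M \<in> borel_measurable borel" unfolding M_def[abs_def] by measurable
      have conv: "ennreal_powr (decay_conv m j (h j) x) Q \<le> ennreal_powr (M x) (Q - P) * ennreal_powr (ennreal C * HL_max (A j) x) P" for j x
      proof -
        let ?k = "\<lambda>y. decay_kernel (2 powr (j/2)) m (x - y)"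
        have "decay_conv m j (h j) x \<le> decay_conv m j (\<lambda>x. ennreal_powr (A j x) \<theta> * ennreal_powr (S x) (1 - \<theta>)) x"
          by (rule decay_conv_mono_AE) (rule hA)
        also have "\<dots> = (\<integral>\<^sup>+y. ennreal_powr (?k y * A j y) \<theta> * ennreal_powr (?k y * S y) (1 - \<theta>) \<partial>lborel)"
          unfolding decay_conv_def
        proof (intro nn_integral_cong)
          fix y
          \<comment> \<open>The kernel is shared between the two Hoelder factors in the proportion
            \<theta> to 1 - \<theta>.\<close>
          have "?k y = ennreal_powr (?k y) \<theta> * ennreal_powr (?k y) (1 - \<theta>)"
            using ennreal_powr_add[of \<theta> "1 - \<theta>" "?k y"] \<theta> by simp
          then show "?k y * (ennreal_powr (A j y) \<theta> * ennreal_powr (S y) (1 - \<theta>)) =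
             ennreal_powr (?k y * A j y) \<theta> * ennreal_powr (?k y * S y) (1 - \<theta>)"
            using \<theta> by (simp add: ennreal_powr_mult mult_ac)
        qed
        also have "\<dots> \<le> ennreal_powr (decay_conv m j (A j) x) \<theta> * ennreal_powr (decay_conv m j S x) (1 - \<theta>)"
          unfolding decay_conv_def using \<theta> by (intro Hoelder_nn_integral) auto
        also have "\<dots> \<le> ennreal_powr (ennreal C * HL_max (A j) x) \<theta> * ennreal_powr (M x) (1 - \<theta>)"
          unfolding M_def using \<theta> by (intro mult_mono ennreal_powr_mono C) auto
        finally have "ennreal_powr (decay_conv m j (h j) x) Q
           \<le> ennreal_powr (ennreal_powr (ennreal C * HL_max (A j) x) \<theta> * ennreal_powr (M x) (1 - \<theta>)) Q"
          using PQ by (intro ennreal_powr_mono) auto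
        also have "\<dots> = ennreal_powr (ennreal C * HL_max (A j) x) P * ennreal_powr (M x) (Q - P)"
          using PQ by (subst ennreal_powr_mult) (auto simp: ennreal_powr_powr \<theta>)
        finally show ?thesis by (simp add: mult.commute)
      qed
      define U where "U x = (\<integral>\<^sup>+j. ennreal_powr (ennreal C * HL_max (A j) x) P \<partial>count_space UNIV)" for x
      have [measurable]: "U \<in> borel_measurable borel" unfolding U_def[abs_def] by measurable
      have IU: "(\<integral>\<^sup>+x. U x \<partial>lborel) \<le> ennreal D * I"
      proof -
        have "(\<integral>\<^sup>+x. U x \<partial>lborel) = (\<integral>\<^sup>+j. \<integral>\<^sup>+x. ennreal_powr (ennreal C * HL_max (A j) x) P \<partial>lborel \<partial>count_space UNIV)"
          unfolding U_def by (rule nn_integral_count_space_nn_integral) auto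
        also have "\<dots> \<le> (\<integral>\<^sup>+j. ennreal D * (\<integral>\<^sup>+x. ennreal_powr (A j x) P \<partial>lborel) \<partial>count_space UNIV)"
          by (rule nn_integral_mono) (rule T, measurable)
        also have "\<dots> = ennreal D * (\<integral>\<^sup>+j. (\<integral>\<^sup>+x. ennreal_powr (A j x) P \<partial>lborel) \<partial>count_space UNIV)"
          by (rule nn_integral_cmult) simp
        also have "(\<integral>\<^sup>+j. (\<integral>\<^sup>+x. ennreal_powr (A j x) P \<partial>lborel) \<partial>count_space UNIV) =
           (\<integral>\<^sup>+x. (\<integral>\<^sup>+j. ennreal_powr (A j x) P \<partial>count_space UNIV) \<partial>lborel)"
          by (rule nn_integral_count_space_nn_integral[symmetric]) auto
        also have "\<dots> \<le> I" unfolding I_def by (intro nn_integral_mono AS)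
        finally show ?thesis by (simp add: mult_left_mono)
      qed
      have "(\<integral>\<^sup>+x. ennreal_powr (\<integral>\<^sup>+j. ennreal_powr (decay_conv m j (h j) x) Q \<partial>count_space UNIV) \<theta> \<partial>lborel)
        \<le> (\<integral>\<^sup>+x. ennreal_powr (U x) \<theta> * ennreal_powr (ennreal_powr (M x) P) (1 - \<theta>) \<partial>lborel)"
      proof (rule nn_integral_mono)
        fix x
        have "(\<integral>\<^sup>+j. ennreal_powr (decay_conv m j (h j) x) Q \<partial>count_space UNIV)
          \<le> (\<integral>\<^sup>+j. ennreal_powr (M x) (Q - P) * ennreal_powr (ennreal C * HL_max (A j) x) P \<partial>count_space UNIV)"
          by (intro nn_integral_mono conv)
        also have "\<dots> = ennreal_powr (M x) (Q - P) * U x"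
          by (simp add: U_def nn_integral_cmult)
        finally have "ennreal_powr (\<integral>\<^sup>+j. ennreal_powr (decay_conv m j (h j) x) Q \<partial>count_space UNIV) \<theta>
           \<le> ennreal_powr (ennreal_powr (M x) (Q - P) * U x) \<theta>"
          using \<theta> by (intro ennreal_powr_mono) auto
        also have "\<dots> = ennreal_powr (U x) \<theta> * ennreal_powr (ennreal_powr (M x) P) (1 - \<theta>)"
          using \<theta> by (simp add: ennreal_powr_mult ennreal_powr_powr mult.commute)
        finally show "ennreal_powr (\<integral>\<^sup>+j. ennreal_powr (decay_conv m j (h j) x) Q \<partial>count_space UNIV) \<theta> \<le> \<dots>" .
      qed
      also have "\<dots> \<le> ennreal_powr (\<integral>\<^sup>+x. U x \<partial>lborel) \<theta> * ennreal_powr (\<integral>\<^sup>+x. ennreal_powr (M x) P \<partial>lborel) (1 - \<theta>)"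
        using \<theta> by (intro Hoelder_nn_integral) auto
      also have "\<dots> \<le> ennreal_powr (ennreal D * I) \<theta> * ennreal_powr (ennreal D * I) (1 - \<theta>)"
        using \<theta> T[of S] by (intro mult_mono ennreal_powr_mono IU) (auto simp: M_def I_def)
      also have "\<dots> = ennreal D * I"
        using ennreal_powr_add[of \<theta> "1 - \<theta>" "ennreal D * I"] \<theta> by simp
      finally show ?thesis unfolding Ieq .
    qed
  qed
  then show ?thesis using D unfolding \<theta>_def by (intro exI[of _ D]) auto
qed

section \<open>Pointwise estimate of the Peetre maximal function\<close>

text \<open>The complement is open and null, hence empty.\<close>

lemma AE_lborel_closed_imp_UNIV:
  fixes S :: "'a::euclidean_space set"
  assumes "closed S" "AE x in lborel. x \<in> S" shows "x \<in> S"
proof (rule ccontr)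
  assume "x \<notin> S"
  then have "\<not> negligible (- S)" using assms(1) by (intro open_not_negligible) auto
  moreover have "- S \<in> null_sets lborel"
    using assms by (intro AE_iff_null_sets[THEN iffD2]) auto
  then have "negligible (- S)"
    unfolding negligible_iff_null_sets by (rule null_sets_completionI)
  ultimately show False by simp
qed

lemma AE_le_continuous_imp_le:
  fixes \<phi> :: "'a::euclidean_space \<Rightarrow> real"
  assumes "continuous_on UNIV \<phi>" "AE t in lborel. ennreal (\<phi> t) \<le> Z" shows "ennreal (\<phi> t) \<le> Z"
proof (cases Z)
  case (real z)
  have "closed {t. \<phi> t \<le> z}" by (intro closed_Collect_le assms continuous_intros)
  moreover have "AE t in lborel. t \<in> {t. \<phi> t \<le> z}" using assms(2) real by (simp add: ennreal_le_iff)
  ultimately have "t \<in> {t. \<phi> t \<le> z}" by (rule AE_lborel_closed_imp_UNIV)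
  then show ?thesis using real by (simp add: ennreal_leI)
qed simp

text \<open>The Peetre maximal function with modulus and scale abstracted from the functional
  calculus; later a = 2^(j/2) and g = |\<phi>_j(H)f|.\<close>

definition peetre_sup :: "real \<Rightarrow> real \<Rightarrow> ('a::euclidean_space \<Rightarrow> real) \<Rightarrow> 'a \<Rightarrow> ennreal" where
  "peetre_sup a s g x = (SUP t. ennreal (g t / (1 + a * norm (x - t)) powr s))"

lemma one_plus_pos: "0 < a \<Longrightarrow> 0 < 1 + a * norm z" for a :: real
  by (simp add: add_pos_nonneg)

lemma one_plus_neq_0: "0 < a \<Longrightarrow> 1 + a * norm z \<noteq> 0" for a :: real
  using one_plus_pos[of a z] by linarith

text \<open>The supremum is uncountable, but each superlevel set is a union of open sets, so the
  function is lower semicontinuous and hence Borel.\<close>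

lemma borel_measurable_peetre_sup:
  fixes g :: "'a::euclidean_space \<Rightarrow> real"
  assumes "0 < a"
  shows "peetre_sup a s g \<in> borel_measurable borel"
proof (rule borel_measurableI_greater)
  fix y
  have "open {x. y < ennreal (g t / (1 + a * norm (x - t)) powr s)}" for t
    using one_plus_neq_0[OF assms] by (intro open_Collect_less continuous_on_ennreal continuous_intros) auto
  then have "open (\<Union>t. {x. y < ennreal (g t / (1 + a * norm (x - t)) powr s)})" by blast
  also have "(\<Union>t. {x. y < ennreal (g t / (1 + a * norm (x - t)) powr s)}) = {x. y < peetre_sup a s g x}"
    by (auto simp: peetre_sup_def less_SUP_iff)
  finally show "{x \<in> space borel. y < peetre_sup a s g x} \<in> sets borel" by simp
qed

lemma le_peetre_sup: "ennreal (g x) \<le> peetre_sup a s g x"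
  unfolding peetre_sup_def by (rule SUP_upper2[of x]) auto

text \<open>Bounds derived from the reproducing identity hold for almost every t only; continuity of
  g extends them to the whole supremum.\<close>

lemma peetre_sup_le_AE_bound:
  fixes g :: "'a::euclidean_space \<Rightarrow> real"
  assumes "0 < a" "continuous_on UNIV g"
    and "AE t in lborel. ennreal (g t / (1 + a * norm (x - t)) powr s) \<le> Z"
  shows "peetre_sup a s g x \<le> Z"
  unfolding peetre_sup_def
proof (rule SUP_least)
  fix t
  have "continuous_on UNIV (\<lambda>t. g t / (1 + a * norm (x - t)) powr s)"
    using one_plus_neq_0[OF assms(1)] by (intro continuous_intros assms) auto
  from AE_le_continuous_imp_le[OF this assms(3)]
  show "ennreal (g t / (1 + a * norm (x - t)) powr s) \<le> Z" .
qed

lemma peetre_triangle: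
  fixes x y t :: "'a::real_normed_vector"
  assumes "0 < a"
  shows "1 + a * norm (x - y) \<le> (1 + a * norm (x - t)) * (1 + a * norm (t - y))"
proof -
  have "a * norm (x - y) \<le> a * (norm (x - t) + norm (t - y))"
    using assms norm_triangle_ineq[of "x - t" "t - y"] by (intro mult_left_mono) auto
  moreover have "0 \<le> (a * norm (x - t)) * (a * norm (t - y))"
    using assms by (intro mult_nonneg_nonneg) auto
  ultimately show ?thesis by (simp add: algebra_simps)
qed

text \<open>The weight (1 + a|x-t|)^s of the supremum is traded, through the submultiplicative
  triangle inequality, for s powers of decay in t - y; what remains depends on x - y and no longer
  on t.\<close>

lemma kernel_transfer:
  fixes x y t :: "'a::real_normed_vector"
  assumes "0 < a" "0 \<le> s" "s \<le> N"
  shows "(1 + a * norm (t - y)) powr (- N) / (1 + a * norm (x - t)) powr s \<le> (1 + a * norm (x - y)) powr (- s)"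
proof -
  have p: "0 < 1 + a * norm z" for z :: 'a using assms(1) by (rule one_plus_pos)
  have "(1 + a * norm (x - y)) powr s \<le> ((1 + a * norm (x - t)) * (1 + a * norm (t - y))) powr s"
    using assms p[of "x - y"] by (intro powr_mono2 peetre_triangle) auto
  also have "\<dots> = (1 + a * norm (x - t)) powr s * (1 + a * norm (t - y)) powr s"
    using p by (simp add: powr_mult less_imp_le)
  also have "\<dots> \<le> (1 + a * norm (x - t)) powr s * (1 + a * norm (t - y)) powr N"
    using assms by (intro mult_left_mono powr_mono) auto
  finally have "(1 + a * norm (x - y)) powr s \<le> (1 + a * norm (x - t)) powr s * (1 + a * norm (t - y)) powr N" .
  then show ?thesis using p[of "x - y"] p[of "x - t"] p[of "t - y"]
    by (simp add: powr_minus field_simps)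
qed

text \<open>By definition of w, g(y) \<le> w (1 + a|x-y|)^s. Inserting this in the factor g^(1-r)
  costs w^(1-r) and weakens the decay exponent from s to s - s(1-r) = s r. The result W \<le> C0 I
  W^(1-r) is absorbed, W being finite because of the bound M on g.\<close>

lemma peetre_pointwise_small:
  fixes g :: "'a::euclidean_space \<Rightarrow> real"
  assumes a: "0 < a" and g: "continuous_on UNIV g" "\<And>t. 0 \<le> g t" "\<And>t. g t \<le> M"
    and r: "0 < r" "r < 1" and s: "0 < s" "s \<le> N" and C0: "0 \<le> C0"
    and repr: "AE t in lborel. ennreal (g t) \<le> ennreal C0 * (\<integral>\<^sup>+y. decay_kernel a N (t - y) * ennreal (g y) \<partial>lborel)"
  shows "ennreal_powr (peetre_sup a s g x) r
    \<le> ennreal C0 * (\<integral>\<^sup>+y. decay_kernel a (s * r) (x - y) * ennreal (g y powr r) \<partial>lborel)"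
proof -
  have p: "0 < 1 + a * norm z" for z :: 'a using a by (rule one_plus_pos)
  have [measurable]: "g \<in> borel_measurable borel"
    using g(1) by (rule borel_measurable_continuous_onI)
  define W where "W = peetre_sup a s g x"
  have "W \<le> ennreal M"
    unfolding W_def peetre_sup_def
  proof (intro SUP_least ennreal_leI)
    fix t
    have "g t / (1 + a * norm (x - t)) powr s \<le> g t / 1"
      using a s g(2)[of t] p[of "x - t"] by (intro divide_left_mono) (auto simp: ge_one_powr_ge_zero)
    then show "g t / (1 + a * norm (x - t)) powr s \<le> M" using g(3)[of t] by simp
  qed
  then have Wfin: "W \<noteq> \<infinity>" by (auto simp: top_unique)
  define w where "w = enn2real W"
  have w: "W = ennreal w" "0 \<le> w" using Wfin by (auto simp: w_def less_top)
  have gw: "g y \<le> w * (1 + a * norm (x - y)) powr s" for y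
  proof -
    have "ennreal (g y / (1 + a * norm (x - y)) powr s) \<le> W"
      unfolding W_def peetre_sup_def by (rule SUP_upper) simp
    then have "g y / (1 + a * norm (x - y)) powr s \<le> w"
      using w by (simp add: ennreal_le_iff)
    then show ?thesis using p[of "x - y"] by (simp add: field_simps)
  qed
  define I where "I = (\<integral>\<^sup>+y. decay_kernel a (s * r) (x - y) * ennreal (g y powr r) \<partial>lborel)"
  have "W \<le> ennreal C0 * I * ennreal_powr W (1 - r)"
    unfolding W_def
  proof (rule peetre_sup_le_AE_bound[OF a g(1)])
    show "AE t in lborel. ennreal (g t / (1 + a * norm (x - t)) powr s)
       \<le> ennreal C0 * I * ennreal_powr (peetre_sup a s g x) (1 - r)"
      using repr
    proof eventually_elim
      case (elim t)
      let ?d = "1 / (1 + a * norm (x - t)) powr s"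
      have "ennreal (g t / (1 + a * norm (x - t)) powr s) = ennreal (g t) * ennreal ?d"
        using g(2)[of t] by (simp add: ennreal_mult[symmetric])
      also have "\<dots> \<le> (ennreal C0 * (\<integral>\<^sup>+y. decay_kernel a N (t - y) * ennreal (g y) \<partial>lborel)) * ennreal ?d"
        by (intro mult_right_mono elim) simp
      also have "\<dots> = ennreal C0 * (\<integral>\<^sup>+y. decay_kernel a N (t - y) * ennreal (g y) * ennreal ?d \<partial>lborel)"
        by (subst nn_integral_multc) (auto simp: mult.assoc)
      also have "\<dots> \<le> ennreal C0 * (\<integral>\<^sup>+y. decay_kernel a (s * r) (x - y) * ennreal (g y powr r) * ennreal (w powr (1 - r)) \<partial>lborel)"
      proof (intro mult_left_mono nn_integral_mono)
        fix y
        let ?X = "1 + a * norm (x - y)"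
        have "g y = g y powr r * g y powr (1 - r)"
          using g(2)[of y] by (cases "g y = 0") (auto simp: powr_add[symmetric])
        also have "\<dots> \<le> g y powr r * (w * ?X powr s) powr (1 - r)"
          using g(2)[of y] gw[of y] r by (intro mult_left_mono powr_mono2) auto
        also have "\<dots> = g y powr r * w powr (1 - r) * ?X powr (s * (1 - r))"
          using w by (simp add: powr_mult powr_powr)
        finally have "(1 + a * norm (t - y)) powr (- N) * ?d * g y
           \<le> ?X powr (- s) * (g y powr r * w powr (1 - r) * ?X powr (s * (1 - r)))"
          using kernel_transfer[OF a, of s N t y x] s g(2)[of y] by (intro mult_mono) auto
        also have "\<dots> = ?X powr (- (s * r)) * g y powr r * w powr (1 - r)"
          using p[of "x - y"] powr_add[of ?X "- s" "s * (1 - r)"] by (simp add: algebra_simps)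
        finally have "a ^ DIM('a) * ((1 + a * norm (t - y)) powr (- N) * ?d * g y)
           \<le> a ^ DIM('a) * (?X powr (- (s * r)) * g y powr r * w powr (1 - r))"
          using a by (intro mult_left_mono) auto
        then show "decay_kernel a N (t - y) * ennreal (g y) * ennreal ?d
          \<le> decay_kernel a (s * r) (x - y) * ennreal (g y powr r) * ennreal (w powr (1 - r))"
          unfolding decay_kernel_def using a g(2)[of y]
          by (simp add: ennreal_mult[symmetric] mult_ac ennreal_leI)
      qed simp
      also have "\<dots> = ennreal C0 * I * ennreal_powr W (1 - r)"
        unfolding I_def w(1) by (subst nn_integral_multc) (auto simp: mult.assoc ennreal_powr_ennreal w(2))
      finally show ?case by (simp add: W_def)
    qed
  qed
  then have "W \<le> ennreal_powr (ennreal C0 * I) (1 / r)"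
    using r Wfin by (intro ennreal_powr_absorb) auto
  then show ?thesis using r by (simp add: ennreal_powr_le_iff W_def I_def)
qed

text \<open>Jensen's inequality for a kernel of mass at most K replaces absorption: the r-th power
  of the kernel integral of g is at most K^(r-1) times that of g^r. The weight of the supremum
  becomes (1 + a|x-t|)^(s r), to which \<open>kernel_transfer\<close> applies since s r \<le>
  N.\<close>

lemma peetre_pointwise_large:
  fixes g :: "'a::euclidean_space \<Rightarrow> real"
  assumes a: "0 < a" and g: "continuous_on UNIV g" "\<And>t. 0 \<le> g t"
    and r: "1 \<le> r" and s: "0 < s" "s * r \<le> N" and C0: "0 \<le> C0"
    and K: "0 \<le> K" "\<And>x::'a. (\<integral>\<^sup>+y. decay_kernel a N (x - y) \<partial>lborel) \<le> ennreal K"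
    and repr: "AE t in lborel. ennreal (g t) \<le> ennreal C0 * (\<integral>\<^sup>+y. decay_kernel a N (t - y) * ennreal (g y) \<partial>lborel)"
  shows "ennreal_powr (peetre_sup a s g x) r
    \<le> ennreal (C0 powr r * K powr (r - 1)) * (\<integral>\<^sup>+y. decay_kernel a (s * r) (x - y) * ennreal (g y powr r) \<partial>lborel)"
proof -
  have p: "0 < 1 + a * norm z" for z :: 'a using a by (rule one_plus_pos)
  have [measurable]: "g \<in> borel_measurable borel"
    using g(1) by (rule borel_measurable_continuous_onI)
  let ?I = "\<integral>\<^sup>+y. decay_kernel a (s * r) (x - y) * ennreal (g y powr r) \<partial>lborel"
  let ?D = "C0 powr r * K powr (r - 1)"
  have "peetre_sup a s g x \<le> ennreal_powr (ennreal ?D * ?I) (1 / r)"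
  proof (rule peetre_sup_le_AE_bound[OF a g(1)])
    show "AE t in lborel. ennreal (g t / (1 + a * norm (x - t)) powr s) \<le> ennreal_powr (ennreal ?D * ?I) (1 / r)"
      using repr
    proof eventually_elim
      case (elim t)
      let ?d = "1 / (1 + a * norm (x - t)) powr (s * r)"
      have "ennreal_powr (ennreal (g t / (1 + a * norm (x - t)) powr s)) r = ennreal_powr (ennreal (g t)) r * ennreal ?d"
        using g(2)[of t] p[of "x - t"]
        by (simp add: ennreal_powr_ennreal ennreal_mult[symmetric] powr_divide powr_powr)
      also have "\<dots> \<le> ennreal_powr (ennreal C0 * (\<integral>\<^sup>+y. decay_kernel a N (t - y) * ennreal (g y) \<partial>lborel)) r * ennreal ?d"
        using r by (intro mult_right_mono ennreal_powr_mono elim) auto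
      also have "\<dots> = ennreal (C0 powr r) * ennreal_powr (\<integral>\<^sup>+y. decay_kernel a N (t - y) * ennreal (g y) \<partial>lborel) r * ennreal ?d"
        using r C0 by (simp add: ennreal_powr_mult ennreal_powr_ennreal)
      also have "\<dots> \<le> ennreal (C0 powr r) * (ennreal (K powr (r - 1)) *
          (\<integral>\<^sup>+y. decay_kernel a N (t - y) * ennreal (g y powr r) \<partial>lborel)) * ennreal ?d"
      proof (intro mult_right_mono mult_left_mono)
        have "ennreal_powr (\<integral>\<^sup>+y. decay_kernel a N (t - y) * ennreal (g y) \<partial>lborel) r
          \<le> ennreal_powr (\<integral>\<^sup>+y. decay_kernel a N (t - y) \<partial>lborel) (r - 1) * (\<integral>\<^sup>+y. decay_kernel a N (t - y) * ennreal_powr (ennreal (g y)) r \<partial>lborel)"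
          using r by (intro Jensen_powr_nn_integral) auto
        also have "\<dots> \<le> ennreal_powr (ennreal K) (r - 1) * (\<integral>\<^sup>+y. decay_kernel a N (t - y) * ennreal_powr (ennreal (g y)) r \<partial>lborel)"
          using r K by (intro mult_right_mono ennreal_powr_mono) auto
        finally show "ennreal_powr (\<integral>\<^sup>+y. decay_kernel a N (t - y) * ennreal (g y) \<partial>lborel) r \<le>
           ennreal (K powr (r - 1)) * (\<integral>\<^sup>+y. decay_kernel a N (t - y) * ennreal (g y powr r) \<partial>lborel)"
          using K(1) g(2) by (simp add: ennreal_powr_ennreal)
      qed auto
      also have "\<dots> = ennreal ?D * (\<integral>\<^sup>+y. decay_kernel a N (t - y) * ennreal (g y powr r) * ennreal ?d \<partial>lborel)"
        by (subst nn_integral_multc) (auto simp: ennreal_mult mult_ac)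
      also have "\<dots> \<le> ennreal ?D * ?I"
      proof (intro mult_left_mono nn_integral_mono)
        fix y
        have "a ^ DIM('a) * ((1 + a * norm (t - y)) powr (- N) * ?d) * g y powr r
           \<le> a ^ DIM('a) * (1 + a * norm (x - y)) powr (- (s * r)) * g y powr r"
          using a s r kernel_transfer[OF a, of "s * r" N t y x] by (intro mult_right_mono mult_left_mono) auto
        then show "decay_kernel a N (t - y) * ennreal (g y powr r) * ennreal ?d \<le> decay_kernel a (s * r) (x - y) * ennreal (g y powr r)"
          unfolding decay_kernel_def using a by (simp add: ennreal_mult[symmetric] mult_ac ennreal_leI)
      qed simp
      finally show ?case using r by (simp add: ennreal_powr_le_iff)
    qed
  qed
  then show ?thesis using r by (simp add: ennreal_powr_le_iff)
qed

section \<open>Quasi-norm estimates\<close>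

lemma Lp_qnorm_finite:
  "p \<noteq> \<infinity> \<Longrightarrow> Lp_qnorm p F = ennreal_powr (\<integral>\<^sup>+x. ennreal_powr (F x) (enn2real p) \<partial>lborel) (1 / enn2real p)"
  by (simp add: Lp_qnorm_def)

lemma lq_qnorm_finite:
  "q \<noteq> \<infinity> \<Longrightarrow> lq_qnorm q a = ennreal_powr (\<integral>\<^sup>+j. ennreal_powr (a j) (enn2real q) \<partial>count_space UNIV) (1 / enn2real q)"
  by (simp add: lq_qnorm_def infsum_int_eq_nn_integral)

lemma lq_qnorm_mono:
  assumes "\<And>j. a j \<le> b j" shows "lq_qnorm q a \<le> lq_qnorm q b"
proof (cases "q = \<infinity>")
  case True
  then show ?thesis unfolding lq_qnorm_def by (auto intro!: SUP_mono' assms)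
next
  case False
  then show ?thesis
    by (auto simp: lq_qnorm_finite intro!: ennreal_powr_mono nn_integral_mono assms)
qed

lemma lq_qnorm_cmult:
  assumes "0 < q" shows "lq_qnorm q (\<lambda>j. c * a j) = c * lq_qnorm q a"
proof (cases "q = \<infinity>")
  case True
  then show ?thesis by (simp add: lq_qnorm_def SUP_mult_left_ennreal)
next
  case False
  then have "0 < enn2real q" using assms by (simp add: enn2real_positive_iff less_top)
  then show ?thesis using False
    by (simp add: lq_qnorm_finite ennreal_powr_mult nn_integral_cmult ennreal_powr_powr)
qed

lemma lq_qnorm_measurable [measurable]:
  assumes [measurable]: "\<And>j. F j \<in> borel_measurable M"
  shows "(\<lambda>x. lq_qnorm q (\<lambda>j. F j x)) \<in> borel_measurable M"
  by (cases "q = \<infinity>") (simp_all add: lq_qnorm_finite, simp add: lq_qnorm_def)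

lemma Lp_qnorm_mono:
  assumes "\<And>x. F x \<le> G x" "F \<in> borel_measurable borel" shows "Lp_qnorm p F \<le> Lp_qnorm p G"
proof (cases "p = \<infinity>")
  case True
  then show ?thesis using assms by (auto simp: Lp_qnorm_def intro!: esssup_mono)
next
  case False
  then show ?thesis
    by (auto simp: Lp_qnorm_finite intro!: ennreal_powr_mono nn_integral_mono assms)
qed

lemma decay_conv_cmult:
  assumes [measurable]: "f \<in> borel_measurable borel"
  shows "decay_conv m j (\<lambda>y. c * f y) x = c * decay_conv m j f x"
proof -
  have "decay_conv m j (\<lambda>y. c * f y) x = (\<integral>\<^sup>+y. c * (decay_kernel (2 powr (j/2)) m (x - y) * f y) \<partial>lborel)"
    by (simp add: decay_conv_def mult_ac)
  then show ?thesis by (simp add: decay_conv_def nn_integral_cmult)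
qed

lemma Lp_qnorm_le_of_integral_le:
  assumes "0 < p" "p \<noteq> \<infinity>" "0 \<le> D"
    and "(\<integral>\<^sup>+x. ennreal_powr (F x) (enn2real p) \<partial>lborel) \<le> ennreal D * (\<integral>\<^sup>+x. ennreal_powr (G x) (enn2real p) \<partial>lborel)"
  shows "Lp_qnorm p F \<le> ennreal (D powr (1 / enn2real p)) * Lp_qnorm p G"
proof -
  have P: "0 < enn2real p" using assms by (simp add: enn2real_positive_iff less_top)
  have "Lp_qnorm p F \<le> ennreal_powr (ennreal D * (\<integral>\<^sup>+x. ennreal_powr (G x) (enn2real p) \<partial>lborel)) (1 / enn2real p)"
    using assms P by (simp add: Lp_qnorm_finite ennreal_powr_mono)
  then show ?thesis using assms P by (simp add: Lp_qnorm_finite ennreal_powr_mult ennreal_powr_ennreal)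
qed

text \<open>With r = q the pointwise hypothesis can be summed over j as it stands; what remains is
  the L^(p/q) bound for sums of convolutions, available because p/q \<ge> 1.\<close>

lemma Lp_lq_bound_le:
  assumes p: "0 < p" "p \<noteq> \<infinity>" and q: "0 < q" "q \<le> p"
    and m: "real DIM('a) < m" and C: "0 \<le> C"
  shows "\<exists>D\<ge>0. \<forall>X Y :: int \<Rightarrow> 'a::euclidean_space \<Rightarrow> ennreal. (\<forall>j. Y j \<in> borel_measurable borel) \<longrightarrow>
    (\<forall>j x. ennreal_powr (X j x) (enn2real q) \<le> ennreal C * decay_conv m j (\<lambda>y. ennreal_powr (Y j y) (enn2real q)) x) \<longrightarrow>
    Lp_qnorm p (\<lambda>x. lq_qnorm q (\<lambda>j. X j x)) \<le> ennreal D * Lp_qnorm p (\<lambda>x. lq_qnorm q (\<lambda>j. Y j x))"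
proof -
  define P where "P = enn2real p"
  define Q where "Q = enn2real q"
  have qfin: "q \<noteq> \<infinity>" using p q by (auto simp: top_unique)
  have PQ: "0 < Q" "0 < P" "Q \<le> P"
    using p q qfin unfolding P_def Q_def by (auto simp: enn2real_positive_iff less_top enn2real_mono)
  obtain B where B: "0 \<le> B" "\<And>h :: int \<Rightarrow> 'a \<Rightarrow> ennreal. (\<And>j. h j \<in> borel_measurable borel) \<Longrightarrow>
    (\<integral>\<^sup>+x. ennreal_powr (\<integral>\<^sup>+j. decay_conv m j (h j) x \<partial>count_space UNIV) (P / Q) \<partial>lborel)
      \<le> ennreal B * (\<integral>\<^sup>+x. ennreal_powr (\<integral>\<^sup>+j. h j x \<partial>count_space UNIV) (P / Q) \<partial>lborel)"
    using decay_conv_sum_Lp_bound[OF m, of "P / Q"] PQ by auto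
  have lq: "ennreal_powr (lq_qnorm q (\<lambda>j. Z j x)) P = ennreal_powr (\<integral>\<^sup>+j. ennreal_powr (Z j x) Q \<partial>count_space UNIV) (P / Q)"
    for Z :: "int \<Rightarrow> 'a \<Rightarrow> ennreal" and x
    using qfin by (simp add: lq_qnorm_finite ennreal_powr_powr Q_def)
  have "Lp_qnorm p (\<lambda>x. lq_qnorm q (\<lambda>j. X j x)) \<le> ennreal ((C powr (P / Q) * B) powr (1 / P)) * Lp_qnorm p (\<lambda>x. lq_qnorm q (\<lambda>j. Y j x))"
    if [measurable]: "\<And>j. Y j \<in> borel_measurable borel" and le: "\<And>j x. ennreal_powr (X j x) Q \<le>
       ennreal C * decay_conv m j (\<lambda>y. ennreal_powr (Y j y) Q) x" for X Y :: "int \<Rightarrow> 'a \<Rightarrow> ennreal"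
    unfolding P_def
  proof (rule Lp_qnorm_le_of_integral_le[OF p])
    let ?K = "\<lambda>x. \<integral>\<^sup>+j. decay_conv m j (\<lambda>y. ennreal_powr (Y j y) Q) x \<partial>count_space UNIV"
    have "(\<integral>\<^sup>+x. ennreal_powr (lq_qnorm q (\<lambda>j. X j x)) P \<partial>lborel)
      \<le> (\<integral>\<^sup>+x. ennreal (C powr (P / Q)) * ennreal_powr (?K x) (P / Q) \<partial>lborel)"
    proof (intro nn_integral_mono)
      fix x
      have "(\<integral>\<^sup>+j. ennreal_powr (X j x) Q \<partial>count_space UNIV)
        \<le> (\<integral>\<^sup>+j. ennreal C * decay_conv m j (\<lambda>y. ennreal_powr (Y j y) Q) x \<partial>count_space UNIV)"
        by (intro nn_integral_mono le)
      also have "\<dots> = ennreal C * ?K x" by (simp add: nn_integral_cmult)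
      finally show "ennreal_powr (lq_qnorm q (\<lambda>j. X j x)) P \<le> ennreal (C powr (P / Q)) * ennreal_powr (?K x) (P / Q)"
        unfolding lq using PQ C
        by (simp add: ennreal_powr_ennreal[symmetric] ennreal_powr_mult[symmetric] ennreal_powr_mono)
    qed
    also have "\<dots> = ennreal (C powr (P / Q)) * (\<integral>\<^sup>+x. ennreal_powr (?K x) (P / Q) \<partial>lborel)"
      by (rule nn_integral_cmult) measurable
    also have "\<dots> \<le> ennreal (C powr (P / Q)) * (ennreal B *
        (\<integral>\<^sup>+x. ennreal_powr (\<integral>\<^sup>+j. ennreal_powr (Y j x) Q \<partial>count_space UNIV) (P / Q) \<partial>lborel))"
      by (intro mult_left_mono B) auto
    finally show "(\<integral>\<^sup>+x. ennreal_powr (lq_qnorm q (\<lambda>j. X j x)) (enn2real p) \<partial>lborel)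
      \<le> ennreal (C powr (enn2real p / Q) * B) * (\<integral>\<^sup>+x. ennreal_powr (lq_qnorm q (\<lambda>j. Y j x)) (enn2real p) \<partial>lborel)"
      using B(1) unfolding P_def[symmetric] lq by (simp add: ennreal_mult mult.assoc)
  qed (use B in simp)
  then show ?thesis unfolding Q_def by (intro exI[of _ "(C powr (P / enn2real q) * B) powr (1 / P)"]) auto
qed

text \<open>Here r < p < q, so for the r-th powers the exponents p/r < q/r both exceed 1 and the
  scalar maximal theorem is available at p/r.\<close>

lemma Lp_lq_bound_gt:
  assumes p: "0 < p" "p \<noteq> \<infinity>" and q: "p < q" and r: "0 < r" "r < enn2real p"
    and m: "real DIM('a) < m" and C: "0 \<le> C"
  shows "\<exists>D\<ge>0. \<forall>X Y :: int \<Rightarrow> 'a::euclidean_space \<Rightarrow> ennreal. (\<forall>j. Y j \<in> borel_measurable borel) \<longrightarrow>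
    (\<forall>j x. ennreal_powr (X j x) r \<le> ennreal C * decay_conv m j (\<lambda>y. ennreal_powr (Y j y) r) x) \<longrightarrow>
    Lp_qnorm p (\<lambda>x. lq_qnorm q (\<lambda>j. X j x)) \<le> ennreal D * Lp_qnorm p (\<lambda>x. lq_qnorm q (\<lambda>j. Y j x))"
proof -
  define P where "P = enn2real p / r"
  have P: "1 < P" "enn2real p = r * P" using r by (auto simp: P_def)
  \<comment> \<open>The l^(q/r) norm, written through \<open>lq_qnorm\<close> so that homogeneity
    and monotonicity come at once for finite and infinite q.\<close>
  define L where "L a = ennreal_powr (lq_qnorm q (\<lambda>j. ennreal_powr (a j) (1 / r))) r" for a
  have Lp: "ennreal_powr (lq_qnorm q a) (enn2real p) = ennreal_powr (L (\<lambda>j. ennreal_powr (a j) r)) P" for a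
    using r P by (simp add: L_def ennreal_powr_powr)
  have Lmono: "L a \<le> L b" if "\<And>j. a j \<le> b j" for a b
    unfolding L_def using r that by (intro ennreal_powr_mono lq_qnorm_mono) auto
  have Lcmult: "L (\<lambda>j. c * a j) = c * L a" for c a
  proof -
    have "0 < q" using p q by auto
    then show ?thesis using r by (simp add: L_def ennreal_powr_mult lq_qnorm_cmult ennreal_powr_powr)
  qed
  have "\<exists>B\<ge>0. \<forall>h :: int \<Rightarrow> 'a \<Rightarrow> ennreal. (\<forall>j. h j \<in> borel_measurable borel) \<longrightarrow>
    (\<integral>\<^sup>+x. ennreal_powr (L (\<lambda>j. decay_conv m j (h j) x)) P \<partial>lborel)
      \<le> ennreal B * (\<integral>\<^sup>+x. ennreal_powr (L (\<lambda>j. h j x)) P \<partial>lborel)"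
  proof (cases "q = \<infinity>")
    case True
    have "L a = (SUP j. a j)" for a
      using r by (simp add: L_def lq_qnorm_def True ennreal_powr_SUP ennreal_powr_powr)
    then show ?thesis using decay_conv_SUP_Lp_bound[OF m P(1)] by simp
  next
    case False
    define Q where "Q = enn2real q / r"
    have pq: "enn2real p < enn2real q"
      using q p False by (cases p; cases q) (auto simp: ennreal_less_iff)
    then have Q: "P < Q" "enn2real q = r * Q" "0 < enn2real q" using r by (auto simp: P_def Q_def divide_strict_right_mono)
    have "ennreal_powr (L a) P = ennreal_powr (\<integral>\<^sup>+j. ennreal_powr (a j) Q \<partial>count_space UNIV) (P / Q)" for a
      using False r Q by (simp add: L_def lq_qnorm_finite ennreal_powr_powr)
    then show ?thesis using decay_conv_lq_Lp_bound[OF m P(1) Q(1)] by simp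
  qed
  then obtain B where B: "0 \<le> B" "\<And>h :: int \<Rightarrow> 'a \<Rightarrow> ennreal. (\<And>j. h j \<in> borel_measurable borel) \<Longrightarrow>
    (\<integral>\<^sup>+x. ennreal_powr (L (\<lambda>j. decay_conv m j (h j) x)) P \<partial>lborel)
      \<le> ennreal B * (\<integral>\<^sup>+x. ennreal_powr (L (\<lambda>j. h j x)) P \<partial>lborel)" by blast
  have Lmeas [measurable]: "(\<lambda>x. L (\<lambda>j. F j x)) \<in> borel_measurable borel"
    if [measurable]: "\<And>j. F j \<in> borel_measurable borel" for F :: "int \<Rightarrow> 'a \<Rightarrow> ennreal"
    unfolding L_def by measurable
  have "Lp_qnorm p (\<lambda>x. lq_qnorm q (\<lambda>j. X j x)) \<le> ennreal ((C powr P * B) powr (1 / enn2real p)) * Lp_qnorm p (\<lambda>x. lq_qnorm q (\<lambda>j. Y j x))"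
    if [measurable]: "\<And>j. Y j \<in> borel_measurable borel" and le: "\<And>j x. ennreal_powr (X j x) r \<le>
       ennreal C * decay_conv m j (\<lambda>y. ennreal_powr (Y j y) r) x" for X Y :: "int \<Rightarrow> 'a \<Rightarrow> ennreal"
  proof (rule Lp_qnorm_le_of_integral_le[OF p])
    let ?K = "\<lambda>x. L (\<lambda>j. decay_conv m j (\<lambda>y. ennreal_powr (Y j y) r) x)"
    have "(\<integral>\<^sup>+x. ennreal_powr (lq_qnorm q (\<lambda>j. X j x)) (enn2real p) \<partial>lborel)
      \<le> (\<integral>\<^sup>+x. ennreal (C powr P) * ennreal_powr (?K x) P \<partial>lborel)"
    proof (intro nn_integral_mono)
      fix x
      have "L (\<lambda>j. ennreal_powr (X j x) r) \<le> ennreal C * ?K x"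
        unfolding Lcmult[symmetric] by (intro Lmono le)
      then show "ennreal_powr (lq_qnorm q (\<lambda>j. X j x)) (enn2real p) \<le> ennreal (C powr P) * ennreal_powr (?K x) P"
        unfolding Lp using P C
        by (simp add: ennreal_powr_ennreal[symmetric] ennreal_powr_mult[symmetric] ennreal_powr_mono)
    qed
    also have "\<dots> = ennreal (C powr P) * (\<integral>\<^sup>+x. ennreal_powr (?K x) P \<partial>lborel)"
      by (rule nn_integral_cmult) measurable
    also have "\<dots> \<le> ennreal (C powr P) * (ennreal B *
        (\<integral>\<^sup>+x. ennreal_powr (L (\<lambda>j. ennreal_powr (Y j x) r)) P \<partial>lborel))"
      by (intro mult_left_mono B) auto
    finally show "(\<integral>\<^sup>+x. ennreal_powr (lq_qnorm q (\<lambda>j. X j x)) (enn2real p) \<partial>lborel)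
      \<le> ennreal (C powr P * B) * (\<integral>\<^sup>+x. ennreal_powr (lq_qnorm q (\<lambda>j. Y j x)) (enn2real p) \<partial>lborel)"
      using B(1) unfolding Lp by (simp add: ennreal_mult mult.assoc)
  qed (use B in simp)
  then show ?thesis by (intro exI[of _ "(C powr P * B) powr (1 / enn2real p)"]) auto
qed

text \<open>The interface between operator theory and real analysis. The bound M may depend on g,
  since it only serves to make maximal functions finite; C is the constant that has to be uniform.
  The inequality is required almost everywhere, as the identity behind it holds only there.\<close>

definition reproducing :: "nat \<Rightarrow> real \<Rightarrow> int \<Rightarrow> ('a::euclidean_space \<Rightarrow> real) \<Rightarrow> bool" where
  "reproducing N C j g \<longleftrightarrow> continuous_on UNIV g \<and> (\<forall>t. 0 \<le> g t) \<and> (\<exists>M. \<forall>t. g t \<le> M) \<and>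
     (AE t in lborel. ennreal (g t) \<le> ennreal C * decay_conv (real N) j (\<lambda>y. ennreal (g y)) t)"

lemma reproducing_measurable: "reproducing N C j g \<Longrightarrow> g \<in> borel_measurable borel"
  unfolding reproducing_def by (auto intro: borel_measurable_continuous_onI)

lemma peetre_pointwise:
  assumes r: "0 < r" and s: "0 < s" and N: "s \<le> real N" "s * r \<le> real N" "real DIM('a) < real N" and C0: "0 \<le> C0"
  shows "\<exists>C\<ge>0. \<forall>(j::int) (g :: 'a::euclidean_space \<Rightarrow> real) x. reproducing N C0 j g \<longrightarrow>
    ennreal_powr (peetre_sup (2 powr (j/2)) s g x) r \<le> ennreal C * decay_conv (s * r) j (\<lambda>y. ennreal_powr (ennreal (g y)) r) x"
proof (cases "r < 1")
  case True
  have "ennreal_powr (peetre_sup (2 powr (j/2)) s g x) r \<le> ennreal C0 * decay_conv (s * r) j (\<lambda>y. ennreal_powr (ennreal (g y)) r) x"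
    if g: "reproducing N C0 j g" for j :: int and g :: "'a \<Rightarrow> real" and x
  proof -
    obtain M where M: "\<And>t. g t \<le> M" using g by (auto simp: reproducing_def)
    show ?thesis
      using peetre_pointwise_small[where a = "2 powr (real_of_int j/2)" and g = g and x = x, OF _ _ _ M r True s N(1) C0] g
      by (simp add: reproducing_def decay_conv_def ennreal_powr_ennreal)
  qed
  then show ?thesis using C0 by blast
next
  case False
  obtain K where K: "0 \<le> K" "\<And>(j::int) (x::'a). (\<integral>\<^sup>+y. decay_kernel (2 powr (j/2)) (real N) (x - y) \<partial>lborel) \<le> ennreal K"
    using nn_integral_decay_kernel_le[OF N(3)] by blast
  have "ennreal_powr (peetre_sup (2 powr (j/2)) s g x) r
     \<le> ennreal (C0 powr r * K powr (r - 1)) * decay_conv (s * r) j (\<lambda>y. ennreal_powr (ennreal (g y)) r) x"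
    if g: "reproducing N C0 j g" for j :: int and g :: "'a \<Rightarrow> real" and x
    using peetre_pointwise_large[where a = "2 powr (real_of_int j/2)" and g = g and x = x and r = r, OF _ _ _ _ s N(2) C0 K(1) K(2)] g False
    by (simp add: reproducing_def decay_conv_def ennreal_powr_ennreal)
  then show ?thesis by (intro exI[of _ "C0 powr r * K powr (r - 1)"]) auto
qed

text \<open>The weights are at least 1, and a continuous g is bounded everywhere by its essential
  supremum.\<close>

lemma peetre_sup_Linf_le:
  fixes g :: "'a::euclidean_space \<Rightarrow> real"
  assumes a: "0 < a" and s: "0 < s" and g: "continuous_on UNIV g" "\<And>t. 0 \<le> g t"
  shows "esssup lborel (peetre_sup a s g) \<le> esssup lborel (\<lambda>x. ennreal (g x))"
proof (rule esssup_I)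
  show "peetre_sup a s g \<in> borel_measurable lborel"
    using borel_measurable_peetre_sup[OF a] by simp
  have "ennreal (g t) \<le> esssup lborel (\<lambda>x. ennreal (g x))" for t
    by (rule AE_le_continuous_imp_le[OF g(1) esssup_AE])
  moreover have "ennreal (g t / (1 + a * norm (x - t)) powr s) \<le> ennreal (g t)" for t x
  proof -
    have "g t / (1 + a * norm (x - t)) powr s \<le> g t / 1"
      using a s g(2)[of t] one_plus_pos[OF a, of "x - t"] by (intro divide_left_mono) (auto simp: ge_one_powr_ge_zero)
    then show ?thesis by (simp add: ennreal_leI)
  qed
  ultimately show "AE x in lborel. peetre_sup a s g x \<le> esssup lborel (\<lambda>x. ennreal (g x))"
    by (auto simp: peetre_sup_def intro!: AE_I2 SUP_least intro: order_trans)
qed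

section \<open>Norm inequalities for reproducing families\<close>

lemma exponent_condition:
  fixes p :: ennreal
  assumes "0 < p" "p \<noteq> \<infinity>" "0 < s" "of_nat n / p < ennreal s" shows "real n < s * enn2real p"
proof (cases p)
  case (real P)
  then have "0 < P" using assms by auto
  then show ?thesis using real assms
    by (simp add: ennreal_of_nat_eq_real_of_nat divide_ennreal ennreal_less_iff field_simps)
qed (use assms in auto)

text \<open>For finite p take r = p: the condition s p > n makes the kernel of the pointwise
  estimate integrable, so the L^1 bound for convolutions suffices for each j, and the l^q norm is
  applied last. N is quantified before C0 because the reproducing constant is available only for a
  given N.\<close>

theorem besov_peetre_bound:
  fixes p q :: ennreal
  assumes p: "0 < p" and q: "0 < q" and s: "0 < s" "of_nat DIM('a) / p < ennreal s"
  shows "\<exists>N. \<forall>C0\<ge>0. \<exists>C\<ge>0. \<forall>g :: int \<Rightarrow> 'a::euclidean_space \<Rightarrow> real. (\<forall>j. reproducing N C0 j (g j)) \<longrightarrow>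
    lq_qnorm q (\<lambda>j. c j * Lp_qnorm p (peetre_sup (2 powr (j/2)) s (g j)))
      \<le> ennreal C * lq_qnorm q (\<lambda>j. c j * Lp_qnorm p (\<lambda>x. ennreal (g j x)))"
proof -
  have "\<exists>N. \<forall>C0\<ge>0. \<exists>C\<ge>0. \<forall>(j::int) (g :: 'a \<Rightarrow> real). reproducing N C0 j g \<longrightarrow>
    Lp_qnorm p (peetre_sup (2 powr (j/2)) s g) \<le> ennreal C * Lp_qnorm p (\<lambda>x. ennreal (g x))"
  proof (cases "p = \<infinity>")
    case True
    have "Lp_qnorm p (peetre_sup (2 powr (j/2)) s g) \<le> ennreal 1 * Lp_qnorm p (\<lambda>x. ennreal (g x))"
      if "reproducing 0 C0 j g" for C0 and j :: int and g :: "'a \<Rightarrow> real"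
      using peetre_sup_Linf_le[OF _ s(1), of "2 powr (real_of_int j/2)" g] that True
      by (auto simp: Lp_qnorm_def reproducing_def)
    then show ?thesis by (meson zero_le_one)
  next
    case False
    define P where "P = enn2real p"
    have P: "0 < P" using p False by (simp add: P_def enn2real_positive_iff less_top)
    have m: "real DIM('a) < s * P" using exponent_condition[OF p False s] by (simp add: P_def)
    \<comment> \<open>One N that exceeds s, s P and n at the same time, as
      \<open>peetre_pointwise\<close> asks for both regimes of r.\<close>
    obtain N where N: "s + s * P + real DIM('a) < real N" using reals_Archimedean2 by blast
    have N': "s \<le> real N" "s * P \<le> real N" "real DIM('a) < real N"
      using N s(1) mult_pos_pos[OF s(1) P] of_nat_0_le_iff[of "DIM('a)", where 'a=real] by linarith+
    have "\<exists>C\<ge>0. \<forall>(j::int) (g :: 'a \<Rightarrow> real). reproducing N C0 j g \<longrightarrow>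
      Lp_qnorm p (peetre_sup (2 powr (j/2)) s g) \<le> ennreal C * Lp_qnorm p (\<lambda>x. ennreal (g x))" if C0: "0 \<le> C0" for C0
    proof -
      obtain C where C: "0 \<le> C" "\<And>(j::int) (g :: 'a \<Rightarrow> real) x. reproducing N C0 j g \<Longrightarrow>
        ennreal_powr (peetre_sup (2 powr (j/2)) s g x) P \<le> ennreal C * decay_conv (s * P) j (\<lambda>y. ennreal_powr (ennreal (g y)) P) x"
        using peetre_pointwise[OF P s(1) N' C0] by blast
      obtain B where B: "0 \<le> B" "\<And>(j::int) (f :: 'a \<Rightarrow> ennreal). f \<in> borel_measurable borel \<Longrightarrow>
        (\<integral>\<^sup>+x. decay_conv (s * P) j f x \<partial>lborel) \<le> ennreal B * (\<integral>\<^sup>+x. f x \<partial>lborel)"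
        using nn_integral_decay_conv_le[OF m] by blast
      have "Lp_qnorm p (peetre_sup (2 powr (j/2)) s g) \<le> ennreal ((C * B) powr (1 / P)) * Lp_qnorm p (\<lambda>x. ennreal (g x))"
        if g: "reproducing N C0 j g" for j :: int and g :: "'a \<Rightarrow> real"
        unfolding P_def
      proof (rule Lp_qnorm_le_of_integral_le[OF p False])
        have [measurable]: "g \<in> borel_measurable borel" using g by (rule reproducing_measurable)
        have "(\<integral>\<^sup>+x. ennreal_powr (peetre_sup (2 powr (j/2)) s g x) P \<partial>lborel)
          \<le> (\<integral>\<^sup>+x. ennreal C * decay_conv (s * P) j (\<lambda>y. ennreal_powr (ennreal (g y)) P) x \<partial>lborel)"
          by (intro nn_integral_mono C g)
        also have "\<dots> = ennreal C * (\<integral>\<^sup>+x. decay_conv (s * P) j (\<lambda>y. ennreal_powr (ennreal (g y)) P) x \<partial>lborel)"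
          by (rule nn_integral_cmult) measurable
        also have "\<dots> \<le> ennreal C * (ennreal B * (\<integral>\<^sup>+x. ennreal_powr (ennreal (g x)) P \<partial>lborel))"
          by (intro mult_left_mono B) auto
        finally show "(\<integral>\<^sup>+x. ennreal_powr (peetre_sup (2 powr (j/2)) s g x) (enn2real p) \<partial>lborel)
          \<le> ennreal (C * B) * (\<integral>\<^sup>+x. ennreal_powr (ennreal (g x)) (enn2real p) \<partial>lborel)"
          using B(1) C(1) by (simp add: ennreal_mult mult.assoc P_def)
      qed (use B C in simp)
      then show ?thesis by (intro exI[of _ "(C * B) powr (1 / P)"]) auto
    qed
    then show ?thesis by blast
  qed
  then obtain N where N: "\<And>C0. 0 \<le> C0 \<Longrightarrow> \<exists>C\<ge>0. \<forall>(j::int) (g :: 'a \<Rightarrow> real). reproducing N C0 j g \<longrightarrow>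
    Lp_qnorm p (peetre_sup (2 powr (j/2)) s g) \<le> ennreal C * Lp_qnorm p (\<lambda>x. ennreal (g x))" by blast
  show ?thesis
  proof (rule exI[of _ N], intro allI impI)
    fix C0 :: real assume "0 \<le> C0"
    then obtain C where C: "0 \<le> C" "\<And>(j::int) (g :: 'a \<Rightarrow> real). reproducing N C0 j g \<Longrightarrow>
      Lp_qnorm p (peetre_sup (2 powr (j/2)) s g) \<le> ennreal C * Lp_qnorm p (\<lambda>x. ennreal (g x))"
      using N by blast
    have "lq_qnorm q (\<lambda>j. c j * Lp_qnorm p (peetre_sup (2 powr (j/2)) s (g j)))
      \<le> ennreal C * lq_qnorm q (\<lambda>j. c j * Lp_qnorm p (\<lambda>x. ennreal (g j x)))"
      if "\<forall>j. reproducing N C0 j (g j)" for g :: "int \<Rightarrow> 'a \<Rightarrow> real"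
    proof -
      have "c j * Lp_qnorm p (peetre_sup (2 powr (j/2)) s (g j)) \<le> ennreal C * (c j * Lp_qnorm p (\<lambda>x. ennreal (g j x)))" for j
        using mult_left_mono[OF C(2)[of j "g j"], of "c j"] that by (simp add: mult_ac)
      then have "lq_qnorm q (\<lambda>j. c j * Lp_qnorm p (peetre_sup (2 powr (j/2)) s (g j)))
        \<le> lq_qnorm q (\<lambda>j. ennreal C * (c j * Lp_qnorm p (\<lambda>x. ennreal (g j x))))"
        by (rule lq_qnorm_mono)
      then show ?thesis by (simp add: lq_qnorm_cmult[OF q])
    qed
    then show "\<exists>C\<ge>0. \<forall>g :: int \<Rightarrow> 'a \<Rightarrow> real. (\<forall>j. reproducing N C0 j (g j)) \<longrightarrow>
      lq_qnorm q (\<lambda>j. c j * Lp_qnorm p (peetre_sup (2 powr (j/2)) s (g j)))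
      \<le> ennreal C * lq_qnorm q (\<lambda>j. c j * Lp_qnorm p (\<lambda>x. ennreal (g j x)))" using C(1) by blast
  qed
qed

text \<open>The choice of r decides the argument: r = q if q \<le> p, and otherwise any r strictly
  between n/s and p. In both cases s r > n by the assumption on \<open>min p q\<close>. The weights
  c_j are constant in x and pass through the convolution.\<close>

theorem triebel_lizorkin_peetre_bound:
  fixes p q :: ennreal
  assumes p: "0 < p" "p \<noteq> \<infinity>" and q: "0 < q" and s: "0 < s" "of_nat DIM('a) / min p q < ennreal s"
  shows "\<exists>N. \<forall>C0\<ge>0. \<exists>C\<ge>0. \<forall>g :: int \<Rightarrow> 'a::euclidean_space \<Rightarrow> real. (\<forall>j. reproducing N C0 j (g j)) \<longrightarrow>
    Lp_qnorm p (\<lambda>x. lq_qnorm q (\<lambda>j. c j * peetre_sup (2 powr (j/2)) s (g j) x))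
      \<le> ennreal C * Lp_qnorm p (\<lambda>x. lq_qnorm q (\<lambda>j. c j * ennreal (g j x)))"
proof -
  have "\<exists>r>0. real DIM('a) < s * r \<and> (\<forall>C\<ge>0. \<exists>D\<ge>0. \<forall>X Y :: int \<Rightarrow> 'a \<Rightarrow> ennreal. (\<forall>j. Y j \<in> borel_measurable borel) \<longrightarrow>
    (\<forall>j x. ennreal_powr (X j x) r \<le> ennreal C * decay_conv (s * r) j (\<lambda>y. ennreal_powr (Y j y) r) x) \<longrightarrow>
    Lp_qnorm p (\<lambda>x. lq_qnorm q (\<lambda>j. X j x)) \<le> ennreal D * Lp_qnorm p (\<lambda>x. lq_qnorm q (\<lambda>j. Y j x)))"
  proof (cases "q \<le> p")
    case True
    then have qfin: "q \<noteq> \<infinity>" using p by (auto simp: top_unique)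
    have "of_nat DIM('a) / q < ennreal s" using s True by (simp add: min_def split: if_splits)
    from exponent_condition[OF q qfin s(1) this] have m: "real DIM('a) < s * enn2real q" .
    have "0 < enn2real q" using q qfin by (simp add: enn2real_positive_iff less_top)
    then show ?thesis using m Lp_lq_bound_le[OF p q True m]
      by (intro exI[of _ "enn2real q"]) auto
  next
    case False
    then have "of_nat DIM('a) / p < ennreal s" using s by (simp add: min_def split: if_splits)
    from exponent_condition[OF p s(1) this] have "real DIM('a) / s < enn2real p"
      using s by (simp add: field_simps)
    then obtain r where r: "real DIM('a) / s < r" "r < enn2real p" using dense by blast
    then have "0 < r" using s(1) by (meson divide_nonneg_pos of_nat_0_le_iff order_le_less_trans)
    moreover have "real DIM('a) < s * r" using r s by (simp add: field_simps)
    ultimately show ?thesis using Lp_lq_bound_gt[where 'a='a, OF p _ _ r(2), of q] False by (auto simp: not_le)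
  qed
  then obtain r where r: "0 < r" "real DIM('a) < s * r" and
    bd: "\<And>C. 0 \<le> C \<Longrightarrow> \<exists>D\<ge>0. \<forall>X Y :: int \<Rightarrow> 'a \<Rightarrow> ennreal. (\<forall>j. Y j \<in> borel_measurable borel) \<longrightarrow>
    (\<forall>j x. ennreal_powr (X j x) r \<le> ennreal C * decay_conv (s * r) j (\<lambda>y. ennreal_powr (Y j y) r) x) \<longrightarrow>
    Lp_qnorm p (\<lambda>x. lq_qnorm q (\<lambda>j. X j x)) \<le> ennreal D * Lp_qnorm p (\<lambda>x. lq_qnorm q (\<lambda>j. Y j x))"
    by blast
  obtain N where N: "s + s * r + real DIM('a) < real N" using reals_Archimedean2 by blast
  have N': "s \<le> real N" "s * r \<le> real N" "real DIM('a) < real N"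
    using N s(1) mult_pos_pos[OF s(1) r(1)] of_nat_0_le_iff[of "DIM('a)", where 'a=real] by linarith+
  show ?thesis
  proof (rule exI[of _ N], intro allI impI)
    fix C0 :: real assume C0: "0 \<le> C0"
    obtain C where C: "0 \<le> C" "\<And>(j::int) (g :: 'a \<Rightarrow> real) x. reproducing N C0 j g \<Longrightarrow>
        ennreal_powr (peetre_sup (2 powr (j/2)) s g x) r \<le> ennreal C * decay_conv (s * r) j (\<lambda>y. ennreal_powr (ennreal (g y)) r) x"
        using peetre_pointwise[OF r(1) s(1) N' C0] by blast
    obtain D where D: "0 \<le> D" "\<And>X Y :: int \<Rightarrow> 'a \<Rightarrow> ennreal. (\<And>j. Y j \<in> borel_measurable borel) \<Longrightarrow>
      (\<And>j x. ennreal_powr (X j x) r \<le> ennreal C * decay_conv (s * r) j (\<lambda>y. ennreal_powr (Y j y) r) x) \<Longrightarrow>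
      Lp_qnorm p (\<lambda>x. lq_qnorm q (\<lambda>j. X j x)) \<le> ennreal D * Lp_qnorm p (\<lambda>x. lq_qnorm q (\<lambda>j. Y j x))"
      using bd[OF C(1)] by blast
    have "Lp_qnorm p (\<lambda>x. lq_qnorm q (\<lambda>j. c j * peetre_sup (2 powr (j/2)) s (g j) x))
      \<le> ennreal D * Lp_qnorm p (\<lambda>x. lq_qnorm q (\<lambda>j. c j * ennreal (g j x)))"
      if g: "\<forall>j. reproducing N C0 j (g j)" for g :: "int \<Rightarrow> 'a \<Rightarrow> real"
    proof (rule D(2))
      have [measurable]: "g j \<in> borel_measurable borel" for j using g reproducing_measurable by blast
      show "(\<lambda>x. c j * ennreal (g j x)) \<in> borel_measurable borel" for j by measurable
      show "ennreal_powr (c j * peetre_sup (2 powr (j/2)) s (g j) x) r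
        \<le> ennreal C * decay_conv (s * r) j (\<lambda>y. ennreal_powr (c j * ennreal (g j y)) r) x" for j x
      proof -
        have "ennreal_powr (c j * peetre_sup (2 powr (j/2)) s (g j) x) r
           \<le> ennreal_powr (c j) r * (ennreal C * decay_conv (s * r) j (\<lambda>y. ennreal_powr (ennreal (g j y)) r) x)"
          using r g C(2)[of j "g j" x] by (simp add: ennreal_powr_mult mult_left_mono)
        also have "\<dots> = ennreal C * decay_conv (s * r) j (\<lambda>y. ennreal_powr (c j * ennreal (g j y)) r) x"
          using r by (simp add: ennreal_powr_mult decay_conv_cmult mult_ac)
        finally show ?thesis .
      qed
    qed
    then show "\<exists>C\<ge>0. \<forall>g :: int \<Rightarrow> 'a \<Rightarrow> real. (\<forall>j. reproducing N C0 j (g j)) \<longrightarrow>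
      Lp_qnorm p (\<lambda>x. lq_qnorm q (\<lambda>j. c j * peetre_sup (2 powr (j/2)) s (g j) x))
      \<le> ennreal C * Lp_qnorm p (\<lambda>x. lq_qnorm q (\<lambda>j. c j * ennreal (g j x)))" using D(1) by blast
  qed
qed

section \<open>The space \<open>L\<^sub>2\<close>\<close>

lemma L2_measurable [measurable_dest]: "f \<in> L2 \<Longrightarrow> f \<in> borel_measurable borel"
  by (simp add: L2_def)

lemma L2_integrable_sq: "f \<in> L2 \<Longrightarrow> integrable lborel (\<lambda>x. (norm (f x))\<^sup>2)"
  by (simp add: L2_def)

lemma L2_integrable_mult:
  assumes "f \<in> L2" "g \<in> L2" shows "integrable lborel (\<lambda>x. f x * cnj (g x))"
proof (rule Bochner_Integration.integrable_bound)
  show "integrable lborel (\<lambda>x. (norm (f x))\<^sup>2 + (norm (g x))\<^sup>2)"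
    using assms by (intro Bochner_Integration.integrable_add L2_integrable_sq)
  have [measurable]: "f \<in> borel_measurable borel" "g \<in> borel_measurable borel"
    using assms by (auto dest: L2_measurable)
  show "(\<lambda>x. f x * cnj (g x)) \<in> borel_measurable lborel"
    by (intro borel_measurable_times measurable_compose[OF _ borel_measurable_continuous_onI[of cnj]]) (auto intro: continuous_intros)
  have "a * b \<le> a\<^sup>2 + b\<^sup>2" for a b :: real
    using sum_squares_bound[of a b] zero_le_power2[of a] zero_le_power2[of b] by linarith
  then show "AE x in lborel. norm (f x * cnj (g x)) \<le> norm ((norm (f x))\<^sup>2 + (norm (g x))\<^sup>2)"
    by (auto simp: norm_mult)
qed

lemma L2_add_cmult:
  assumes "f \<in> L2" "g \<in> L2" shows "(\<lambda>x. f x + c * g x) \<in> L2"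
proof -
  have [measurable]: "f \<in> borel_measurable borel" "g \<in> borel_measurable borel"
    using assms by (auto dest: L2_measurable)
  have "integrable lborel (\<lambda>x. (norm (f x + c * g x))\<^sup>2)"
  proof (rule Bochner_Integration.integrable_bound)
    show "integrable lborel (\<lambda>x. 2 * (norm (f x))\<^sup>2 + (2 * (norm c)\<^sup>2) * (norm (g x))\<^sup>2)"
      using assms by (intro Bochner_Integration.integrable_add integrable_mult_right L2_integrable_sq)
    have "(norm (f x + c * g x))\<^sup>2 \<le> 2 * (norm (f x))\<^sup>2 + (2 * (norm c)\<^sup>2) * (norm (g x))\<^sup>2" for x
    proof -
      have "(norm (f x + c * g x))\<^sup>2 \<le> (norm (f x) + norm (c * g x))\<^sup>2"
        by (intro power_mono norm_triangle_ineq) simp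
      also have "\<dots> \<le> 2 * (norm (f x))\<^sup>2 + 2 * (norm (c * g x))\<^sup>2"
        using sum_squares_bound[of "norm (f x)" "norm (c * g x)"] by (simp add: power2_sum)
      finally show ?thesis by (simp add: norm_mult power_mult_distrib)
    qed
    then show "AE x in lborel. norm ((norm (f x + c * g x))\<^sup>2) \<le> norm (2 * (norm (f x))\<^sup>2 + (2 * (norm c)\<^sup>2) * (norm (g x))\<^sup>2)"
      by (intro AE_I2) (simp only: real_norm_def, smt (verit) zero_le_power2)
  qed measurable
  then show ?thesis unfolding L2_def by simp
qed

lemma L2_zero [simp]: "(\<lambda>x. 0) \<in> L2" by (simp add: L2_def)

lemma L2_cmult: "g \<in> L2 \<Longrightarrow> (\<lambda>x. c * g x) \<in> L2"
  using L2_add_cmult[OF L2_zero, of g c] by simp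

lemma L2_add: "f \<in> L2 \<Longrightarrow> g \<in> L2 \<Longrightarrow> (\<lambda>x. f x + g x) \<in> L2"
  using L2_add_cmult[of f g 1] by simp

lemma L2_diff: "f \<in> L2 \<Longrightarrow> g \<in> L2 \<Longrightarrow> (\<lambda>x. f x - g x) \<in> L2"
  using L2_add_cmult[of f g "-1"] by simp

lemma L2_sum: "(\<And>i. i \<in> I \<Longrightarrow> f i \<in> L2) \<Longrightarrow> (\<lambda>x. \<Sum>i\<in>I. f i x) \<in> L2"
  by (induction I rule: infinite_finite_induct) (auto intro: L2_add)

lemma L2_inner_add_cmult_left:
  "f \<in> L2 \<Longrightarrow> g \<in> L2 \<Longrightarrow> h \<in> L2 \<Longrightarrow> L2_inner (\<lambda>x. f x + c * g x) h = L2_inner f h + c * L2_inner g h"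
  using L2_integrable_mult[of f h] L2_integrable_mult[of g h]
  by (simp add: L2_inner_def distrib_right mult.assoc)

lemma L2_inner_cnj: "L2_inner g f = cnj (L2_inner f g)"
  unfolding L2_inner_def
  using Bochner_Integration.integral_cnj[of lborel "\<lambda>x. f x * cnj (g x)"] by (simp add: mult.commute)

lemma L2_inner_add_cmult_right:
  assumes "f \<in> L2" "g \<in> L2" "h \<in> L2"
  shows "L2_inner h (\<lambda>x. f x + c * g x) = L2_inner h f + cnj c * L2_inner h g"
  using L2_inner_add_cmult_left[OF assms, of c]
  by (simp add: L2_inner_cnj[of h "\<lambda>x. f x + c * g x"] L2_inner_cnj[of h f] L2_inner_cnj[of h g])

lemma L2_inner_diff_left: "f \<in> L2 \<Longrightarrow> g \<in> L2 \<Longrightarrow> h \<in> L2 \<Longrightarrow> L2_inner (\<lambda>x. f x - g x) h = L2_inner f h - L2_inner g h"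
  using L2_inner_add_cmult_left[of f g h "-1"] by simp

lemma L2_inner_cmult_left: "g \<in> L2 \<Longrightarrow> h \<in> L2 \<Longrightarrow> L2_inner (\<lambda>x. c * g x) h = c * L2_inner g h"
  using L2_inner_add_cmult_left[of "\<lambda>_. 0" g h c] by (simp add: L2_inner_def)

lemma L2_inner_sum_left:
  assumes "finite I" "\<And>i. i \<in> I \<Longrightarrow> f i \<in> L2" "h \<in> L2"
  shows "L2_inner (\<lambda>x. \<Sum>i\<in>I. f i x) h = (\<Sum>i\<in>I. L2_inner (f i) h)"
  using assms
proof (induction I rule: finite_induct)
  case (insert i I)
  then show ?case
    using L2_inner_add_cmult_left[of "f i" "\<lambda>x. \<Sum>i\<in>I. f i x" h 1] by (simp add: L2_sum)
qed (simp add: L2_inner_def)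

lemma L2_norm_ge_0 [simp]: "0 \<le> L2_norm f"
  by (simp add: L2_norm_def)

lemma L2_norm_sq: "(L2_norm f)\<^sup>2 = (LINT x|lborel. (norm (f x))\<^sup>2)"
  by (simp add: L2_norm_def)

lemma L2_inner_self: "L2_inner f f = of_real ((L2_norm f)\<^sup>2)"
  unfolding L2_inner_def L2_norm_sq by (simp add: complex_norm_square[symmetric] del: of_real_power flip: of_real_power)

lemma L2_norm_sq_add_cmult:
  assumes "f \<in> L2" "g \<in> L2"
  shows "(L2_norm (\<lambda>x. f x + c * g x))\<^sup>2 = (L2_norm f)\<^sup>2 + 2 * Re (cnj c * L2_inner f g) + (norm c)\<^sup>2 * (L2_norm g)\<^sup>2"
proof -
  have 1: "complex_of_real ((L2_norm (\<lambda>x. f x + c * g x))\<^sup>2) =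
     L2_inner f f + cnj c * L2_inner f g + c * L2_inner g f + c * cnj c * L2_inner g g"
    unfolding L2_inner_self[symmetric] using assms
    by (simp add: L2_inner_add_cmult_left L2_inner_add_cmult_right L2_add_cmult algebra_simps)
  have 2: "c * cnj c * L2_inner g g = of_real ((norm c)\<^sup>2 * (L2_norm g)\<^sup>2)"
    by (simp add: L2_inner_self complex_norm_square[symmetric])
  have 3: "cnj c * L2_inner f g + c * L2_inner g f = of_real (2 * Re (cnj c * L2_inner f g))"
    by (subst L2_inner_cnj[of g f]) (simp add: complex_eq_iff algebra_simps)
  have "complex_of_real ((L2_norm (\<lambda>x. f x + c * g x))\<^sup>2) =
     of_real ((L2_norm f)\<^sup>2 + 2 * Re (cnj c * L2_inner f g) + (norm c)\<^sup>2 * (L2_norm g)\<^sup>2)"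
    using 3 unfolding 1 2 by (simp add: L2_inner_self add.assoc)
  then show ?thesis using of_real_eq_iff by blast
qed

text \<open>The squared norm of f - t z g with z = <f, g> is a nonnegative quadratic in the real
  variable t. Take t = 1/||g||^2; if g has norm 0 the quadratic is affine, and its nonnegativity for
  large t forces z = 0.\<close>

lemma L2_Cauchy_Schwarz:
  assumes "f \<in> L2" "g \<in> L2" shows "norm (L2_inner f g) \<le> L2_norm f * L2_norm g"
proof -
  define z where "z = L2_inner f g"
  have *: "0 \<le> (L2_norm f)\<^sup>2 - 2 * t * (norm z)\<^sup>2 + t\<^sup>2 * (norm z)\<^sup>2 * (L2_norm g)\<^sup>2" for t :: real
  proof -
    have "Re (cnj (- of_real t * z) * z) = - t * (norm z)\<^sup>2"
      by (simp only: cmod_power2) (simp add: power2_eq_square algebra_simps)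
    then have "(L2_norm (\<lambda>x. f x + (- of_real t * z) * g x))\<^sup>2 =
      (L2_norm f)\<^sup>2 - 2 * t * (norm z)\<^sup>2 + t\<^sup>2 * (norm z)\<^sup>2 * (L2_norm g)\<^sup>2"
      unfolding L2_norm_sq_add_cmult[OF assms] z_def[symmetric]
      by (simp add: norm_mult power_mult_distrib)
    then show ?thesis by (metis zero_le_power2)
  qed
  have "(norm z)\<^sup>2 \<le> (L2_norm f * L2_norm g)\<^sup>2"
  proof (cases "L2_norm g = 0")
    case True
    have "(norm z)\<^sup>2 = 0"
    proof (rule ccontr)
      assume nz: "(norm z)\<^sup>2 \<noteq> 0"
      have "0 \<le> (L2_norm f)\<^sup>2 - 2 * (((L2_norm f)\<^sup>2 + 1) / (norm z)\<^sup>2) * (norm z)\<^sup>2"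
        using *[of "((L2_norm f)\<^sup>2 + 1) / (norm z)\<^sup>2"] True by simp
      also have "\<dots> = - (L2_norm f)\<^sup>2 - 2" using nz by (simp add: field_simps)
      also have "\<dots> < 0" using zero_le_power2[of "L2_norm f"] by linarith
      finally show False by simp
    qed
    then show ?thesis by simp
  next
    case False
    then have pos: "0 < (L2_norm g)\<^sup>2" by simp
    define G where "G = (L2_norm g)\<^sup>2"
    have "(1 / G)\<^sup>2 * (norm z)\<^sup>2 * G = (norm z)\<^sup>2 / G"
      using pos by (simp add: G_def[symmetric] power2_eq_square)
    then have "0 \<le> (L2_norm f)\<^sup>2 - (norm z)\<^sup>2 / (L2_norm g)\<^sup>2"
      using *[of "1 / G"] by (simp add: G_def[symmetric])
    then show ?thesis using pos by (simp add: field_simps power_mult_distrib)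
  qed
  then show ?thesis unfolding z_def[symmetric] by (rule power2_le_imp_le) simp
qed

lemma L2_norm_cong: "(\<And>x. norm (f x) = norm (g x)) \<Longrightarrow> L2_norm f = L2_norm g"
  by (simp add: L2_norm_def)

lemma ae_eq_L2_inner:
  assumes "ae_eq f f'" "f \<in> L2" "f' \<in> L2" "g \<in> L2" shows "L2_inner f g = L2_inner f' g"
proof -
  have "integrable lborel (\<lambda>x. f x * cnj (g x))" "integrable lborel (\<lambda>x. f' x * cnj (g x))"
    using assms by (auto intro: L2_integrable_mult)
  then show ?thesis unfolding L2_inner_def
    using assms(1) by (intro integral_cong_AE) (auto simp: ae_eq_def)
qed

lemma L2_norm_0_imp_ae: assumes "f \<in> L2" "L2_norm f = 0" shows "ae_eq f (\<lambda>x. 0)"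
proof -
  have "(LINT x|lborel. (norm (f x))\<^sup>2) = 0" using assms by (simp add: L2_norm_def)
  then have "AE x in lborel. (norm (f x))\<^sup>2 = 0"
    using integral_nonneg_eq_0_iff_AE[OF L2_integrable_sq[OF assms(1)]] by simp
  then show ?thesis by (simp add: ae_eq_def)
qed

lemma L2_inner_separates:
  assumes "u \<in> L2" "v \<in> L2" "\<And>g. g \<in> L2 \<Longrightarrow> L2_inner u g = L2_inner v g" shows "ae_eq u v"
proof -
  have d: "(\<lambda>x. u x - v x) \<in> L2" using assms by (intro L2_diff)
  have "of_real ((L2_norm (\<lambda>x. u x - v x))\<^sup>2) = (0::complex)"
    unfolding L2_inner_self[symmetric] using assms d by (simp add: L2_inner_diff_left)
  then have "L2_norm (\<lambda>x. u x - v x) = 0" by simp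
  from L2_norm_0_imp_ae[OF d this] show ?thesis by (simp add: ae_eq_def)
qed

lemma L2_inner_tendsto:
  assumes "\<And>n. u n \<in> L2" "v \<in> L2" "g \<in> L2" "(\<lambda>n. L2_norm (\<lambda>x. u n x - v x)) \<longlonglongrightarrow> 0"
  shows "(\<lambda>n. L2_inner (u n) g) \<longlonglongrightarrow> L2_inner v g"
proof (rule LIM_zero_cancel, rule Lim_null_comparison)
  show "\<forall>\<^sub>F n in sequentially. norm (L2_inner (u n) g - L2_inner v g) \<le> L2_norm (\<lambda>x. u n x - v x) * L2_norm g"
    using L2_Cauchy_Schwarz[OF L2_diff[OF assms(1,2)] assms(3)]
    by (simp add: L2_inner_diff_left assms)
  show "(\<lambda>n. L2_norm (\<lambda>x. u n x - v x) * L2_norm g) \<longlonglongrightarrow> 0"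
    using tendsto_mult_right[OF assms(4), of "L2_norm g"] by simp
qed

definition L2_weight :: "'a::euclidean_space \<Rightarrow> complex" where
  "L2_weight x = of_real ((1 + norm x) powr (- real DIM('a)))"

text \<open>The square of the weight is \<open>decay_kernel\<close> at scale 1, that is j = 0, with
  exponent 2n > n.\<close>

lemma L2_weight_in_L2: "(L2_weight :: 'a::euclidean_space \<Rightarrow> complex) \<in> L2"
proof -
  have m: "real DIM('a) < 2 * real DIM('a)" by simp
  obtain C where C: "\<And>(j::int) (x::'a). (\<integral>\<^sup>+y. decay_kernel (2 powr (j/2)) (2 * real DIM('a)) (x - y) \<partial>lborel) \<le> ennreal C"
    using nn_integral_decay_kernel_le[OF m] by blast
  have eq: "(norm (L2_weight y))\<^sup>2 = (1 + norm y) powr (- (2 * real DIM('a)))" for y :: 'a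
    by (simp add: L2_weight_def power2_eq_square powr_add[symmetric])
  have "(\<integral>\<^sup>+y. ennreal (norm ((norm (L2_weight (y::'a)))\<^sup>2)) \<partial>lborel) \<le> ennreal C"
    using C[of 0 0] unfolding eq by (simp add: decay_kernel_def)
  then have "(\<integral>\<^sup>+y. ennreal (norm ((norm (L2_weight (y::'a)))\<^sup>2)) \<partial>lborel) < \<infinity>"
    by (rule order_le_less_trans) simp
  moreover have [measurable]: "(L2_weight :: 'a \<Rightarrow> complex) \<in> borel_measurable borel"
    unfolding L2_weight_def[abs_def] by measurable
  ultimately show ?thesis unfolding L2_def by (simp add: integrable_iff_bounded)
qed

text \<open>Multiplying by a positive square integrable weight turns an \<open>L\<^sub>2\<close> Cauchy sequence into
  an \<open>L\<^sub>1\<close> Cauchy sequence, for which almost everywhere convergent subsequences are available.\<close>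

lemma L2_complete:
  fixes u :: "nat \<Rightarrow> 'a::euclidean_space \<Rightarrow> complex"
  assumes u: "\<And>n. u n \<in> L2"
    and cauchy: "\<And>e. 0 < e \<Longrightarrow> \<exists>N. \<forall>n\<ge>N. \<forall>m\<ge>N. L2_norm (\<lambda>x. u n x - u m x) < e"
  shows "\<exists>v\<in>L2. (\<lambda>n. L2_norm (\<lambda>x. u n x - v x)) \<longlonglongrightarrow> 0"
proof -
  let ?w = "L2_weight :: 'a \<Rightarrow> complex"
  have w: "?w \<in> L2" by (rule L2_weight_in_L2)
  have wpos: "?w x \<noteq> 0" and cnjw: "cnj (?w x) = ?w x" for x
    using one_plus_neq_0[of 1 x] by (auto simp: L2_weight_def)
  have um [measurable]: "u n \<in> borel_measurable borel" for n using u by (rule L2_measurable)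
  have int: "integrable lborel (\<lambda>x. u n x * ?w x)" for n
    using L2_integrable_mult[OF u[of n] w] by (simp add: cnjw)
  have L1: "(LINT x|lborel. norm (u n x * ?w x - u m x * ?w x)) \<le> L2_norm (\<lambda>x. u n x - u m x) * L2_norm ?w" for n m
  proof -
    \<comment> \<open>Taking the modulus of the difference makes its inner product with the positive
      weight equal to the weighted L^1 norm.\<close>
    let ?d = "\<lambda>x. of_real (norm (u n x - u m x)) :: complex"
    have d: "?d \<in> L2" using L2_diff[OF u[of n] u[of m]] by (simp add: L2_def)
    have "?d x * cnj (?w x) = of_real (norm (u n x * ?w x - u m x * ?w x))" for x
      by (simp add: left_diff_distrib[symmetric] norm_mult cnjw) (simp add: L2_weight_def)
    then have "L2_inner ?d ?w = of_real (LINT x|lborel. norm (u n x * ?w x - u m x * ?w x))"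
      by (simp add: L2_inner_def)
    then have "(LINT x|lborel. norm (u n x * ?w x - u m x * ?w x)) = norm (L2_inner ?d ?w)"
      by (simp add: Bochner_Integration.integral_nonneg)
    also have "\<dots> \<le> L2_norm ?d * L2_norm ?w" by (rule L2_Cauchy_Schwarz[OF d w])
    also have "L2_norm ?d = L2_norm (\<lambda>x. u n x - u m x)" by (rule L2_norm_cong) simp
    finally show ?thesis .
  qed
  have "\<exists>N. \<forall>i\<ge>N. \<forall>j\<ge>N. LINT x|lborel. norm (u i x * ?w x - u j x * ?w x) < e" if "0 < e" for e
  proof -
    have p: "0 < e / (L2_norm ?w + 1)" using that L2_norm_ge_0[of ?w] by (intro divide_pos_pos) linarith+
    obtain N where N: "\<And>n m. n \<ge> N \<Longrightarrow> m \<ge> N \<Longrightarrow> L2_norm (\<lambda>x. u n x - u m x) < e / (L2_norm ?w + 1)"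
      using cauchy[OF p] by blast
    have "LINT x|lborel. norm (u i x * ?w x - u j x * ?w x) < e" if "i \<ge> N" "j \<ge> N" for i j
    proof -
      have "LINT x|lborel. norm (u i x * ?w x - u j x * ?w x) \<le> (e / (L2_norm ?w + 1)) * L2_norm ?w"
        using L1[of i j] N[OF that] by (meson L2_norm_ge_0 less_imp_le mult_right_mono order_trans)
      also have "\<dots> < (e / (L2_norm ?w + 1)) * (L2_norm ?w + 1)" using p by (intro mult_strict_left_mono) auto
      also have "\<dots> = e"
      proof -
        have "L2_norm ?w + 1 \<noteq> 0" using L2_norm_ge_0[of ?w] by linarith
        then show ?thesis by simp
      qed
      finally show ?thesis .
    qed
    then show ?thesis by blast
  qed
  from cauchy_L1_AE_cauchy_subseq[OF int this]
  obtain r where r: "strict_mono r" "AE x in lborel. Cauchy (\<lambda>i. u (r i) x * ?w x)" by auto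
  \<comment> \<open>\<open>lim\<close> is total and measurable in x; it is the limit only where the
    subsequence converges, which is almost everywhere.\<close>
  define v where "v x = lim (\<lambda>i. u (r i) x)" for x
  have [measurable]: "v \<in> borel_measurable borel"
    unfolding v_def[abs_def] by measurable
  have conv: "AE x in lborel. (\<lambda>i. u (r i) x) \<longlonglongrightarrow> v x"
    using r(2)
  proof eventually_elim
    case (elim x)
    then have "convergent (\<lambda>i. u (r i) x * ?w x)" by (simp add: Cauchy_convergent)
    then have "convergent (\<lambda>i. u (r i) x)"
      using wpos[of x] convergent_mult[OF _ convergent_const[of "inverse (?w x)"], of "\<lambda>i. u (r i) x * ?w x"]
      by (simp add: mult.assoc)
    then show ?case by (simp add: v_def convergent_LIMSEQ_iff)
  qed
  \<comment> \<open>Fatou's lemma along the subsequence carries the Cauchy bound over to the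
    distance from u_n to v.\<close>
  have bound: "(\<integral>\<^sup>+x. ennreal ((norm (u n x - v x))\<^sup>2) \<partial>lborel) \<le> ennreal (e\<^sup>2)"
    if e: "0 < e" and N: "\<And>m. m \<ge> N \<Longrightarrow> L2_norm (\<lambda>x. u n x - u m x) < e" for n N e
  proof -
    have "(\<integral>\<^sup>+x. ennreal ((norm (u n x - v x))\<^sup>2) \<partial>lborel)
       \<le> (\<integral>\<^sup>+x. liminf (\<lambda>i. ennreal ((norm (u n x - u (r i) x))\<^sup>2)) \<partial>lborel)"
    proof (rule nn_integral_mono_AE, use conv in eventually_elim)
      case (elim x)
      then have "(\<lambda>i. ennreal ((norm (u n x - u (r i) x))\<^sup>2)) \<longlonglongrightarrow> ennreal ((norm (u n x - v x))\<^sup>2)"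
        by (intro tendsto_intros tendsto_ennrealI)
      from lim_imp_Liminf[OF sequentially_bot this] show ?case by simp
    qed
    also have "\<dots> \<le> liminf (\<lambda>i. \<integral>\<^sup>+x. ennreal ((norm (u n x - u (r i) x))\<^sup>2) \<partial>lborel)"
      by (rule nn_integral_liminf) measurable
    also have "\<dots> \<le> ennreal (e\<^sup>2)"
    proof (rule Liminf_le)
      have "(\<integral>\<^sup>+x. ennreal ((norm (u n x - u (r i) x))\<^sup>2) \<partial>lborel) \<le> ennreal (e\<^sup>2)" if "i \<ge> N" for i
      proof -
        have "(\<integral>\<^sup>+x. ennreal ((norm (u n x - u (r i) x))\<^sup>2) \<partial>lborel) = ennreal ((L2_norm (\<lambda>x. u n x - u (r i) x))\<^sup>2)"
          unfolding L2_norm_sq by (intro nn_integral_eq_integral L2_integrable_sq L2_diff u) auto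
        also have "\<dots> \<le> ennreal (e\<^sup>2)"
          using N[of "r i"] that seq_suble[OF r(1), of i] by (intro ennreal_leI power_mono) auto
        finally show ?thesis .
      qed
      then show "\<forall>\<^sub>F i in sequentially. (\<integral>\<^sup>+x. ennreal ((norm (u n x - u (r i) x))\<^sup>2) \<partial>lborel) \<le> ennreal (e\<^sup>2)"
        unfolding eventually_sequentially by blast
    qed simp
    finally show ?thesis .
  qed
  have diff: "(\<lambda>x. u n x - v x) \<in> L2 \<and> L2_norm (\<lambda>x. u n x - v x) \<le> e"
    if e: "0 < e" and N: "\<And>m. m \<ge> N \<Longrightarrow> L2_norm (\<lambda>x. u n x - u m x) < e" for n N e
  proof -
    have b: "(\<integral>\<^sup>+x. ennreal ((norm (u n x - v x))\<^sup>2) \<partial>lborel) \<le> ennreal (e\<^sup>2)"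
      by (rule bound[OF e N])
    have i: "integrable lborel (\<lambda>x. (norm (u n x - v x))\<^sup>2)"
      using order_le_less_trans[OF b ennreal_less_top] by (auto simp: integrable_iff_bounded)
    have "ennreal ((L2_norm (\<lambda>x. u n x - v x))\<^sup>2) \<le> ennreal (e\<^sup>2)"
      using b nn_integral_eq_integral[OF i] by (simp add: L2_norm_sq)
    then have "(L2_norm (\<lambda>x. u n x - v x))\<^sup>2 \<le> e\<^sup>2" by (simp add: ennreal_le_iff)
    from power2_le_imp_le[OF this less_imp_le[OF e]] have "L2_norm (\<lambda>x. u n x - v x) \<le> e" .
    then show ?thesis using i by (simp add: L2_def)
  qed
  show ?thesis
  proof (intro bexI)
    obtain N where "\<And>n m. n \<ge> N \<Longrightarrow> m \<ge> N \<Longrightarrow> L2_norm (\<lambda>x. u n x - u m x) < 1"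
      using cauchy[of 1] by auto
    then have "(\<lambda>x. u N x - v x) \<in> L2" using diff[of 1 N N] by auto
    from L2_diff[OF u[of N] this] show "v \<in> L2" by simp
    show "(\<lambda>n. L2_norm (\<lambda>x. u n x - v x)) \<longlonglongrightarrow> 0"
    proof (rule LIMSEQ_I)
      fix e :: real assume "0 < e"
      then obtain N where "\<And>n m. n \<ge> N \<Longrightarrow> m \<ge> N \<Longrightarrow> L2_norm (\<lambda>x. u n x - u m x) < e / 2"
        using cauchy[of "e / 2"] by auto
      then have "L2_norm (\<lambda>x. u n x - v x) \<le> e / 2" if "n \<ge> N" for n
        using diff[of "e / 2" N n] that \<open>0 < e\<close> by auto
      then show "\<exists>N. \<forall>n\<ge>N. norm (L2_norm (\<lambda>x. u n x - v x) - 0) < e"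
        using \<open>0 < e\<close> by (intro exI[of _ N]) fastforce
    qed
  qed
qed

section \<open>Bounded functional calculus\<close>

definition bounded_borel :: "(real \<Rightarrow> complex) \<Rightarrow> bool" where
  "bounded_borel \<phi> \<longleftrightarrow> \<phi> \<in> borel_measurable borel \<and> (\<exists>C. \<forall>t. norm (\<phi> t) \<le> C)"

lemma bounded_borel_measurable [measurable_dest]: "bounded_borel \<phi> \<Longrightarrow> \<phi> \<in> borel_measurable borel"
  by (simp add: bounded_borel_def)

lemma bounded_borel_indicator: "B \<in> sets borel \<Longrightarrow> bounded_borel (\<lambda>t. c * indicator B t)"
  unfolding bounded_borel_def by (auto simp: norm_mult intro!: exI[of _ "norm c"] split: split_indicator)

lemma bounded_borelI: "\<phi> \<in> borel_measurable borel \<Longrightarrow> (\<And>t. norm (\<phi> t) \<le> C) \<Longrightarrow> bounded_borel \<phi>"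
  unfolding bounded_borel_def by blast

lemma bounded_borelE:
  assumes "bounded_borel \<phi>"
  obtains C where "\<phi> \<in> borel_measurable borel" "0 \<le> C" "\<And>t. norm (\<phi> t) \<le> C"
  using assms norm_ge_zero order_trans unfolding bounded_borel_def by metis

lemma bounded_borel_add:
  assumes "bounded_borel \<phi>" "bounded_borel \<psi>" shows "bounded_borel (\<lambda>t. \<phi> t + \<psi> t)"
proof -
  obtain C where C: "\<phi> \<in> borel_measurable borel" "0 \<le> C" "\<And>t. norm (\<phi> t) \<le> C"
    by (rule bounded_borelE[OF assms(1)]) (rule that)
  obtain D where D: "\<psi> \<in> borel_measurable borel" "0 \<le> D" "\<And>t. norm (\<psi> t) \<le> D"
    by (rule bounded_borelE[OF assms(2)]) (rule that)
  show ?thesis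
    by (rule bounded_borelI[of _ "C + D"]) (intro borel_measurable_add C D norm_triangle_mono)+
qed

lemma bounded_borel_mult:
  assumes "bounded_borel \<phi>" "bounded_borel \<psi>" shows "bounded_borel (\<lambda>t. \<phi> t * \<psi> t)"
proof -
  obtain C where C: "\<phi> \<in> borel_measurable borel" "0 \<le> C" "\<And>t. norm (\<phi> t) \<le> C"
    by (rule bounded_borelE[OF assms(1)]) (rule that)
  obtain D where D: "\<psi> \<in> borel_measurable borel" "0 \<le> D" "\<And>t. norm (\<psi> t) \<le> D"
    by (rule bounded_borelE[OF assms(2)]) (rule that)
  show ?thesis
    unfolding bounded_borel_def norm_mult
    by (intro conjI exI[of _ "C * D"] allI borel_measurable_times C D mult_mono norm_ge_zero)
qed

lemma bounded_borel_const: "bounded_borel (\<lambda>t. c)"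
  unfolding bounded_borel_def by auto

lemma bounded_borel_cnj:
  assumes "bounded_borel \<phi>" shows "bounded_borel (\<lambda>t. cnj (\<phi> t))"
proof -
  obtain C where C: "\<phi> \<in> borel_measurable borel" "0 \<le> C" "\<And>t. norm (\<phi> t) \<le> C"
    by (rule bounded_borelE[OF assms]) (rule that)
  have "cnj \<in> borel_measurable borel" by (intro borel_measurable_continuous_onI continuous_intros)
  from measurable_compose[OF C(1) this] show ?thesis
    by (rule bounded_borelI[where C = C]) (simp add: C(3))
qed

lemma bounded_borel_diff:
  assumes "bounded_borel \<phi>" "bounded_borel \<psi>" shows "bounded_borel (\<lambda>t. \<phi> t - \<psi> t)"
  using bounded_borel_add[OF assms(1) bounded_borel_mult[OF bounded_borel_const[of "-1"] assms(2)]] by simp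

lemma bounded_borel_sum:
  assumes "finite I" "\<And>i. i \<in> I \<Longrightarrow> bounded_borel (\<phi> i)"
  shows "bounded_borel (\<lambda>t. \<Sum>i\<in>I. \<phi> i t)"
  using assms
proof (induction I rule: finite_induct)
  case empty
  then show ?case by (simp add: bounded_borel_const)
next
  case (insert i I)
  then show ?case unfolding sum.insert[OF insert(1,2)] by (intro bounded_borel_add) auto
qed

text \<open>A bounded Borel function is a pointwise limit of simple functions with |F_i| \<le> 2
  |\<phi>|, hence of a uniformly bounded sequence. This makes dominated convergence available in the
  limit case and reduces the identities of the calculus to indicators.\<close>

lemma bounded_borel_induct [consumes 1, case_names indicator add lim]:
  assumes \<phi>: "bounded_borel \<phi>"
    and ind: "\<And>c B. B \<in> sets borel \<Longrightarrow> P (\<lambda>t. c * indicator B t)"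
    and add: "\<And>\<phi> \<psi>. bounded_borel \<phi> \<Longrightarrow> bounded_borel \<psi> \<Longrightarrow> P \<phi> \<Longrightarrow> P \<psi> \<Longrightarrow> P (\<lambda>t. \<phi> t + \<psi> t)"
    and lim: "\<And>\<Phi> \<phi> C. (\<And>n::nat. bounded_borel (\<Phi> n)) \<Longrightarrow> (\<And>n. P (\<Phi> n)) \<Longrightarrow> (\<And>n t. norm (\<Phi> n t) \<le> C) \<Longrightarrow>
       (\<And>t. (\<lambda>n. \<Phi> n t) \<longlonglongrightarrow> \<phi> t) \<Longrightarrow> bounded_borel \<phi> \<Longrightarrow> P \<phi>"
  shows "P \<phi>"
proof -
  obtain C where C: "\<And>t. norm (\<phi> t) \<le> C" using \<phi> by (auto simp: bounded_borel_def)
  have "\<phi> \<in> borel_measurable borel" using \<phi> by (rule bounded_borel_measurable)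
  from borel_measurable_implies_sequence_metric[OF this, of 0]
  obtain F where F: "\<And>i. simple_function borel (F i)" "\<And>t. (\<lambda>i. F i t) \<longlonglongrightarrow> \<phi> t"
    "\<And>i t. dist (F i t) 0 \<le> 2 * dist (\<phi> t) 0" by auto
  have S: "P (\<lambda>t. \<Sum>y\<in>Y. y * indicator (F i -` {y}) t) \<and> bounded_borel (\<lambda>t. \<Sum>y\<in>Y. y * indicator (F i -` {y}) t)"
    if "finite Y" for i Y
    using that
  proof (induction Y rule: finite_induct)
    case empty
    then show ?case using ind[of "{}" 0] bounded_borel_const[of 0] by simp
  next
    case (insert y Y)
    have B: "F i -` {y} \<in> sets borel"
      using borel_measurable_simple_function[OF F(1)[of i]] measurable_sets_borel[of "F i" borel "{y}"] by simp
    show ?case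
      unfolding sum.insert[OF insert(1,2)]
      by (intro conjI add bounded_borel_add bounded_borel_indicator B ind
            insert(3)[THEN conjunct1] insert(3)[THEN conjunct2])
  qed
  have eq: "F i = (\<lambda>t. \<Sum>y\<in>range (F i). y * indicator (F i -` {y}) t)" for i
  proof
    fix t
    have "finite (range (F i))" using F(1)[of i] by (simp add: simple_function_def)
    then have "(\<Sum>y\<in>range (F i). y * indicator (F i -` {y}) t) = (\<Sum>y\<in>{F i t}. y * indicator (F i -` {y}) t)"
      by (intro sum.mono_neutral_right) (auto split: split_indicator)
    then show "F i t = (\<Sum>y\<in>range (F i). y * indicator (F i -` {y}) t)" by simp
  qed
  have fin: "finite (range (F i))" for i using F(1)[of i] by (simp add: simple_function_def)
  show ?thesis
  proof (rule lim[of F "2 * C"])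
    show "bounded_borel (F i)" for i by (subst eq) (rule S[OF fin, THEN conjunct2])
    show "P (F i)" for i by (subst eq) (rule S[OF fin, THEN conjunct1])
    show "norm (F i t) \<le> 2 * C" for i t using F(3)[of i t] C[of t] by simp
  qed (use F \<phi> in auto)
qed

section \<open>Integration against a projection-valued measure\<close>

context
  fixes E :: "real set \<Rightarrow> ('a::euclidean_space \<Rightarrow> complex) \<Rightarrow> 'a \<Rightarrow> complex"
  assumes pvm: "projection_valued_measure E"
begin

lemmas pvmD = pvm[unfolded projection_valued_measure_def]

lemma E_operator: "B \<in> sets borel \<Longrightarrow> L2_operator L2 (E B)"
  using pvmD[THEN conjunct1] by simp

lemma E_L2: "B \<in> sets borel \<Longrightarrow> f \<in> L2 \<Longrightarrow> E B f \<in> L2"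
  using E_operator[of B] unfolding L2_operator_def by simp

lemma E_sym: "B \<in> sets borel \<Longrightarrow> f \<in> L2 \<Longrightarrow> g \<in> L2 \<Longrightarrow> L2_inner (E B f) g = L2_inner f (E B g)"
  using pvmD[THEN conjunct1] by simp

lemma E_inner_Int:
  assumes "A \<in> sets borel" "B \<in> sets borel" "f \<in> L2" "g \<in> L2"
  shows "L2_inner (E (A \<inter> B) f) g = L2_inner (E B f) (E A g)"
proof -
  have "ae_eq (E (A \<inter> B) f) (E A (E B f))"
    using pvmD[THEN conjunct2, THEN conjunct2, THEN conjunct2, THEN conjunct1] assms by simp
  then have "L2_inner (E (A \<inter> B) f) g = L2_inner (E A (E B f)) g"
    using assms by (intro ae_eq_L2_inner E_L2) auto
  also have "\<dots> = L2_inner (E B f) (E A g)" using assms by (intro E_sym E_L2)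
  finally show ?thesis .
qed

lemma E_inner_self:
  assumes "B \<in> sets borel" "f \<in> L2"
  shows "L2_inner (E B f) f = of_real ((L2_norm (E B f))\<^sup>2)"
  using E_inner_Int[OF assms(1,1,2,2)] unfolding Int_absorb L2_inner_self .

lemma E_inner_add:
  assumes "B \<in> sets borel" "f \<in> L2" "g \<in> L2" "h \<in> L2"
  shows "L2_inner (E B (\<lambda>x. f x + c * g x)) h = L2_inner (E B f) h + c * L2_inner (E B g) h"
proof -
  have "ae_eq (E B (\<lambda>x. f x + c * g x)) (\<lambda>x. E B f x + c * E B g x)"
    using E_operator[OF assms(1)] assms unfolding L2_operator_def by simp
  then have "L2_inner (E B (\<lambda>x. f x + c * g x)) h = L2_inner (\<lambda>x. E B f x + c * E B g x) h"
    using assms by (intro ae_eq_L2_inner E_L2 L2_add_cmult)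
  also have "\<dots> = L2_inner (E B f) h + c * L2_inner (E B g) h"
    using assms by (intro L2_inner_add_cmult_left E_L2)
  finally show ?thesis .
qed

lemma E_inner_expand:
  assumes "B \<in> sets borel" "f \<in> L2" "g \<in> L2"
  shows "L2_inner (E B (\<lambda>x. f x + c * g x)) (\<lambda>x. f x + c * g x) =
    L2_inner (E B f) f + cnj c * L2_inner (E B f) g + c * L2_inner (E B g) f + c * cnj c * L2_inner (E B g) g"
  unfolding E_inner_add[OF assms L2_add_cmult[OF assms(2,3)]]
    L2_inner_add_cmult_right[OF assms(2,3) E_L2[OF assms(1,2)]] L2_inner_add_cmult_right[OF assms(2,3) E_L2[OF assms(1,3)]]
  by (simp add: algebra_simps)

lemma space_spectral [simp]: "space (scalar_spectral_measure E f) = UNIV"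
  and sets_spectral [simp, measurable_cong]: "sets (scalar_spectral_measure E f) = sets borel"
  using sets.sigma_sets_eq[of "borel :: real measure"]
  by (auto simp: scalar_spectral_measure_def space_measure_of_conv sets_measure_of_conv)

text \<open>\<open>measure_of\<close> yields the intended values only once countable additivity is
  known. It follows from strong additivity of E and continuity of the inner product, because <E(B)f,
  f> is the squared norm of E(B)f.\<close>

lemma emeasure_spectral:
  assumes f: "f \<in> L2" and B: "B \<in> sets borel"
  shows "emeasure (scalar_spectral_measure E f) B = ennreal ((L2_norm (E B f))\<^sup>2)"
proof -
  let ?\<mu> = "\<lambda>B. ennreal (Re (L2_inner (E B f) f))"
  have \<mu>: "?\<mu> B = ennreal ((L2_norm (E B f))\<^sup>2)" if "B \<in> sets borel" for B
    using E_inner_self[OF that f] by simp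
  have "emeasure (scalar_spectral_measure E f) B = ?\<mu> B"
  proof (rule emeasure_measure_of[OF scalar_spectral_measure_def])
    have "ae_eq (E {} f) (\<lambda>x. 0)" using pvmD[THEN conjunct2, THEN conjunct1] f by simp
    then have "L2_inner (E {} f) f = L2_inner (\<lambda>x. 0) f" using f by (intro ae_eq_L2_inner E_L2) auto
    then show "positive (sets (scalar_spectral_measure E f)) ?\<mu>" by (simp add: positive_def L2_inner_def)
    show "countably_additive (sets (scalar_spectral_measure E f)) ?\<mu>"
    proof (rule countably_additiveI)
      fix A :: "nat \<Rightarrow> real set"
      assume A: "range A \<subseteq> sets (scalar_spectral_measure E f)" "disjoint_family A"
      then have Am: "A i \<in> sets borel" for i by auto
      have U: "(\<Union>i. A i) \<in> sets borel" using Am by auto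
      have "(\<lambda>m. L2_norm (\<lambda>x. (\<Sum>i<m. E (A i) f x) - E (\<Union>i. A i) f x)) \<longlonglongrightarrow> 0"
        using pvmD[THEN conjunct2, THEN conjunct2, THEN conjunct2, THEN conjunct2, rule_format, of A f] f A
        unfolding sets_spectral by blast
      then have "(\<lambda>m. L2_inner (\<lambda>x. \<Sum>i<m. E (A i) f x) f) \<longlonglongrightarrow> L2_inner (E (\<Union>i. A i) f) f"
        by (rule L2_inner_tendsto[rotated 3]) (rule L2_sum E_L2 Am U f)+
      moreover have "L2_inner (\<lambda>x. \<Sum>i<m. E (A i) f x) f = of_real (\<Sum>i<m. (L2_norm (E (A i) f))\<^sup>2)" for m
        using f Am by (subst L2_inner_sum_left) (auto simp: E_L2 E_inner_self)
      ultimately have "(\<lambda>m. complex_of_real (\<Sum>i<m. (L2_norm (E (A i) f))\<^sup>2)) \<longlonglongrightarrow> of_real ((L2_norm (E (\<Union>i. A i) f))\<^sup>2)"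
        by (simp only: E_inner_self[OF U f])
      then have "(\<lambda>m. (\<Sum>i<m. (L2_norm (E (A i) f))\<^sup>2)) \<longlonglongrightarrow> (L2_norm (E (\<Union>i. A i) f))\<^sup>2"
        by (simp only: tendsto_of_real_iff)
      then have "(\<lambda>i. (L2_norm (E (A i) f))\<^sup>2) sums (L2_norm (E (\<Union>i. A i) f))\<^sup>2"
        by (simp add: sums_def)
      then have "(\<Sum>i. ennreal ((L2_norm (E (A i) f))\<^sup>2)) = ennreal ((L2_norm (E (\<Union>i. A i) f))\<^sup>2)"
        by (rule suminf_ennreal_eq[rotated]) (rule zero_le_power2)
      then show "(\<Sum>i. ?\<mu> (A i)) = ?\<mu> (\<Union> (range A))"
        unfolding \<mu>[OF Am] \<mu>[OF U] .
    qed
  qed (use B in auto)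
  then show ?thesis using \<mu>[OF B] by simp
qed

lemma finite_measure_spectral: "f \<in> L2 \<Longrightarrow> finite_measure (scalar_spectral_measure E f)"
  by (rule finite_measureI) (simp add: emeasure_spectral)

lemma measure_spectral:
  "f \<in> L2 \<Longrightarrow> B \<in> sets borel \<Longrightarrow> complex_of_real (measure (scalar_spectral_measure E f) B) = L2_inner (E B f) f"
  by (simp add: measure_def emeasure_spectral E_inner_self)

lemma integrable_spectral:
  assumes "bounded_borel \<phi>" "f \<in> L2" shows "integrable (scalar_spectral_measure E f) \<phi>"
proof -
  interpret finite_measure "scalar_spectral_measure E f" using assms(2) by (rule finite_measure_spectral)
  obtain C where "\<And>t. norm (\<phi> t) \<le> C" using assms(1) by (auto simp: bounded_borel_def)
  then show ?thesis using assms(1)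
    by (intro integrable_const_bound[of _ C]) (auto simp: bounded_borel_def cong: measurable_cong_sets)
qed

lemma spectral_integral_indicator:
  assumes h: "h \<in> L2" and B: "B \<in> sets borel"
  shows "(LINT t|scalar_spectral_measure E h. c * indicator B t) = c * L2_inner (E B h) h"
proof -
  let ?M = "scalar_spectral_measure E h"
  have "(LINT t|?M. (indicator B t :: complex)) = (LINT t|?M. complex_of_real (indicator B t))"
    by (intro Bochner_Integration.integral_cong refl) (auto split: split_indicator)
  also have "\<dots> = of_real (measure ?M B)"
    using B by (simp only: integral_complex_of_real) (simp add: Bochner_Integration.integral_indicator)
  finally show ?thesis using measure_spectral[OF h B] by simp
qed

text \<open>Polarization: among the four terms in the expansion of <E(B)(f + i^k g), f + i^k g>,
  only <E(B)f, g> carries the bare factor cnj(i^k), which cancels the prefactor i^k; the other three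
  end up with powers of i that sum to 0 over k.\<close>

lemma form_indicator:
  assumes B: "B \<in> sets borel" and f: "f \<in> L2" and g: "g \<in> L2"
  shows "spectral_form E (\<lambda>t. c * indicator B t) f g = c * L2_inner (E B f) g"
proof -
  have "spectral_form E (\<lambda>t. c * indicator B t) f g =
     (\<Sum>k<4. \<i> ^ k * (c * L2_inner (E B (\<lambda>x. f x + \<i> ^ k * g x)) (\<lambda>x. f x + \<i> ^ k * g x))) / 4"
    unfolding spectral_form_def spectral_integral_indicator[OF L2_add_cmult[OF f g] B] ..
  also have "\<dots> = c * L2_inner (E B f) g"
    unfolding E_inner_expand[OF B f g] by (simp add: numeral_eq_Suc lessThan_Suc algebra_simps)
  finally show ?thesis .
qed

lemma form_add:
  assumes "bounded_borel \<phi>" "bounded_borel \<psi>" "f \<in> L2" "g \<in> L2"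
  shows "spectral_form E (\<lambda>t. \<phi> t + \<psi> t) f g = spectral_form E \<phi> f g + spectral_form E \<psi> f g"
  unfolding spectral_form_def using assms
  by (simp add: integrable_spectral L2_add_cmult distrib_left sum.distrib add_divide_distrib)

lemma form_cmult: "spectral_form E (\<lambda>t. c * \<phi> t) f g = c * spectral_form E \<phi> f g"
  unfolding spectral_form_def by (simp add: sum_distrib_left mult_ac)

lemma form_sum:
  assumes "finite I" "\<And>i. i \<in> I \<Longrightarrow> bounded_borel (\<phi> i)" "f \<in> L2" "g \<in> L2"
  shows "spectral_form E (\<lambda>t. \<Sum>i\<in>I. \<phi> i t) f g = (\<Sum>i\<in>I. spectral_form E (\<phi> i) f g)"
  using assms
proof (induction I rule: finite_induct)
  case empty
  then show ?case by (simp add: spectral_form_def)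
next
  case (insert i I)
  then show ?case by (simp add: form_add bounded_borel_sum)
qed

lemma spectral_integral_lim:
  assumes "\<And>n. bounded_borel (\<Phi> n)" "\<And>n t. norm (\<Phi> n t) \<le> C" "\<And>t. (\<lambda>n. \<Phi> n t) \<longlonglongrightarrow> \<phi> t" "bounded_borel \<phi>" "h \<in> L2"
  shows "(\<lambda>n. LINT t|scalar_spectral_measure E h. \<Phi> n t) \<longlonglongrightarrow> (LINT t|scalar_spectral_measure E h. \<phi> t)"
proof (rule integral_dominated_convergence[where w = "\<lambda>_. C"])
  interpret finite_measure "scalar_spectral_measure E h" using assms(5) by (rule finite_measure_spectral)
  show "integrable (scalar_spectral_measure E h) (\<lambda>_. C)" by simp
qed (use assms in \<open>auto simp: bounded_borel_def cong: measurable_cong_sets\<close>)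

lemma form_lim:
  assumes "\<And>n. bounded_borel (\<Phi> n)" "\<And>n t. norm (\<Phi> n t) \<le> C" "\<And>t. (\<lambda>n. \<Phi> n t) \<longlonglongrightarrow> \<phi> t" "bounded_borel \<phi>" "f \<in> L2" "g \<in> L2"
  shows "(\<lambda>n. spectral_form E (\<Phi> n) f g) \<longlonglongrightarrow> spectral_form E \<phi> f g"
  unfolding spectral_form_def using assms
  by (intro tendsto_intros spectral_integral_lim[where C = C]) (auto intro: L2_add_cmult)

text \<open>Multiplicativity in its simplest form, with a projection moved to the second argument.
  For indicators it is E(A \<inter> B) = E(A) E(B), and the induction over bounded functions does
  the rest.\<close>

lemma form_indicator_mult:
  assumes B: "B \<in> sets borel" and f: "f \<in> L2" and g: "g \<in> L2" and \<phi>: "bounded_borel \<phi>"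
  shows "spectral_form E (\<lambda>t. indicator B t * \<phi> t) f g = spectral_form E \<phi> f (E B g)"
  using \<phi>
proof (induct rule: bounded_borel_induct)
  case (indicator c A)
  have "(\<lambda>t. indicator B t * (c * indicator A t)) = (\<lambda>t. c * indicator (B \<inter> A) t)"
    by (auto split: split_indicator)
  then show ?case using B f g indicator by (simp add: form_indicator E_inner_Int E_L2)
next
  case (add \<phi> \<psi>)
  have b: "bounded_borel (\<lambda>t. indicator B t * \<xi> t)" if "bounded_borel \<xi>" for \<xi>
    using bounded_borel_mult[OF bounded_borel_indicator[OF B, of 1] that] by simp
  show ?case using add b B f g by (simp add: distrib_left form_add E_L2)
next
  case (lim \<Phi> \<phi> C)
  have b: "bounded_borel (\<lambda>t. indicator B t * \<xi> t)" if "bounded_borel \<xi>" for \<xi>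
    using bounded_borel_mult[OF bounded_borel_indicator[OF B, of 1] that] by simp
  have "(\<lambda>n. spectral_form E (\<lambda>t. indicator B t * \<Phi> n t) f g) \<longlonglongrightarrow> spectral_form E (\<lambda>t. indicator B t * \<phi> t) f g"
  proof (rule form_lim[where C = C])
    have "0 \<le> C" using lim(3) norm_ge_zero order_trans by blast
    then show "norm (indicator B t * \<Phi> n t) \<le> C" for n t using lim(3)[of n t] by (auto split: split_indicator)
    show "(\<lambda>n. indicator B t * \<Phi> n t) \<longlonglongrightarrow> indicator B t * \<phi> t" for t
      by (intro tendsto_mult tendsto_const lim)
  qed (use lim b f g in auto)
  moreover have "(\<lambda>n. spectral_form E (\<Phi> n) f (E B g)) \<longlonglongrightarrow> spectral_form E \<phi> f (E B g)"
    using lim f g B by (intro form_lim[where C = C]) (auto intro: E_L2)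
  ultimately show ?case using lim(2) LIMSEQ_unique by simp
qed

text \<open>Stated for any u that represents \<phi>(H)f weakly, so that it can be used before
  \<phi>(H)f is known to exist. For \<psi> an indicator, symmetry moves E(B) onto g and
  \<open>form_indicator_mult\<close> applies.\<close>

lemma form_mult:
  assumes f: "f \<in> L2" and u: "u \<in> L2" and g: "g \<in> L2" and \<phi>: "bounded_borel \<phi>" and \<psi>: "bounded_borel \<psi>"
    and rep: "\<And>g. g \<in> L2 \<Longrightarrow> L2_inner u g = spectral_form E \<phi> f g"
  shows "spectral_form E \<psi> u g = spectral_form E (\<lambda>t. \<psi> t * \<phi> t) f g"
  using \<psi>
proof (induct rule: bounded_borel_induct)
  case (indicator c B)
  have "spectral_form E (\<lambda>t. c * indicator B t) u g = c * L2_inner u (E B g)"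
    using indicator u g by (simp add: form_indicator E_sym)
  also have "\<dots> = spectral_form E (\<lambda>t. c * (indicator B t * \<phi> t)) f g"
    using indicator f g \<phi> by (simp add: form_cmult form_indicator_mult rep E_L2)
  finally show ?case by (simp add: mult.assoc)
next
  case (add \<psi> \<xi>)
  then show ?case using f u g \<phi> by (simp add: form_add distrib_right bounded_borel_mult)
next
  case (lim \<Psi> \<psi> C)
  obtain D where D: "\<And>t. norm (\<phi> t) \<le> D" using \<phi> by (auto simp: bounded_borel_def)
  have "(\<lambda>n. spectral_form E (\<lambda>t. \<Psi> n t * \<phi> t) f g) \<longlonglongrightarrow> spectral_form E (\<lambda>t. \<psi> t * \<phi> t) f g"
  proof (rule form_lim[where C = "C * D"])
    show "norm (\<Psi> n t * \<phi> t) \<le> C * D" for n t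
      unfolding norm_mult using lim(3)[of n t] D[of t] order_trans[OF norm_ge_zero lim(3)[of n t]]
      by (intro mult_mono) auto
    show "(\<lambda>n. \<Psi> n t * \<phi> t) \<longlonglongrightarrow> \<psi> t * \<phi> t" for t by (intro tendsto_mult tendsto_const lim)
  qed (use lim \<phi> f g in \<open>auto intro: bounded_borel_mult\<close>)
  moreover have "(\<lambda>n. spectral_form E (\<Psi> n) u g) \<longlonglongrightarrow> spectral_form E \<psi> u g"
    using lim u g by (intro form_lim[where C = C]) auto
  ultimately show ?case using lim(2) LIMSEQ_unique by simp
qed

text \<open>This is adjointness of \<phi>(H) and (cnj \<phi>)(H); it moves a vector known only
  weakly from the second argument to the first, where \<open>form_mult\<close> can expand
  it.\<close>

lemma form_hermitian:
  assumes f: "f \<in> L2" and g: "g \<in> L2" and \<phi>: "bounded_borel \<phi>"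
  shows "spectral_form E \<phi> f g = cnj (spectral_form E (\<lambda>t. cnj (\<phi> t)) g f)"
  using \<phi>
proof (induct rule: bounded_borel_induct)
  case (indicator c B)
  have "(\<lambda>t. cnj (c * indicator B t)) = (\<lambda>t. cnj c * indicator B t)" by (auto split: split_indicator)
  then show ?case using indicator f g
    by (simp add: form_indicator E_sym L2_inner_cnj[of g "E B f"])
next
  case (add \<psi> \<xi>)
  then show ?case using f g by (simp add: form_add bounded_borel_cnj)
next
  case (lim \<Psi> \<psi> C)
  have "(\<lambda>n. cnj (spectral_form E (\<lambda>t. cnj (\<Psi> n t)) g f)) \<longlonglongrightarrow> cnj (spectral_form E (\<lambda>t. cnj (\<psi> t)) g f)"
    using lim f g by (intro tendsto_cnj form_lim[where C = C]) (auto intro: bounded_borel_cnj tendsto_cnj)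
  moreover have "(\<lambda>n. spectral_form E (\<Psi> n) f g) \<longlonglongrightarrow> spectral_form E \<psi> f g"
    using lim f g by (intro form_lim[where C = C]) auto
  ultimately show ?case using lim(2) LIMSEQ_unique by simp
qed

text \<open>Polarization on the diagonal involves the measures of (1 + i^k) f; checking the identity
  on indicators avoids computing them.\<close>

lemma form_diagonal:
  assumes f: "f \<in> L2" and \<phi>: "bounded_borel \<phi>"
  shows "spectral_form E \<phi> f f = (LINT t|scalar_spectral_measure E f. \<phi> t)"
  using \<phi>
proof (induct rule: bounded_borel_induct)
  case (indicator c B)
  then show ?case using f by (simp only: form_indicator spectral_integral_indicator)
next
  case (add \<psi> \<xi>)
  then show ?case using f by (simp add: form_add integrable_spectral)
next
  case (lim \<Psi> \<psi> C)
  have "(\<lambda>n. spectral_form E (\<Psi> n) f f) \<longlonglongrightarrow> spectral_form E \<psi> f f"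
    using lim f by (intro form_lim[where C = C]) auto
  moreover have "(\<lambda>n. LINT t|scalar_spectral_measure E f. \<Psi> n t) \<longlonglongrightarrow> (LINT t|scalar_spectral_measure E f. \<psi> t)"
    using lim f by (intro spectral_integral_lim[where C = C]) auto
  ultimately show ?case using lim(2) LIMSEQ_unique by simp
qed

text \<open>The norm identity for \<phi>(H)f, again for any weak representative: expand <u, u> by
  \<open>form_hermitian\<close> and \<open>form_mult\<close>. Applied to differences it makes limits
  of represented vectors converge.\<close>

lemma norm_represented:
  assumes f: "f \<in> L2" and u: "u \<in> L2" and \<phi>: "bounded_borel \<phi>"
    and rep: "\<And>g. g \<in> L2 \<Longrightarrow> L2_inner u g = spectral_form E \<phi> f g"
  shows "complex_of_real ((L2_norm u)\<^sup>2) = (LINT t|scalar_spectral_measure E f. \<phi> t * cnj (\<phi> t))"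
proof -
  have "L2_inner u u = cnj (spectral_form E (\<lambda>t. cnj (\<phi> t)) u f)"
    using form_hermitian[OF f u \<phi>] rep[OF u] by simp
  also have "spectral_form E (\<lambda>t. cnj (\<phi> t)) u f = spectral_form E (\<lambda>t. cnj (\<phi> t) * \<phi> t) f f"
    by (rule form_mult[OF f u f \<phi> bounded_borel_cnj[OF \<phi>] rep])
  also have "cnj \<dots> = spectral_form E (\<lambda>t. \<phi> t * cnj (\<phi> t)) f f"
    using form_hermitian[OF f f, of "\<lambda>t. \<phi> t * cnj (\<phi> t)"] \<phi>
    by (simp add: bounded_borel_mult bounded_borel_cnj mult.commute)
  finally show ?thesis using form_diagonal[OF f] \<phi>
    by (simp add: L2_inner_self bounded_borel_mult bounded_borel_cnj)
qed

text \<open>Indicators are represented by multiples of E(B)f, sums by sums. In the limit case the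
  norm identity for \<Psi>_n - \<Psi>_m bounds the distance of the representatives by integrals that
  tend to 0 under dominated convergence; completeness supplies the limit vector, and both sides of
  the pairing converge.\<close>

lemma exists_represented:
  assumes f: "f \<in> L2" and \<phi>: "bounded_borel \<phi>"
  shows "\<exists>u\<in>L2. \<forall>g\<in>L2. L2_inner u g = spectral_form E \<phi> f g"
  using \<phi>
proof (induct rule: bounded_borel_induct)
  case (indicator c B)
  then show ?case using f
    by (intro bexI[of _ "\<lambda>x. c * E B f x"]) (auto simp: form_indicator L2_inner_cmult_left E_L2 L2_cmult)
next
  case (add \<psi> \<xi>)
  then obtain u v where "u \<in> L2" "v \<in> L2" "\<forall>g\<in>L2. L2_inner u g = spectral_form E \<psi> f g"
    "\<forall>g\<in>L2. L2_inner v g = spectral_form E \<xi> f g" by blast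
  then show ?case using add f L2_inner_add_cmult_left[of u v _ 1]
    by (intro bexI[of _ "\<lambda>x. u x + v x"]) (auto simp: form_add L2_add)
next
  case (lim \<Psi> \<psi> C)
  then have "\<forall>n. \<exists>u. u \<in> L2 \<and> (\<forall>g\<in>L2. L2_inner u g = spectral_form E (\<Psi> n) f g)" by blast
  then obtain u where u: "\<And>n. u n \<in> L2" "\<And>n g. g \<in> L2 \<Longrightarrow> L2_inner (u n) g = spectral_form E (\<Psi> n) f g"
    by metis
  let ?M = "scalar_spectral_measure E f"
  interpret finite_measure ?M using f by (rule finite_measure_spectral)
  define a where "a n = (LINT t|?M. (norm (\<Psi> n t - \<psi> t))\<^sup>2)" for n
  have psiC: "norm (\<psi> t) \<le> C" for t
    using lim(3) by (intro tendsto_upperbound[OF tendsto_norm[OF lim(4)[of t]]] always_eventually) auto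
  have C2: "norm (\<Psi> n t - \<psi> t) \<le> 2 * C" for n t
    using norm_triangle_ineq4[of "\<Psi> n t" "\<psi> t"] lim(3)[of n t] psiC[of t] by simp
  have C3: "norm ((norm (\<Psi> n t - \<psi> t))\<^sup>2) \<le> (2 * C)\<^sup>2" for n t
    using power_mono[OF C2[of n t] norm_ge_zero, of 2] by simp
  have mb: "\<Psi> n \<in> borel_measurable borel" "\<psi> \<in> borel_measurable borel" for n
    using lim by (auto dest: bounded_borel_measurable)
  have sq: "integrable ?M (\<lambda>t. (norm (\<Psi> n t - \<psi> t))\<^sup>2)" for n
  proof (rule integrable_const_bound[of _ "(2 * C)\<^sup>2"])
    show "AE t in ?M. norm ((norm (\<Psi> n t - \<psi> t))\<^sup>2) \<le> (2 * C)\<^sup>2"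
      by (rule AE_I2) (rule C3)
  qed (use mb in measurable)
  have a: "a \<longlonglongrightarrow> 0"
  proof -
    have "a \<longlonglongrightarrow> (LINT t|?M. 0)"
      unfolding a_def
    proof (rule integral_dominated_convergence[where w = "\<lambda>_. (2 * C)\<^sup>2"])
      show "AE t in ?M. (\<lambda>n. (norm (\<Psi> n t - \<psi> t))\<^sup>2) \<longlonglongrightarrow> 0"
      proof (rule AE_I2)
        fix t
        have "(\<lambda>n. (norm (\<Psi> n t - \<psi> t))\<^sup>2) \<longlonglongrightarrow> (norm (\<psi> t - \<psi> t))\<^sup>2" by (intro tendsto_intros lim)
        then show "(\<lambda>n. (norm (\<Psi> n t - \<psi> t))\<^sup>2) \<longlonglongrightarrow> 0" by simp
      qed
      show "AE t in ?M. norm ((norm (\<Psi> n t - \<psi> t))\<^sup>2) \<le> (2 * C)\<^sup>2" for n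
        by (rule AE_I2) (rule C3)
      show "(\<lambda>t. (norm (\<Psi> n t - \<psi> t))\<^sup>2) \<in> borel_measurable ?M" for n
        using mb by measurable
      show "integrable ?M (\<lambda>_. (2 * C)\<^sup>2)" by simp
    qed simp
    then show ?thesis by simp
  qed
  \<comment> \<open>The norm identity for the difference, followed by |a - b|^2 \<le> 2|a|^2 +
    2|b|^2 with both functions measured from the limit \<psi>.\<close>
  have dist: "(L2_norm (\<lambda>x. u n x - u m x))\<^sup>2 \<le> 2 * a n + 2 * a m" for n m
  proof -
    let ?\<xi> = "\<lambda>t. \<Psi> n t - \<Psi> m t"
    have b: "bounded_borel ?\<xi>" using lim by (intro bounded_borel_diff)
    have "spectral_form E ?\<xi> f g = spectral_form E (\<Psi> n) f g - spectral_form E (\<Psi> m) f g" if "g \<in> L2" for g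
      using form_add[OF lim(1)[of n] bounded_borel_mult[OF bounded_borel_const[of "-1"] lim(1)[of m]] f that] form_cmult[of "-1" "\<Psi> m" f g]
      by simp
    then have "complex_of_real ((L2_norm (\<lambda>x. u n x - u m x))\<^sup>2) = (LINT t|?M. ?\<xi> t * cnj (?\<xi> t))"
      using u by (intro norm_represented f b L2_diff) (auto simp: L2_inner_diff_left)
    also have "(\<lambda>t. ?\<xi> t * cnj (?\<xi> t)) = (\<lambda>t. of_real ((norm (?\<xi> t))\<^sup>2))"
      by (simp only: complex_norm_square)
    finally have "(L2_norm (\<lambda>x. u n x - u m x))\<^sup>2 = (LINT t|?M. (norm (?\<xi> t))\<^sup>2)"
      by (simp only: integral_complex_of_real of_real_eq_iff)
    also have "\<dots> \<le> (LINT t|?M. 2 * (norm (\<Psi> n t - \<psi> t))\<^sup>2 + 2 * (norm (\<Psi> m t - \<psi> t))\<^sup>2)"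
    proof (rule integral_mono')
      show "integrable ?M (\<lambda>t. 2 * (norm (\<Psi> n t - \<psi> t))\<^sup>2 + 2 * (norm (\<Psi> m t - \<psi> t))\<^sup>2)"
        by (intro Bochner_Integration.integrable_add integrable_mult_right sq)
      fix t
      have "norm (?\<xi> t) \<le> norm (\<Psi> n t - \<psi> t) + norm (\<Psi> m t - \<psi> t)"
        using norm_triangle_ineq4[of "\<Psi> n t - \<psi> t" "\<Psi> m t - \<psi> t"] by simp
      then have "(norm (?\<xi> t))\<^sup>2 \<le> (norm (\<Psi> n t - \<psi> t) + norm (\<Psi> m t - \<psi> t))\<^sup>2"
        by (intro power_mono) auto
      also have "\<dots> \<le> 2 * (norm (\<Psi> n t - \<psi> t))\<^sup>2 + 2 * (norm (\<Psi> m t - \<psi> t))\<^sup>2"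
        using sum_squares_bound[of "norm (\<Psi> n t - \<psi> t)" "norm (\<Psi> m t - \<psi> t)"] by (simp add: power2_sum)
      finally show "(norm (?\<xi> t))\<^sup>2 \<le> 2 * (norm (\<Psi> n t - \<psi> t))\<^sup>2 + 2 * (norm (\<Psi> m t - \<psi> t))\<^sup>2" .
    qed simp
    also have "\<dots> = 2 * a n + 2 * a m"
      unfolding a_def using sq by simp
    finally show ?thesis .
  qed
  have "\<exists>N. \<forall>n\<ge>N. \<forall>m\<ge>N. L2_norm (\<lambda>x. u n x - u m x) < e" if "0 < e" for e
  proof -
    have "\<forall>\<^sub>F n in sequentially. a n < e\<^sup>2 / 4" using order_tendstoD(2)[OF a, of "e\<^sup>2 / 4"] that by simp
    then obtain N where N: "\<And>n. n \<ge> N \<Longrightarrow> a n < e\<^sup>2 / 4" unfolding eventually_sequentially by blast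
    have "L2_norm (\<lambda>x. u n x - u m x) < e" if "n \<ge> N" "m \<ge> N" for n m
    proof (rule power2_less_imp_less)
      show "(L2_norm (\<lambda>x. u n x - u m x))\<^sup>2 < e\<^sup>2"
        using dist[of n m] N[OF that(1)] N[OF that(2)] by linarith
    qed (use \<open>0 < e\<close> in simp)
    then show ?thesis by blast
  qed
  from L2_complete[OF u(1) this]
  obtain v where v: "v \<in> L2" "(\<lambda>n. L2_norm (\<lambda>x. u n x - v x)) \<longlonglongrightarrow> 0" by blast
  have "L2_inner v g = spectral_form E \<psi> f g" if g: "g \<in> L2" for g
  proof (rule LIMSEQ_unique)
    show "(\<lambda>n. L2_inner (u n) g) \<longlonglongrightarrow> L2_inner v g" using u(1) v g by (intro L2_inner_tendsto)
    show "(\<lambda>n. L2_inner (u n) g) \<longlonglongrightarrow> spectral_form E \<psi> f g"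
      using lim f g by (simp add: u(2)) (intro form_lim[where C = C], auto)
  qed
  then show ?case using v(1) by blast
qed

text \<open>For bounded \<phi> the domain condition holds for every f in L^2, because the scalar
  spectral measures are finite; so the testing runs over all of L^2.\<close>

lemma spectral_integral_bounded_iff:
  assumes \<phi>: "bounded_borel \<phi>"
  shows "(f, u) \<in> spectral_integral E \<phi> \<longleftrightarrow> f \<in> L2 \<and> u \<in> L2 \<and> (\<forall>g\<in>L2. L2_inner u g = spectral_form E \<phi> f g)"
proof -
  have "(\<integral>\<^sup>+t. ennreal ((norm (\<phi> t))\<^sup>2) \<partial>scalar_spectral_measure E f) < \<infinity>" if f: "f \<in> L2" for f
  proof -
    interpret finite_measure "scalar_spectral_measure E f" using f by (rule finite_measure_spectral)
    obtain C where C: "\<And>t. norm (\<phi> t) \<le> C" using \<phi> by (auto simp: bounded_borel_def)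
    have "(\<integral>\<^sup>+t. ennreal ((norm (\<phi> t))\<^sup>2) \<partial>scalar_spectral_measure E f) \<le> (\<integral>\<^sup>+t. ennreal (C\<^sup>2) \<partial>scalar_spectral_measure E f)"
      using C by (intro nn_integral_mono ennreal_leI power_mono) auto
    also have "\<dots> < \<infinity>" by (simp add: ennreal_mult_less_top emeasure_eq_measure)
    finally show ?thesis .
  qed
  then have "spectral_integral_domain E \<phi> = L2" by (auto simp: spectral_integral_domain_def)
  then show ?thesis by (simp add: spectral_integral_def)
qed

text \<open>Once a representative exists the choice in \<open>fun_calc\<close> is satisfiable: take
  a continuous one if there is one, and any other otherwise.\<close>

lemma fun_calc_represented:
  assumes \<phi>: "bounded_borel \<phi>" and f: "f \<in> L2"
  shows "(f, fun_calc E \<phi> f) \<in> spectral_integral E \<phi> \<and>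
     ((\<exists>v. (f, v) \<in> spectral_integral E \<phi> \<and> continuous_on UNIV v) \<longrightarrow> continuous_on UNIV (fun_calc E \<phi> f))"
proof -
  have "\<exists>u. (f, u) \<in> spectral_integral E \<phi> \<and>
    ((\<exists>v. (f, v) \<in> spectral_integral E \<phi> \<and> continuous_on UNIV v) \<longrightarrow> continuous_on UNIV u)"
    using exists_represented[OF f \<phi>] f spectral_integral_bounded_iff[OF \<phi>] by blast
  from someI_ex[OF this] show ?thesis unfolding fun_calc_def .
qed

lemma fun_calc_L2: "bounded_borel \<phi> \<Longrightarrow> f \<in> L2 \<Longrightarrow> fun_calc E \<phi> f \<in> L2"
  using fun_calc_represented spectral_integral_bounded_iff by blast

lemma fun_calc_inner:
  "bounded_borel \<phi> \<Longrightarrow> f \<in> L2 \<Longrightarrow> g \<in> L2 \<Longrightarrow> L2_inner (fun_calc E \<phi> f) g = spectral_form E \<phi> f g"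
  using fun_calc_represented spectral_integral_bounded_iff by blast

text \<open>A continuous function equal almost everywhere to the chosen one has the same inner
  products, hence lies in the graph and triggers the continuity clause of the choice.\<close>

lemma fun_calc_continuous:
  assumes \<phi>: "bounded_borel \<phi>" and f: "f \<in> L2"
    and v: "continuous_on UNIV v" "ae_eq (fun_calc E \<phi> f) v"
  shows "continuous_on UNIV (fun_calc E \<phi> f)"
proof -
  let ?u = "fun_calc E \<phi> f"
  have u: "?u \<in> L2" by (rule fun_calc_L2[OF \<phi> f])
  have [measurable]: "v \<in> borel_measurable borel" "?u \<in> borel_measurable borel"
    using v(1) u by (auto intro: borel_measurable_continuous_onI L2_measurable)
  have "integrable lborel (\<lambda>x. (norm (v x))\<^sup>2)"
    using v(2) L2_integrable_sq[OF u] by (subst integrable_cong_AE[where g = "\<lambda>x. (norm (?u x))\<^sup>2"]) (auto simp: ae_eq_def)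
  then have vL: "v \<in> L2" by (simp add: L2_def)
  have "(f, v) \<in> spectral_integral E \<phi>"
    unfolding spectral_integral_bounded_iff[OF \<phi>]
    using f vL u v(2) fun_calc_inner[OF \<phi> f] by (auto simp: ae_eq_L2_inner[OF v(2) u vL, symmetric])
  then show ?thesis using fun_calc_represented[OF \<phi> f] v(1) by blast
qed

text \<open>Pairing with an arbitrary g and weak multiplicativity turn the identity between
  functions on the real line into one between vectors.\<close>

lemma fun_calc_reproducing:
  assumes \<phi>: "bounded_borel \<phi>" and I: "finite I" and \<psi>: "\<And>i. i \<in> I \<Longrightarrow> bounded_borel (\<psi> i)"
    and eq: "\<And>t. (\<Sum>i\<in>I. \<psi> i t * \<phi> t) = \<phi> t" and f: "f \<in> L2"
  shows "ae_eq (fun_calc E \<phi> f) (\<lambda>x. \<Sum>i\<in>I. fun_calc E (\<psi> i) (fun_calc E \<phi> f) x)"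
proof (rule L2_inner_separates)
  let ?u = "fun_calc E \<phi> f"
  show u: "?u \<in> L2" by (rule fun_calc_L2[OF \<phi> f])
  show "(\<lambda>x. \<Sum>i\<in>I. fun_calc E (\<psi> i) ?u x) \<in> L2" using \<psi> u \<phi> f by (intro L2_sum fun_calc_L2)
  fix g :: "'a \<Rightarrow> complex" assume g: "g \<in> L2"
  have "L2_inner (\<lambda>x. \<Sum>i\<in>I. fun_calc E (\<psi> i) ?u x) g = (\<Sum>i\<in>I. L2_inner (fun_calc E (\<psi> i) ?u) g)"
    using \<psi> u g I \<phi> f by (intro L2_inner_sum_left fun_calc_L2)
  also have "\<dots> = (\<Sum>i\<in>I. spectral_form E (\<psi> i) ?u g)"
    using \<psi> u g by (intro sum.cong refl fun_calc_inner)
  also have "\<dots> = (\<Sum>i\<in>I. spectral_form E (\<lambda>t. \<psi> i t * \<phi> t) f g)"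
    using \<psi> u g f \<phi> by (intro sum.cong refl form_mult fun_calc_inner) auto
  also have "\<dots> = spectral_form E (\<lambda>t. \<Sum>i\<in>I. \<psi> i t * \<phi> t) f g"
    using \<psi> \<phi> f g I by (intro form_sum[symmetric] bounded_borel_mult)
  also have "\<dots> = L2_inner ?u g" using fun_calc_inner[OF \<phi> f g] by (simp add: eq)
  finally show "L2_inner ?u g = L2_inner (\<lambda>x. \<Sum>i\<in>I. fun_calc E (\<psi> i) ?u x) g" by simp
qed

end

section \<open>Smooth dyadic partitions of unity\<close>

lemma partial_derivs_append: "partial_derivs (xs @ ys) f = partial_derivs xs (partial_derivs ys f)"
  by (induction xs) auto

text \<open>Unlike \<open>partial_derivs\<close> this peels off the innermost derivative first, which makes the product
  rule an easy induction.\<close>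

primrec times_differentiable :: "nat \<Rightarrow> (real \<Rightarrow> complex) \<Rightarrow> bool" where
  "times_differentiable 0 f \<longleftrightarrow> True"
| "times_differentiable (Suc k) f \<longleftrightarrow>
     (\<exists>f'. (\<forall>x. (f has_vector_derivative f' x) (at x)) \<and> times_differentiable k f')"

lemma partial_derivs_1:
  assumes "\<And>x. (f has_vector_derivative f' x) (at x)"
  shows "partial_derivs [1] f = (f' :: real \<Rightarrow> complex)"
proof
  fix x
  have "frechet_derivative f (at x) = (\<lambda>h. h *\<^sub>R f' x)"
    using frechet_derivative_at[OF assms[of x, unfolded has_vector_derivative_def]] by simp
  then show "partial_derivs [1] f x = f' x" by simp
qed

lemma partial_derivs_Suc: "partial_derivs (replicate (Suc k) 1) f = partial_derivs (replicate k 1) (partial_derivs [1] (f :: real \<Rightarrow> complex))"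
  using partial_derivs_append[of "replicate k 1" "[1]" f] by (simp add: replicate_append_same)

lemma differentiable_has_vector_derivative_partial:
  fixes f :: "real \<Rightarrow> complex"
  assumes "f differentiable (at x)" shows "(f has_vector_derivative partial_derivs [1] f x) (at x)"
proof -
  have D: "(f has_derivative frechet_derivative f (at x)) (at x)"
    using assms by (simp add: frechet_derivative_works)
  have *: "frechet_derivative f (at x) (h *\<^sub>R 1) = h *\<^sub>R frechet_derivative f (at x) 1" for h
    by (rule linear_scale[OF linear_frechet_derivative[OF assms]])
  have "frechet_derivative f (at x) = (\<lambda>h. h *\<^sub>R frechet_derivative f (at x) 1)"
  proof
    show "frechet_derivative f (at x) h = h *\<^sub>R frechet_derivative f (at x) 1" for h
      using *[of h] unfolding real_scaleR_def mult_1_right .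
  qed
  with D show ?thesis
    unfolding has_vector_derivative_def partial_derivs.simps by (rule back_subst[of "\<lambda>D. (f has_derivative D) (at x)"])
qed

lemma times_differentiable_imp:
  "times_differentiable (Suc k) f \<Longrightarrow> partial_derivs (replicate k 1) f differentiable (at x)"
proof (induction k arbitrary: f)
  case 0
  then show ?case by (auto simp: has_vector_derivative_def differentiable_def)
next
  case (Suc k)
  then obtain f' where f': "\<And>x. (f has_vector_derivative f' x) (at x)" "times_differentiable (Suc k) f'"
    unfolding times_differentiable.simps(2)[of "Suc k"] by blast
  show ?case unfolding partial_derivs_Suc partial_derivs_1[OF f'(1)] by (rule Suc.IH[OF f'(2)])
qed

lemma times_differentiableI:
  assumes "\<And>k x. partial_derivs (replicate k 1) f differentiable (at x)"
  shows "times_differentiable k f"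
  using assms
proof (induction k arbitrary: f)
  case (Suc k)
  have "f differentiable (at x)" for x using Suc.prems[of 0 x] by simp
  then have "(f has_vector_derivative partial_derivs [1] f x) (at x)" for x
    by (rule differentiable_has_vector_derivative_partial)
  moreover have "times_differentiable k (partial_derivs [1] f)"
    using Suc.prems unfolding partial_derivs_Suc[symmetric] by (intro Suc.IH) (metis partial_derivs_Suc)
  ultimately show ?case unfolding times_differentiable.simps(2) by blast
qed simp

text \<open>On the line the only basis vector is 1, so a list of directions is determined by its
  length, and iterated partial derivatives are the ordinary ones.\<close>

lemma smooth_real_iff: "smooth (f :: real \<Rightarrow> complex) \<longleftrightarrow> (\<forall>k. times_differentiable k f)"
proof
  assume "smooth f"
  then have "partial_derivs (replicate k 1) f differentiable (at x)" for k x
    unfolding smooth_def by (auto simp: set_replicate_conv_if)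
  then show "\<forall>k. times_differentiable k f" by (auto intro: times_differentiableI)
next
  assume *: "\<forall>k. times_differentiable k f"
  show "smooth f"
    unfolding smooth_def
  proof (intro allI impI)
    fix bs :: "real list" and x assume "set bs \<subseteq> Basis"
    then have "bs = replicate (length bs) 1" by (intro replicate_eqI) auto
    moreover have "partial_derivs (replicate (length bs) 1) f differentiable (at x)"
      using * by (intro times_differentiable_imp) blast
    ultimately show "partial_derivs bs f differentiable (at x)" by simp
  qed
qed

lemma times_differentiable_Suc_imp: "times_differentiable (Suc k) f \<Longrightarrow> times_differentiable k f"
proof (induction k arbitrary: f)
  case (Suc k)
  then obtain f' where "\<forall>x. (f has_vector_derivative f' x) (at x)" "times_differentiable (Suc k) f'"
    unfolding times_differentiable.simps(2)[of "Suc k"] by blast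
  then show ?case using Suc.IH by auto
qed simp

lemma times_differentiable_add:
  "times_differentiable k f \<Longrightarrow> times_differentiable k g \<Longrightarrow> times_differentiable k (\<lambda>x. f x + g x)"
proof (induction k arbitrary: f g)
  case (Suc k)
  then obtain f' g' where "\<forall>x. (f has_vector_derivative f' x) (at x)" "times_differentiable k f'"
    "\<forall>x. (g has_vector_derivative g' x) (at x)" "times_differentiable k g'" by auto
  then show ?case using Suc.IH[of f' g']
    by (auto intro!: exI[of _ "\<lambda>x. f' x + g' x"] has_vector_derivative_add)
qed simp

lemma times_differentiable_mult:
  "times_differentiable k f \<Longrightarrow> times_differentiable k g \<Longrightarrow> times_differentiable k (\<lambda>x. f x * g x)"
proof (induction k arbitrary: f g)
  case (Suc k)
  then obtain f' g' where *: "\<forall>x. (f has_vector_derivative f' x) (at x)" "times_differentiable k f'"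
    "\<forall>x. (g has_vector_derivative g' x) (at x)" "times_differentiable k g'" by auto
  have "times_differentiable k f" "times_differentiable k g"
    using Suc.prems by (auto simp del: times_differentiable.simps intro: times_differentiable_Suc_imp)
  then have "times_differentiable k (\<lambda>x. f x * g' x + f' x * g x)"
    using * by (intro times_differentiable_add Suc.IH)
  then show ?case using *
    by (auto intro!: exI[of _ "\<lambda>x. f x * g' x + f' x * g x"] has_vector_derivative_mult)
qed simp

lemma times_differentiable_const: "times_differentiable k (\<lambda>x. c)"
  by (induction k arbitrary: c) (auto intro!: exI[of _ "\<lambda>x. 0"] derivative_eq_intros)

lemma times_differentiable_cnj:
  "times_differentiable k f \<Longrightarrow> times_differentiable k (\<lambda>x. cnj (f x))"
proof (induction k arbitrary: f)
  case (Suc k)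
  then obtain f' where "\<forall>x. (f has_vector_derivative f' x) (at x)" "times_differentiable k f'" by auto
  then show ?case using Suc.IH[of f']
    by (auto intro!: exI[of _ "\<lambda>x. cnj (f' x)"] has_vector_derivative_cnj)
qed simp

lemma has_vector_derivative_affine:
  fixes f :: "real \<Rightarrow> complex"
  assumes "\<And>x. (f has_vector_derivative f' x) (at x)"
  shows "((\<lambda>x. f (a * x + b)) has_vector_derivative of_real a * f' (a * x + b)) (at x)"
proof -
  have "((\<lambda>x. a * x + b) has_vector_derivative a) (at x)"
    by (auto intro!: derivative_eq_intros simp: has_real_derivative_iff_has_vector_derivative[symmetric])
  from vector_diff_chain_at[OF this assms] show ?thesis by (simp add: o_def scaleR_conv_of_real)
qed

lemma times_differentiable_affine:
  "times_differentiable k f \<Longrightarrow> times_differentiable k (\<lambda>x. f (a * x + b))"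
proof (induction k arbitrary: f)
  case (Suc k)
  then obtain f' where f': "\<forall>x. (f has_vector_derivative f' x) (at x)" "times_differentiable k f'" by auto
  have "times_differentiable k (\<lambda>x. of_real a * f' (a * x + b))"
    using f' by (intro times_differentiable_mult times_differentiable_const Suc.IH)
  then show ?case using f'
    by (auto intro!: exI[of _ "\<lambda>x. of_real a * f' (a * x + b)"] has_vector_derivative_affine)
qed simp

lemma times_differentiable_diff:
  assumes "times_differentiable k f" "times_differentiable k g" shows "times_differentiable k (\<lambda>x. f x - g x)"
  using times_differentiable_add[OF assms(1) times_differentiable_mult[OF times_differentiable_const[of k "-1"] assms(2)]]
  by simp

text \<open>Each derivative brings out a factor a; with a = 2^(-j) this is the scaling required in
  the derivative bounds of a dyadic system.\<close>

lemma partial_derivs_affine: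
  fixes f :: "real \<Rightarrow> complex"
  assumes "smooth f"
  shows "partial_derivs (replicate k 1) (\<lambda>x. f (a * x)) = (\<lambda>x. of_real a ^ k * partial_derivs (replicate k 1) f (a * x))"
proof (induction k)
  case (Suc k)
  have "partial_derivs (replicate k 1) f differentiable (at x)" for x
    using assms unfolding smooth_real_iff by (intro times_differentiable_imp) auto
  then have "(partial_derivs (replicate k 1) f has_vector_derivative partial_derivs (replicate (Suc k) 1) f x) (at x)" for x
    using differentiable_has_vector_derivative_partial[of "partial_derivs (replicate k 1) f" x] by simp
  from has_vector_derivative_affine[OF this, of a 0]
  have d: "((\<lambda>x. partial_derivs (replicate k 1) f (a * x)) has_vector_derivative
     of_real a * partial_derivs (replicate (Suc k) 1) f (a * x)) (at x)" for x by simp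
  have "((\<lambda>x. of_real a ^ k * partial_derivs (replicate k 1) f (a * x)) has_vector_derivative
     of_real a ^ Suc k * partial_derivs (replicate (Suc k) 1) f (a * x)) (at x)" for x
    using has_vector_derivative_mult_right[OF d[of x], of "of_real a ^ k"]
    by (simp add: mult_ac)
  from partial_derivs_1[OF this] show ?case using Suc.IH by simp
qed simp

lemma partial_derivs_diff:
  fixes f g :: "real \<Rightarrow> complex"
  assumes "smooth f" "smooth g"
  shows "partial_derivs (replicate k 1) (\<lambda>x. f x - g x) =
    (\<lambda>x. partial_derivs (replicate k 1) f x - partial_derivs (replicate k 1) g x)"
proof (induction k)
  case (Suc k)
  have d: "(partial_derivs (replicate k 1) h has_vector_derivative partial_derivs (replicate (Suc k) 1) h x) (at x)"
    if "smooth h" for h :: "real \<Rightarrow> complex" and x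
    using that times_differentiable_imp[of k h] differentiable_has_vector_derivative_partial[of "partial_derivs (replicate k 1) h" x]
    unfolding smooth_real_iff by simp
  from partial_derivs_1[OF has_vector_derivative_diff[OF d[OF assms(1)] d[OF assms(2)]]]
  show ?case using Suc.IH by simp
qed simp

text \<open>Outside [-R, R] the function vanishes on an open set, hence so do all its derivatives;
  inside, continuity on a compact interval gives the bound.\<close>

lemma partial_derivs_bounded:
  fixes f :: "real \<Rightarrow> complex"
  assumes "smooth f" and supp: "\<And>x. R < \<bar>x\<bar> \<Longrightarrow> f x = 0"
  shows "\<exists>B. \<forall>x. norm (partial_derivs (replicate k 1) f x) \<le> B"
proof -
  have zero: "partial_derivs (replicate k 1) f x = 0" if "R < \<bar>x\<bar>" for x
    using that
  proof (induction k arbitrary: x)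
    case (Suc k)
    have "open {x::real. R < \<bar>x\<bar>}" by (intro open_Collect_less continuous_intros)
    then have "(partial_derivs (replicate k 1) f has_derivative (\<lambda>h. 0)) (at x)"
      using Suc has_derivative_transform_within_open[of "\<lambda>x. 0::complex" "\<lambda>h. 0" x UNIV "{x. R < \<bar>x\<bar>}" "partial_derivs (replicate k 1) f"]
      by simp
    from frechet_derivative_at[OF this] show ?case by (metis replicate_Suc partial_derivs.simps(2))
  qed (use supp in simp)
  have "partial_derivs (replicate k 1) f differentiable (at x)" for x
    using assms unfolding smooth_real_iff by (intro times_differentiable_imp) auto
  then have "continuous_on {- R..R} (partial_derivs (replicate k 1) f)"
    by (intro continuous_at_imp_continuous_on ballI differentiable_imp_continuous_within)
  then have "bounded (partial_derivs (replicate k 1) f ` {- R..R})"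
    by (intro compact_imp_bounded compact_continuous_image) auto
  then obtain B where B: "\<And>x. x \<in> {- R..R} \<Longrightarrow> norm (partial_derivs (replicate k 1) f x) \<le> B"
    unfolding bounded_iff by blast
  have "norm (partial_derivs (replicate k 1) f x) \<le> max B 0" for x
    using B[of x] zero[of x] by (cases "R < \<bar>x\<bar>") (auto simp: abs_le_iff not_less le_max_iff_disj)
  then show ?thesis by blast
qed

text \<open>In place of an explicit exponential bump, the nonzero compactly supported f is used: the
  squared modulus of a rescaled copy is a nonnegative smooth \<beta> supported in [1/2, 1], and its
  antiderivative, reversed and normalized, descends from 1 to 0 across that interval.\<close>

lemma exists_smooth_cutoff:
  fixes f :: "real \<Rightarrow> complex"
  assumes f: "smooth f" and supp: "\<And>x. f x \<noteq> 0 \<Longrightarrow> \<bar>x\<bar> \<le> R" and R: "0 < R" and nz: "f x0 \<noteq> 0"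
  shows "\<exists>\<theta> :: real \<Rightarrow> complex. smooth \<theta> \<and> (\<forall>x. \<bar>x\<bar> \<le> 1/2 \<longrightarrow> \<theta> x = 1) \<and> (\<forall>x. 1 \<le> \<bar>x\<bar> \<longrightarrow> \<theta> x = 0)"
proof -
  \<comment> \<open>The affine map 4 R x - 3 R takes [1/2, 1] onto [-R, R].\<close>
  define g where "g x = f (4 * R * x + (- 3 * R))" for x
  define \<beta> where "\<beta> x = (norm (g x))\<^sup>2" for x
  have gk: "times_differentiable k g" for k
    using f unfolding g_def[abs_def] smooth_real_iff by (intro times_differentiable_affine) auto
  have \<beta>eq: "complex_of_real (\<beta> x) = g x * cnj (g x)" for x by (simp add: \<beta>_def complex_norm_square del: of_real_power)
  have \<beta>k: "times_differentiable k (\<lambda>x. complex_of_real (\<beta> x))" for k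
    unfolding \<beta>eq by (intro times_differentiable_mult times_differentiable_cnj gk)
  have \<beta>0: "\<beta> x = 0" if "x < 1/2 \<or> 1 < x" for x
  proof -
    have "\<not> \<bar>4 * R * x + (- 3 * R)\<bar> \<le> R"
    proof
      assume "\<bar>4 * R * x + (- 3 * R)\<bar> \<le> R"
      then have "R * (1/2) \<le> R * x" "R * x \<le> R * 1" by (auto simp: abs_le_iff algebra_simps)
      then show False using that R by (auto simp: mult_le_cancel_left)
    qed
    then show ?thesis using supp[of "4 * R * x + (- 3 * R)"] by (auto simp: \<beta>_def g_def)
  qed
  have "isCont (\<lambda>x. complex_of_real (\<beta> x)) x" for x
    using \<beta>k[of "Suc 0"] by (auto intro: has_vector_derivative_continuous)
  then have "isCont (\<lambda>x. Re (complex_of_real (\<beta> x))) x" for x by (rule continuous_Re)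
  then have "isCont \<beta> x" for x by simp
  then have "\<exists>F. \<forall>x::real. -\<infinity> < ereal x \<longrightarrow> ereal x < \<infinity> \<longrightarrow> (F has_vector_derivative \<beta> x) (at x)"
    by (intro einterval_antiderivative) auto
  then obtain F where F: "\<And>x. (F has_vector_derivative \<beta> x) (at x)" by auto
  have FD: "(F has_real_derivative \<beta> x) (at x)" for x
    using F by (simp add: has_real_derivative_iff_has_vector_derivative)
  have mvt: "\<exists>z. x < z \<and> z < y \<and> F y - F x = (y - x) * \<beta> z" if "x < y" for x y
    using MVT2[OF that, of F \<beta>] FD by auto
  have mono: "F x \<le> F y" if le: "x \<le> y" for x y
  proof (cases "x = y")
    case False
    then obtain z where "F y - F x = (y - x) * \<beta> z" using mvt[of x y] le by auto
    moreover have "0 \<le> (y - x) * \<beta> z" using le by (intro mult_nonneg_nonneg) (auto simp: \<beta>_def)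
    ultimately show ?thesis by linarith
  qed simp
  have left: "F x = F (1/2)" if le: "x \<le> 1/2" for x
  proof (cases "x = 1/2")
    case False
    then obtain z where "z < 1/2" "F (1/2) - F x = (1/2 - x) * \<beta> z" using mvt[of x "1/2"] le by auto
    then show ?thesis using \<beta>0[of z] by simp
  qed (simp only:)
  have right: "F x = F 1" if le: "1 \<le> x" for x
  proof (cases "x = 1")
    case False
    then obtain z where "1 < z" "F x - F 1 = (x - 1) * \<beta> z" using mvt[of 1 x] le by auto
    then show ?thesis using \<beta>0[of z] by simp
  qed simp
  have ne: "F 1 \<noteq> F (1/2)"
  proof
    assume eq: "F 1 = F (1/2)"
    have "F x = F 1" for x
      using left[of x] right[of x] mono[of "1/2" x] mono[of x 1] eq by (cases "x \<le> 1/2"; cases "1 \<le> x") auto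
    then have "F = (\<lambda>x. F 1)" by auto
    then have "(F has_real_derivative 0) (at x)" for x by (metis DERIV_const)
    then have "\<beta> x = 0" for x using DERIV_unique[OF FD[of x]] by blast
    \<comment> \<open>The affine change of variable maps this point to x0, where f does not
      vanish.\<close>
    from this[of "(x0 / R + 3) / 4"] nz R show False by (simp add: \<beta>_def g_def field_simps)
  qed
  define \<eta> where "\<eta> x = complex_of_real (inverse (F 1 - F (1/2))) * (complex_of_real (F 1) - complex_of_real (F x))" for x
  have Fk: "times_differentiable k (\<lambda>x. complex_of_real (F x))" for k
  proof (cases k)
    case (Suc l)
    have "((\<lambda>x. complex_of_real (F x)) has_vector_derivative complex_of_real (\<beta> x)) (at x)" for x
      using FD by (rule has_vector_derivative_of_real)
    then show ?thesis using \<beta>k[of l] unfolding Suc times_differentiable.simps(2)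
      by (intro exI[of _ "\<lambda>x. complex_of_real (\<beta> x)"] conjI allI)
  qed simp
  have \<eta>k: "times_differentiable k \<eta>" for k
    unfolding \<eta>_def[abs_def] by (intro times_differentiable_mult times_differentiable_diff times_differentiable_const Fk)
  have \<eta>1: "\<eta> x = 1" if "x \<le> 1/2" for x
    using left[OF that] ne by (simp add: \<eta>_def flip: of_real_diff of_real_mult)
  have \<eta>0: "\<eta> x = 0" if "1 \<le> x" for x
    using right[OF that] by (simp add: \<eta>_def)
  \<comment> \<open>\<eta> equals 1 on the whole half line left of 1/2; the reflected factor cuts it
    off there and makes \<theta> even.\<close>
  define \<theta> where "\<theta> x = \<eta> x * \<eta> (- 1 * x + 0)" for x
  show ?thesis
  proof (intro exI[of _ \<theta>] conjI allI impI)
    show "smooth \<theta>" unfolding smooth_real_iff \<theta>_def[abs_def]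
      by (intro allI times_differentiable_mult times_differentiable_affine \<eta>k)
    show "\<theta> x = 1" if "\<bar>x\<bar> \<le> 1/2" for x
      using that \<eta>1[of x] \<eta>1[of "-x"] by (simp add: \<theta>_def)
    show "\<theta> x = 0" if "1 \<le> \<bar>x\<bar>" for x using that \<eta>0[of x] \<eta>0[of "-x"] by (auto simp: \<theta>_def abs_if split: if_splits)
  qed
qed

text \<open>The differences \<psi>_j(x) = \<theta>(2^(-j) x) - \<theta>(2^(1-j) x) telescope. For
  |x| below 2^(j-2) both terms are 1 and above 2^j both are 0, which gives the support; three
  consecutive indices sum to \<theta>(2^(-j-1) x) - \<theta>(2^(2-j) x), which is 1 - 0 on the
  annulus of index j.\<close>

lemma exists_dyadic_partition:
  fixes f :: "real \<Rightarrow> complex"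
  assumes f: "smooth f" and supp: "\<And>x. f x \<noteq> 0 \<Longrightarrow> \<bar>x\<bar> \<le> R" and R: "0 < R" and nz: "f x0 \<noteq> 0"
  shows "\<exists>\<psi>. dyadic_support_decay \<psi> \<and>
    (\<forall>j x. 2 powi (j - 2) \<le> \<bar>x\<bar> \<longrightarrow> \<bar>x\<bar> \<le> 2 powi j \<longrightarrow> (\<Sum>i\<in>{j - 1..j + 1}. \<psi> i x) = 1)"
proof -
  obtain \<theta> :: "real \<Rightarrow> complex" where \<theta>: "smooth \<theta>" "\<And>x. \<bar>x\<bar> \<le> 1/2 \<Longrightarrow> \<theta> x = 1" "\<And>x. 1 \<le> \<bar>x\<bar> \<Longrightarrow> \<theta> x = 0"
    using exists_smooth_cutoff[OF assms] by blast
  define \<psi> where "\<psi> j x = \<theta> (2 powi (- j) * x) - \<theta> (2 powi (1 - j) * x)" for j :: int and x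
  have scaled: "smooth (\<lambda>x. \<theta> (a * x))" for a
    using \<theta>(1) times_differentiable_affine[of _ \<theta> a 0] unfolding smooth_real_iff by simp
  have smooth: "smooth (\<psi> j)" for j
    using scaled unfolding \<psi>_def[abs_def] smooth_real_iff by (intro allI times_differentiable_diff) auto
  have shift: "(2::real) powi a * 2 powi b = 2 powi (a + b)" for a b
    by (simp add: power_int_add)
  have two: "(2::real) powi (- 1) = 1/2" "(2::real) powi (- 2) = 1/4"
    by (simp_all add: power_int_minus)
  have supp\<psi>: "2 powi (j - 2) \<le> \<bar>x\<bar> \<and> \<bar>x\<bar> \<le> 2 powi j" if "\<psi> j x \<noteq> 0" for j x
  proof (rule ccontr)
    assume "\<not> ?thesis"
    then consider "\<bar>x\<bar> < 2 powi (j - 2)" | "2 powi j < \<bar>x\<bar>" by linarith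
    then have "\<psi> j x = 0"
    proof cases
      case 1
      have a: "(2::real) powi (1 - j) * 2 powi (j - 2) = 1/2" "(2::real) powi (- j) * 2 powi (j - 2) = 1/4"
        unfolding shift using two by simp_all
      have "2 powi (1 - j) * \<bar>x\<bar> \<le> 2 powi (1 - j) * 2 powi (j - 2)" "2 powi (- j) * \<bar>x\<bar> \<le> 2 powi (- j) * 2 powi (j - 2)"
        using 1 by (auto intro!: mult_left_mono)
      then have "2 powi (1 - j) * \<bar>x\<bar> \<le> 1/2" "2 powi (- j) * \<bar>x\<bar> \<le> 1/4" unfolding a .
      then have "\<bar>2 powi (1 - j) * x\<bar> \<le> 1/2" "\<bar>2 powi (- j) * x\<bar> \<le> 1/2" by (auto simp: abs_mult)
      then show ?thesis by (simp only: \<psi>_def \<theta>(2) diff_self)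
    next
      case 2
      have a: "(2::real) powi (1 - j) * 2 powi j = 2" "(2::real) powi (- j) * 2 powi j = 1"
        unfolding shift by simp_all
      have "2 powi (1 - j) * 2 powi j \<le> 2 powi (1 - j) * \<bar>x\<bar>" "2 powi (- j) * 2 powi j \<le> 2 powi (- j) * \<bar>x\<bar>"
        using 2 by (auto intro!: mult_left_mono)
      then have "2 \<le> 2 powi (1 - j) * \<bar>x\<bar>" "1 \<le> 2 powi (- j) * \<bar>x\<bar>" unfolding a .
      then have "1 \<le> \<bar>2 powi (1 - j) * x\<bar>" "1 \<le> \<bar>2 powi (- j) * x\<bar>" by (auto simp: abs_mult)
      then show ?thesis by (simp only: \<psi>_def \<theta>(3) diff_self)
    qed
    then show False using that by simp
  qed
  have clos: "closure {x. \<psi> j x \<noteq> 0} \<subseteq> {x. 2 powi (j - 2) \<le> \<bar>x\<bar> \<and> \<bar>x\<bar> \<le> 2 powi j}" for j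
    using supp\<psi> by (intro closure_minimal closed_Collect_conj closed_Collect_le continuous_intros) auto
  have "compact (closure {x. \<psi> j x \<noteq> 0})" for j
  proof -
    have "closure {x. \<psi> j x \<noteq> 0} \<subseteq> {- (2 powi j)..2 powi j}" using clos[of j] by (auto simp: abs_le_iff)
    then show ?thesis by (meson bounded_closed_interval bounded_subset closed_closure compact_eq_bounded_closed)
  qed
  then have test: "test_function (\<psi> j)" for j using smooth by (simp add: test_function_def)
  have "\<exists>c. \<forall>j x. norm (partial_derivs (replicate k 1) (\<psi> j) x) \<le> c * 2 powi (- (int k * j))" for k
  proof -
    obtain B where B: "\<And>x. norm (partial_derivs (replicate k 1) \<theta> x) \<le> B"
      using partial_derivs_bounded[OF \<theta>(1), of 1 k] \<theta>(3) by (metis less_imp_le)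
    \<comment> \<open>The two terms of \<psi>_j are scaled by 2^(-j) and 2^(1-j); the second is
      responsible for the factor 2^k.\<close>
    have "norm (partial_derivs (replicate k 1) (\<psi> j) x) \<le> (B + 2 ^ k * B) * 2 powi (- (int k * j))" for j x
    proof -
      have a: "(2 powi (- j)) ^ k = (2::real) powi (- (int k * j))"
        by (simp add: power_int_minus power_int_mult mult.commute[of "int k"] power_inverse)
      have b: "(2 powi (1 - j)) ^ k = 2 ^ k * (2::real) powi (- (int k * j))"
        unfolding a[symmetric] by (simp add: power_int_diff power_int_minus field_simps power_mult_distrib)
      have "partial_derivs (replicate k 1) (\<psi> j) x =
        of_real (2 powi (- j)) ^ k * partial_derivs (replicate k 1) \<theta> (2 powi (- j) * x) -
        of_real (2 powi (1 - j)) ^ k * partial_derivs (replicate k 1) \<theta> (2 powi (1 - j) * x)"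
        unfolding \<psi>_def[abs_def] partial_derivs_diff[OF scaled scaled] partial_derivs_affine[OF \<theta>(1)] ..
      also have "norm \<dots> \<le> (2 powi (- j)) ^ k * B + (2 powi (1 - j)) ^ k * B"
      proof (rule order_trans[OF norm_triangle_ineq4 add_mono])
        show "norm (of_real (2 powi (- j)) ^ k * partial_derivs (replicate k 1) \<theta> (2 powi (- j) * x)) \<le> (2 powi (- j)) ^ k * B"
          unfolding norm_mult norm_power norm_of_real using B by (intro mult_mono) auto
        show "norm (of_real (2 powi (1 - j)) ^ k * partial_derivs (replicate k 1) \<theta> (2 powi (1 - j) * x)) \<le> (2 powi (1 - j)) ^ k * B"
          unfolding norm_mult norm_power norm_of_real using B by (intro mult_mono) auto
      qed
      also have "\<dots> = (B + 2 ^ k * B) * 2 powi (- (int k * j))" unfolding a b by (simp add: algebra_simps)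
      finally show ?thesis .
    qed
    then show ?thesis by blast
  qed
  then have "dyadic_support_decay \<psi>" using test clos unfolding dyadic_support_decay_def by blast
  moreover have "(\<Sum>i\<in>{j - 1..j + 1}. \<psi> i x) = 1" if x: "2 powi (j - 2) \<le> \<bar>x\<bar>" "\<bar>x\<bar> \<le> 2 powi j" for j x
  proof -
    have "{j - 1..j + 1} = {j - 1, j, j + 1}" by auto
    then have "(\<Sum>i\<in>{j - 1..j + 1}. \<psi> i x) = \<psi> (j - 1) x + (\<psi> j x + \<psi> (j + 1) x)" by simp
    also have "\<dots> = \<theta> (2 powi (- j - 1) * x) - \<theta> (2 powi (2 - j) * x)"
    proof -
      have e: "- (j - 1) = 1 - j" "1 - (j - 1) = 2 - j" "- (j + 1) = - j - 1" "1 - (j + 1) = - j" by auto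
      show ?thesis unfolding \<psi>_def e by simp
    qed
    also have "\<dots> = 1"
    proof -
      have a: "(2::real) powi (- j - 1) * 2 powi j = 1/2" "(2::real) powi (2 - j) * 2 powi (j - 2) = 1"
        unfolding shift using two by simp_all
      have "2 powi (- j - 1) * \<bar>x\<bar> \<le> 2 powi (- j - 1) * 2 powi j" "2 powi (2 - j) * 2 powi (j - 2) \<le> 2 powi (2 - j) * \<bar>x\<bar>"
        using x by (auto intro!: mult_left_mono)
      then have "2 powi (- j - 1) * \<bar>x\<bar> \<le> 1/2" "1 \<le> 2 powi (2 - j) * \<bar>x\<bar>" unfolding a .
      then have "\<bar>2 powi (- j - 1) * x\<bar> \<le> 1/2" "1 \<le> \<bar>2 powi (2 - j) * x\<bar>" by (auto simp: abs_mult)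
      then show ?thesis by (simp only: \<theta>(2,3) diff_zero)
    qed
    finally show ?thesis .
  qed
  ultimately show ?thesis by blast
qed

section \<open>Application to the functional calculus of \<open>H\<close>\<close>

lemma smooth_continuous: "smooth f \<Longrightarrow> continuous_on UNIV f"
  unfolding smooth_def
  by (intro continuous_at_imp_continuous_on ballI differentiable_imp_continuous_within) (metis empty_subsetI list.set(1) partial_derivs.simps(1))

lemma schwartz_classD:
  assumes "f \<in> schwartz_class" "set bs \<subseteq> Basis"
  shows "\<exists>C. \<forall>x. (1 + norm x) ^ N * norm (partial_derivs bs f x) \<le> C"
  using assms by (simp add: schwartz_class_def)

lemma schwartz_class_bounded:
  assumes "f \<in> schwartz_class" shows "\<exists>M. \<forall>x. norm (f x) \<le> M"
proof -
  have "\<exists>C. \<forall>x. (1 + norm x) ^ 0 * norm (partial_derivs [] f x) \<le> C"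
    using assms by (rule schwartz_classD) simp
  then show ?thesis by simp
qed

lemma schwartz_class_L2:
  fixes f :: "'a::euclidean_space \<Rightarrow> complex"
  assumes "f \<in> schwartz_class" shows "f \<in> L2"
proof -
  have "\<exists>C. \<forall>x. (1 + norm x) ^ DIM('a) * norm (partial_derivs [] f x) \<le> C"
    using assms by (rule schwartz_classD) simp
  then obtain C where C: "\<And>x. (1 + norm x) ^ DIM('a) * norm (f x) \<le> C" by auto
  have meas [measurable]: "f \<in> borel_measurable borel"
    using assms by (intro borel_measurable_continuous_onI smooth_continuous) (simp add: schwartz_class_def)
  have le: "norm (f x) \<le> C * norm (L2_weight x :: complex)" for x
  proof -
    have p: "0 < 1 + norm x" by (simp add: add_pos_nonneg)
    have "norm (L2_weight x :: complex) = inverse ((1 + norm x) ^ DIM('a))"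
    proof -
      have "norm (L2_weight x :: complex) = (1 + norm x) powr (- real DIM('a))"
        unfolding L2_weight_def norm_of_real by simp
      then show ?thesis using p by (simp add: powr_minus powr_realpow)
    qed
    moreover have "0 < (1 + norm x) ^ DIM('a)" using p by simp
    ultimately show ?thesis using C[of x] by (simp add: divide_inverse[symmetric] le_divide_eq mult.commute)
  qed
  have "integrable lborel (\<lambda>x. (norm (f x))\<^sup>2)"
  proof (rule Bochner_Integration.integrable_bound)
    show "integrable lborel (\<lambda>x::'a. C\<^sup>2 * (norm (L2_weight x :: complex))\<^sup>2)"
      by (intro integrable_mult_right L2_integrable_sq L2_weight_in_L2)
    show "AE x in lborel. norm ((norm (f x))\<^sup>2) \<le> norm (C\<^sup>2 * (norm (L2_weight x :: complex))\<^sup>2)"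
    proof (rule AE_I2)
      fix x
      show "norm ((norm (f x))\<^sup>2) \<le> norm (C\<^sup>2 * (norm (L2_weight x :: complex))\<^sup>2)"
        using power_mono[OF le[of x] norm_ge_zero, of 2] by (simp add: power_mult_distrib)
    qed
  qed measurable
  then show ?thesis by (simp add: L2_def)
qed

lemma dyadic_bounded_borel:
  assumes "dyadic_support_decay \<phi>" shows "bounded_borel (\<phi> j)"
proof -
  have "smooth (\<phi> j)" using assms by (simp add: dyadic_support_decay_def test_function_def)
  then have "\<phi> j \<in> borel_measurable borel" by (intro borel_measurable_continuous_onI smooth_continuous)
  moreover have "\<exists>c. \<forall>j x. norm (partial_derivs (replicate 0 1) (\<phi> j) x) \<le> c * 2 powi (- (int 0 * j))"
    using assms unfolding dyadic_support_decay_def by blast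
  ultimately show ?thesis by (auto simp: bounded_borel_def)
qed

section \<open>Operators with polynomially decaying kernels\<close>

lemma kernel_bound_decay_kernel:
  fixes x y :: "real^'n"
  assumes "norm z \<le> c * 2 powr (real CARD('n) * real_of_int j / 2) / (1 + 2 powr (real_of_int j / 2) * norm (x - y)) ^ N"
    and "0 \<le> c"
  shows "ennreal (norm (z :: complex)) \<le> ennreal c * decay_kernel (2 powr (j/2)) (real N) (x - y)"
proof -
  let ?a = "2 powr (real_of_int j / 2)"
  have p: "0 < 1 + ?a * norm (x - y)" by (simp add: one_plus_pos)
  have "?a ^ CARD('n) = 2 powr (real CARD('n) * real_of_int j / 2)"
    by (simp add: powr_realpow[symmetric] powr_powr mult.commute)
  moreover have "(1 + ?a * norm (x - y)) powr (- real N) = 1 / (1 + ?a * norm (x - y)) ^ N"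
    using p by (simp add: powr_minus powr_realpow inverse_eq_divide)
  ultimately have "norm z \<le> c * (?a ^ CARD('n) * (1 + ?a * norm (x - y)) powr (- real N))"
    using assms(1) by (simp add: mult.assoc)
  then show ?thesis using assms(2) by (simp add: decay_kernel_def ennreal_mult[symmetric] ennreal_leI)
qed

lemma one_divide_le_divide:
  fixes c :: real assumes "A \<le> c * B" "0 < A" "0 < B" shows "1 / B \<le> c / A"
  using assms by (simp add: field_simps)

text \<open>For |i - j| \<le> 1 the scales 2^(i/2) and 2^(j/2) differ by a factor of at most 2. The
  normalization then costs 2^n and the decay 2^N.\<close>

lemma decay_kernel_adjacent_le:
  fixes z :: "'a::euclidean_space"
  assumes "i \<in> {j - 1..j + 1}"
  shows "decay_kernel (2 powr (real_of_int i/2)) (real N) z \<le> ennreal (2 ^ DIM('a) * 2 ^ N) * decay_kernel (2 powr (real_of_int j/2)) (real N) z"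
proof -
  define a where "a = 2 powr (real_of_int j / 2)"
  define b where "b = 2 powr (real_of_int i / 2)"
  have pos: "0 < a" "0 < b" by (simp_all add: a_def b_def)
  have "b \<le> 2 powr (real_of_int j / 2 + 1)" unfolding b_def using assms by (intro powr_mono) auto
  then have ba: "b \<le> 2 * a" by (simp add: a_def powr_add)
  have "a \<le> 2 powr (real_of_int i / 2 + 1)" unfolding a_def using assms by (intro powr_mono) auto
  then have ab: "a \<le> 2 * b" by (simp add: b_def powr_add)
  have p: "0 < 1 + a * norm z" "0 < 1 + b * norm z" using pos by (auto intro: one_plus_pos)
  have "a * norm z \<le> 2 * b * norm z" using ab by (intro mult_right_mono) auto
  then have "(1 + a * norm z) ^ N \<le> (2 * (1 + b * norm z)) ^ N" using p by (intro power_mono) auto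
  then have "(1 + a * norm z) ^ N \<le> 2 ^ N * (1 + b * norm z) ^ N" unfolding power_mult_distrib .
  then have "1 / (1 + b * norm z) ^ N \<le> 2 ^ N / (1 + a * norm z) ^ N"
    using p by (intro one_divide_le_divide) auto
  moreover have "b ^ DIM('a) \<le> 2 ^ DIM('a) * a ^ DIM('a)"
    using power_mono[OF ba, of "DIM('a)"] pos unfolding power_mult_distrib by simp
  ultimately have "b ^ DIM('a) * (1 / (1 + b * norm z) ^ N) \<le> (2 ^ DIM('a) * a ^ DIM('a)) * (2 ^ N / (1 + a * norm z) ^ N)"
    using pos p by (intro mult_mono) auto
  moreover have "(1 + t) powr (- real N) = 1 / (1 + t) ^ N" if "0 < 1 + t" for t :: real
    using that by (simp add: powr_minus powr_realpow inverse_eq_divide)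
  ultimately have "b ^ DIM('a) * (1 + b * norm z) powr (- real N)
     \<le> 2 ^ DIM('a) * 2 ^ N * (a ^ DIM('a) * (1 + a * norm z) powr (- real N))"
    using p by (simp add: mult_ac)
  then show ?thesis
    unfolding decay_kernel_def a_def[symmetric] b_def[symmetric] using pos
    by (subst ennreal_mult[symmetric]) (auto intro!: ennreal_leI)
qed

lemma kernel_section_measurable:
  assumes "is_integral_kernel T K" shows "(\<lambda>y. K x y) \<in> borel_measurable borel"
proof -
  have "(\<lambda>(x, y). K x y) \<in> borel_measurable (lborel \<Otimes>\<^sub>M lborel)"
    using assms by (simp add: is_integral_kernel_def)
  from measurable_compose[OF measurable_Pair1'[of x] this] show ?thesis by simp
qed

lemma kernel_integral_bound:
  fixes K :: "'a::euclidean_space \<Rightarrow> 'a \<Rightarrow> complex" and f :: "'a \<Rightarrow> complex"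
  assumes K: "\<And>y. ennreal (norm (K x y)) \<le> ennreal c * decay_kernel (2 powr (real_of_int j/2)) m (x - y)"
    and Km [measurable]: "(\<lambda>y. K x y) \<in> borel_measurable borel"
    and f [measurable]: "f \<in> borel_measurable borel"
  shows "(\<integral>\<^sup>+y. ennreal (norm (K x y * f y)) \<partial>lborel) \<le> ennreal c * decay_conv m j (\<lambda>y. ennreal (norm (f y))) x"
proof -
  have "(\<integral>\<^sup>+y. ennreal (norm (K x y * f y)) \<partial>lborel)
    \<le> (\<integral>\<^sup>+y. ennreal c * (decay_kernel (2 powr (real_of_int j/2)) m (x - y) * ennreal (norm (f y))) \<partial>lborel)"
    using K by (intro nn_integral_mono) (simp add: norm_mult ennreal_mult mult.assoc[symmetric] mult_right_mono)
  also have "\<dots> = ennreal c * decay_conv m j (\<lambda>y. ennreal (norm (f y))) x"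
    by (simp add: decay_conv_def nn_integral_cmult)
  finally show ?thesis .
qed

text \<open>Continuity is dominated convergence along a sequence X_k tending to x. The kernels at
  X_k have a common majorant centred at x, because |X_k - x| \<le> R costs only the factor (1 + a
  R)^N; the majorant is integrable since N exceeds the dimension.\<close>

lemma kernel_operator_continuous:
  fixes K :: "'a::euclidean_space \<Rightarrow> 'a \<Rightarrow> complex" and f :: "'a \<Rightarrow> complex"
  assumes K: "\<And>x y. ennreal (norm (K x y)) \<le> ennreal c * decay_kernel (2 powr (real_of_int j/2)) (real N) (x - y)" and c: "0 \<le> c"
    and N: "DIM('a) < N"
    and Km [measurable]: "\<And>x. (\<lambda>y. K x y) \<in> borel_measurable borel"
    and Kc: "\<And>x y. isCont (\<lambda>z. K z y) x"
    and f [measurable]: "f \<in> borel_measurable borel" and M: "\<And>y. norm (f y) \<le> M"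
  shows "continuous_on UNIV (\<lambda>x. LINT y|lborel. K x y * f y)"
    and "\<exists>B. \<forall>x. norm (LINT y|lborel. K x y * f y) \<le> B"
proof -
  define a where "a = 2 powr (real_of_int j/2)"
  have a: "0 < a" by (simp add: a_def)
  have M0: "0 \<le> M" using M[of 0] norm_ge_zero order_trans by blast
  have m: "real DIM('a) < real N" using N by simp
  obtain D where D: "0 \<le> D" "\<And>(j::int) (x::'a). (\<integral>\<^sup>+y. decay_kernel (2 powr (j/2)) (real N) (x - y) \<partial>lborel) \<le> ennreal D"
    using nn_integral_decay_kernel_le[OF m] by blast
  have Kr: "norm (K x y) \<le> c * (a ^ DIM('a) * (1 + a * norm (x - y)) powr (- real N))" for x y
    using K[of x y] c a unfolding decay_kernel_def a_def[symmetric] by (simp add: ennreal_mult[symmetric] ennreal_le_iff)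
  show "\<exists>B. \<forall>x. norm (LINT y|lborel. K x y * f y) \<le> B"
  proof (intro exI allI)
    fix x
    have "(\<integral>\<^sup>+y. ennreal (norm (K x y * f y)) \<partial>lborel) \<le> ennreal c * decay_conv (real N) j (\<lambda>y. ennreal (norm (f y))) x"
      using K by (intro kernel_integral_bound) auto
    also have "decay_conv (real N) j (\<lambda>y. ennreal (norm (f y))) x \<le> decay_conv (real N) j (\<lambda>y. ennreal M * 1) x"
      using M by (intro decay_conv_mono_AE AE_I2) (auto intro: ennreal_leI)
    also have "\<dots> = ennreal M * decay_conv (real N) j (\<lambda>y. 1) x" by (rule decay_conv_cmult) simp
    also have "decay_conv (real N) j (\<lambda>y. 1) x \<le> ennreal D" using D(2)[of j x] by (simp add: decay_conv_def)
    finally have bd: "(\<integral>\<^sup>+y. ennreal (norm (K x y * f y)) \<partial>lborel) \<le> ennreal (c * (M * D))"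
      using c M0 D(1) by (simp add: ennreal_mult mult_left_mono)
    then have i: "integrable lborel (\<lambda>y. K x y * f y)"
      by (auto simp: integrable_iff_bounded intro: order_le_less_trans)
    show "norm (LINT y|lborel. K x y * f y) \<le> c * (M * D)"
      using order_trans[OF integral_norm_bound_ennreal[OF i] bd] c M0 D(1) by (simp add: ennreal_le_iff)
  qed
  have "isCont (\<lambda>x. LINT y|lborel. K x y * f y) x" for x
    unfolding continuous_at_sequentially
  proof (intro allI impI)
    fix X :: "nat \<Rightarrow> 'a" assume X: "X \<longlonglongrightarrow> x"
    have "Bseq (\<lambda>k. X k - x)" using X by (intro convergent_imp_Bseq convergentI[of _ "x - x"] tendsto_diff tendsto_const)
    then obtain R where R: "0 < R" "\<And>k. norm (X k - x) \<le> R" unfolding Bseq_def by blast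
    let ?w = "\<lambda>y. c * (a ^ DIM('a) * ((1 + a * R) powr real N * (1 + a * norm (x - y)) powr (- real N))) * M"
    have "(\<lambda>k. LINT y|lborel. K (X k) y * f y) \<longlonglongrightarrow> (LINT y|lborel. K x y * f y)"
    proof (rule integral_dominated_convergence[where w = ?w])
      show "AE y in lborel. (\<lambda>k. K (X k) y * f y) \<longlonglongrightarrow> K x y * f y"
        using isCont_tendsto_compose[OF Kc X] by (intro AE_I2 tendsto_mult tendsto_const)
      have "integrable lborel (\<lambda>y. a ^ DIM('a) * (1 + a * norm (x - y)) powr (- real N))"
      proof (rule integrableI_bounded)
        have "(\<integral>\<^sup>+y. ennreal (norm (a ^ DIM('a) * (1 + a * norm (x - y)) powr (- real N))) \<partial>lborel)
          = (\<integral>\<^sup>+y. decay_kernel (2 powr (j/2)) (real N) (x - y) \<partial>lborel)"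
          by (intro nn_integral_cong) (use a in \<open>simp add: decay_kernel_def a_def[symmetric]\<close>)
        then show "(\<integral>\<^sup>+y. ennreal (norm (a ^ DIM('a) * (1 + a * norm (x - y)) powr (- real N))) \<partial>lborel) < \<infinity>"
          using order_le_less_trans[OF D(2)[of j x] ennreal_less_top] by simp
      qed measurable
      from integrable_mult_right[OF this, of "c * (1 + a * R) powr real N * M"]
      show "integrable lborel ?w" by (simp add: mult_ac)
      show "AE y in lborel. norm (K (X k) y * f y) \<le> ?w y" for k
      proof (rule AE_I2)
        fix y
        have "1 + a * norm (x - y) \<le> (1 + a * norm (x - X k)) * (1 + a * norm (X k - y))"
          using a by (rule peetre_triangle)
        also have "\<dots> \<le> (1 + a * R) * (1 + a * norm (X k - y))"
          using a R(2)[of k] one_plus_pos[OF a, of "X k - y"]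
          by (intro mult_right_mono) (auto simp: norm_minus_commute)
        finally have "(1 + a * norm (x - y)) powr real N \<le> ((1 + a * R) * (1 + a * norm (X k - y))) powr real N"
          using one_plus_pos[OF a, of "x - y"] by (intro powr_mono2) auto
        also have "\<dots> = (1 + a * R) powr real N * (1 + a * norm (X k - y)) powr real N"
          by (rule powr_mult)
        finally have "(1 + a * norm (X k - y)) powr (- real N) \<le> (1 + a * R) powr real N * (1 + a * norm (x - y)) powr (- real N)"
          using one_plus_pos[OF a, of "X k - y"] one_plus_pos[OF a, of "x - y"]
          by (simp add: powr_minus field_simps)
        then have "c * (a ^ DIM('a) * (1 + a * norm (X k - y)) powr (- real N))
          \<le> c * (a ^ DIM('a) * ((1 + a * R) powr real N * (1 + a * norm (x - y)) powr (- real N)))"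
          using a c by (intro mult_left_mono) auto
        then have "norm (K (X k) y) \<le> c * (a ^ DIM('a) * ((1 + a * R) powr real N * (1 + a * norm (x - y)) powr (- real N)))"
          using Kr[of "X k" y] by linarith
        then show "norm (K (X k) y * f y) \<le> ?w y"
          unfolding norm_mult using M M0 c a by (intro mult_mono) auto
      qed
    qed measurable
    then show "((\<lambda>x. LINT y|lborel. K x y * f y) \<circ> X) \<longlonglongrightarrow> (LINT y|lborel. K x y * f y)"
      by (simp add: o_def)
  qed
  then show "continuous_on UNIV (\<lambda>x. LINT y|lborel. K x y * f y)"
    by (simp add: continuous_at_imp_continuous_on)
qed

lemma AE_eq_continuous_imp_eq:
  fixes u v :: "'a::euclidean_space \<Rightarrow> complex"
  assumes "continuous_on UNIV u" "continuous_on UNIV v" "ae_eq u v" shows "u = v"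
proof
  fix x
  have "closed {x. u x = v x}" using assms by (intro closed_Collect_eq)
  from AE_lborel_closed_imp_UNIV[OF this, of x] assms(3) show "u x = v x"
    by (simp add: ae_eq_def)
qed

text \<open>The kernel integral is a continuous function that agrees with \<phi>_j(H)f almost
  everywhere, so the choice in \<open>fun_calc\<close> is continuous and therefore equal to it at
  every point; its bound carries over.\<close>

lemma fun_calc_continuous_bounded:
  fixes E :: "real set \<Rightarrow> (real^'n \<Rightarrow> complex) \<Rightarrow> real^'n \<Rightarrow> complex"
  assumes pvm: "projection_valued_measure E" and decay: "kernel_decay E"
    and \<phi>: "dyadic_support_decay \<phi>" and f: "f \<in> L2" and M: "\<And>y. norm (f y) \<le> M"
  shows "continuous_on UNIV (fun_calc E (\<phi> j) f) \<and> (\<exists>B. \<forall>x. norm (fun_calc E (\<phi> j) f x) \<le> B)"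
proof -
  obtain K where K: "\<And>j. is_integral_kernel (fun_calc E (\<phi> j)) (K j)"
    "\<And>j x y. (\<lambda>z. K j z y) differentiable (at x)"
    "\<And>N::nat. \<exists>c>0. \<forall>j x y.
              norm (K j x y) \<le>
                c * 2 powr (real CARD('n) * real_of_int j / 2)
                  / (1 + 2 powr (real_of_int j / 2) * norm (x - y)) ^ N"
    using decay \<phi> unfolding kernel_decay_def by meson
  \<comment> \<open>The exponent n + 1 is the smallest integer giving an integrable kernel.\<close>
  obtain c where c: "c > 0" "\<And>j x y. norm (K j x y) \<le> c * 2 powr (real CARD('n) * real_of_int j / 2)
     / (1 + 2 powr (real_of_int j / 2) * norm (x - y)) ^ (DIM(real^'n) + 1)"
    using K(3)[of "DIM(real^'n) + 1"] by blast
  let ?v = "\<lambda>x. LINT y|lborel. K j x y * f y"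
  have Kb: "ennreal (norm (K j x y)) \<le> ennreal c * decay_kernel (2 powr (real_of_int j/2)) (real (DIM(real^'n) + 1)) (x - y)" for x y
    using c(1) by (intro kernel_bound_decay_kernel c(2)) auto
  have Kc: "isCont (\<lambda>z. K j z y) x" for x y
    using K(2) by (rule differentiable_imp_continuous_within)
  note cb = kernel_operator_continuous[OF Kb _ _ kernel_section_measurable[OF K(1)] Kc L2_measurable[OF f] M]
  have v: "continuous_on UNIV ?v" by (rule cb(1)) (use c(1) in auto)
  have "\<exists>B. \<forall>x. norm (?v x) \<le> B" by (rule cb(2)) (use c(1) in auto)
  moreover have ae: "ae_eq (fun_calc E (\<phi> j) f) ?v"
    using K(1)[of j] f unfolding is_integral_kernel_def ae_eq_def by (auto elim: eventually_mono)
  have uc: "continuous_on UNIV (fun_calc E (\<phi> j) f)"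
    by (rule fun_calc_continuous[OF pvm dyadic_bounded_borel[OF \<phi>] f v ae])
  ultimately show ?thesis using AE_eq_continuous_imp_eq[OF uc v ae] by simp
qed

text \<open>The positive lower bound on the sum, evaluated at x = 1, excludes the zero family. The
  nonzero \<phi>_j found here seeds the smooth cutoff.\<close>

lemma dyadic_system_nonzero:
  assumes "dyadic_system \<phi>" shows "\<exists>j x. \<phi> j x \<noteq> 0"
proof (rule ccontr)
  assume *: "\<not> ?thesis"
  obtain c1 r where "c1 > 0" "c1 \<le> r" "((\<lambda>j. \<phi> j 1) has_sum complex_of_real r) UNIV"
    using assms unfolding dyadic_system_def by (metis zero_neq_one)
  moreover have "((\<lambda>j. \<phi> j 1) has_sum 0) UNIV" using * by (simp add: has_sum_0)
  ultimately have "complex_of_real r = 0" using has_sum_unique by blast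
  with \<open>c1 > 0\<close> \<open>c1 \<le> r\<close> show False by simp
qed

text \<open>The partition \<psi> satisfies the support and derivative conditions itself, so the
  kernel decay applies to it with every N. Since the three \<psi>_i adjacent to j sum to 1 on the
  support of \<phi>_j, the vector u = \<phi>_j(H)f is reproduced by three kernel operators acting on
  u rather than on f.\<close>

lemma fun_calc_reproducing_bound:
  fixes E :: "real set \<Rightarrow> (real^'n \<Rightarrow> complex) \<Rightarrow> real^'n \<Rightarrow> complex"
  assumes pvm: "projection_valued_measure E" and decay: "kernel_decay E" and \<phi>: "dyadic_system \<phi>"
  shows "\<exists>C\<ge>0. \<forall>f\<in>schwartz_class. \<forall>j. reproducing N C j (\<lambda>x. norm (fun_calc E (\<phi> j) f x))"
proof -
  have \<phi>d: "dyadic_support_decay \<phi>" using \<phi> by (simp add: dyadic_system_def)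
  have supp: "2 powi (j - 2) \<le> \<bar>x\<bar> \<and> \<bar>x\<bar> \<le> 2 powi j" if "\<phi> j x \<noteq> 0" for j x
    using \<phi>d that closure_subset[of "{x. \<phi> j x \<noteq> 0}"] unfolding dyadic_support_decay_def by blast
  obtain j0 x0 where "\<phi> j0 x0 \<noteq> 0" using dyadic_system_nonzero[OF \<phi>] by blast
  moreover have "smooth (\<phi> j0)" using \<phi>d by (simp add: dyadic_support_decay_def test_function_def)
  ultimately obtain \<psi> where \<psi>: "dyadic_support_decay \<psi>"
    "\<And>j x. 2 powi (j - 2) \<le> \<bar>x\<bar> \<Longrightarrow> \<bar>x\<bar> \<le> 2 powi j \<Longrightarrow> (\<Sum>i\<in>{j - 1..j + 1}. \<psi> i x) = 1"
    using exists_dyadic_partition[of "\<phi> j0" "2 powi j0" x0] supp by auto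
  have part: "(\<Sum>i\<in>{j - 1..j + 1}. \<psi> i t * \<phi> j t) = \<phi> j t" for j t
    using \<psi>(2)[of j t] supp[of j t] by (cases "\<phi> j t = 0") (auto simp: sum_distrib_right[symmetric])
  obtain K where K: "\<And>j. is_integral_kernel (fun_calc E (\<psi> j)) (K j)"
    "\<And>N::nat. \<exists>c>0. \<forall>j x y.
              norm (K j x y) \<le>
                c * 2 powr (real CARD('n) * real_of_int j / 2)
                  / (1 + 2 powr (real_of_int j / 2) * norm (x - y)) ^ N"
    using decay \<psi>(1) unfolding kernel_decay_def by meson
  obtain c where c: "c > 0" "\<And>j x y. norm (K j x y) \<le> c * 2 powr (real CARD('n) * real_of_int j / 2)
     / (1 + 2 powr (real_of_int j / 2) * norm (x - y)) ^ N"
    using K(2)[of N] by blast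
  define D where "D = 2 ^ DIM(real^'n) * (2::real) ^ N"
  have D: "0 \<le> D" by (simp add: D_def)
  have Kb: "ennreal (norm (K i x y)) \<le> ennreal (c * D) * decay_kernel (2 powr (real_of_int j/2)) (real N) (x - y)"
    if "i \<in> {j - 1..j + 1}" for i j x y
  proof -
    have "ennreal (norm (K i x y)) \<le> ennreal c * decay_kernel (2 powr (real_of_int i/2)) (real N) (x - y)"
      using c(1) by (intro kernel_bound_decay_kernel c(2)) auto
    also have "\<dots> \<le> ennreal c * (ennreal D * decay_kernel (2 powr (real_of_int j/2)) (real N) (x - y))"
      unfolding D_def using that by (intro mult_left_mono decay_kernel_adjacent_le) auto
    finally show ?thesis using c(1) D by (simp add: ennreal_mult mult.assoc)
  qed
  \<comment> \<open>3 counts the indices adjacent to j, c is the kernel constant, and D compares the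
    scales i and j.\<close>
  have "reproducing N (3 * (c * D)) j (\<lambda>x. norm (fun_calc E (\<phi> j) f x))"
    if f: "f \<in> schwartz_class" for f j
  proof -
    let ?u = "fun_calc E (\<phi> j) f"
    have fL: "f \<in> L2" using f by (rule schwartz_class_L2)
    obtain M where M: "\<And>x. norm (f x) \<le> M" using schwartz_class_bounded[OF f] by blast
    have u: "continuous_on UNIV ?u" "\<exists>B. \<forall>x. norm (?u x) \<le> B"
      using fun_calc_continuous_bounded[OF pvm decay \<phi>d fL M] by auto
    have uL: "?u \<in> L2" by (rule fun_calc_L2[OF pvm dyadic_bounded_borel[OF \<phi>d] fL])
    have "ae_eq ?u (\<lambda>x. \<Sum>i\<in>{j - 1..j + 1}. fun_calc E (\<psi> i) ?u x)"
      using part by (intro fun_calc_reproducing[OF pvm dyadic_bounded_borel[OF \<phi>d] _ dyadic_bounded_borel[OF \<psi>(1)] _ fL]) auto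
    moreover have "AE x in lborel. \<forall>i\<in>{j - 1..j + 1}. integrable lborel (\<lambda>y. K i x y * ?u y) \<and>
       fun_calc E (\<psi> i) ?u x = (LINT y|lborel. K i x y * ?u y)"
      using K(1) uL unfolding is_integral_kernel_def by (intro AE_finite_allI) auto
    ultimately have "AE x in lborel. ennreal (norm (?u x)) \<le> ennreal (3 * (c * D)) * decay_conv (real N) j (\<lambda>y. ennreal (norm (?u y))) x"
      unfolding ae_eq_def
    proof eventually_elim
      case (elim x)
      have "ennreal (norm (?u x)) \<le> (\<Sum>i\<in>{j - 1..j + 1}. ennreal (norm (fun_calc E (\<psi> i) ?u x)))"
        unfolding elim(1) by (subst sum_ennreal) (auto intro!: ennreal_leI norm_sum)
      also have "\<dots> \<le> (\<Sum>i\<in>{j - 1..j + 1}. ennreal (c * D) * decay_conv (real N) j (\<lambda>y. ennreal (norm (?u y))) x)"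
      proof (rule sum_mono)
        fix i assume i: "i \<in> {j - 1..j + 1}"
        then have "ennreal (norm (fun_calc E (\<psi> i) ?u x)) \<le> (\<integral>\<^sup>+y. ennreal (norm (K i x y * ?u y)) \<partial>lborel)"
          using elim(2) integral_norm_bound_ennreal[of lborel "\<lambda>y. K i x y * ?u y"] by simp
        also have "\<dots> \<le> ennreal (c * D) * decay_conv (real N) j (\<lambda>y. ennreal (norm (?u y))) x"
          using Kb[OF i] kernel_section_measurable[OF K(1)] L2_measurable[OF uL] by (rule kernel_integral_bound)
        finally show "ennreal (norm (fun_calc E (\<psi> i) ?u x)) \<le> \<dots>" .
      qed
      also have "\<dots> = ennreal (3 * (c * D)) * decay_conv (real N) j (\<lambda>y. ennreal (norm (?u y))) x"
      proof -
        have "card {j - 1..j + 1} = 3" by simp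
        then show ?thesis using c(1) D by (simp add: ennreal_mult mult.assoc)
      qed
      finally show ?case .
    qed
    then show ?thesis unfolding reproducing_def using u by (auto intro: continuous_on_norm)
  qed
  then show ?thesis using c(1) D by (intro exI[of _ "3 * (c * D)"]) auto
qed

lemma peetre_maximal_eq: "peetre_maximal E \<phi> j s f = peetre_sup (2 powr (j/2)) s (\<lambda>t. norm (fun_calc E (\<phi> j) f t))"
  by (simp add: fun_eq_iff peetre_maximal_def peetre_sup_def)

lemma comparable_onI:
  assumes "0 \<le> C" "\<And>f. f \<in> S \<Longrightarrow> A f \<le> B f" "\<And>f. f \<in> S \<Longrightarrow> B f \<le> ennreal C * A f"
  shows "comparable_on S A B"
  unfolding comparable_on_def
proof (intro exI conjI ballI)
  show "1 \<le> max 1 C" by simp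
  fix f assume f: "f \<in> S"
  have "ennreal (1 / max 1 C) * A f \<le> ennreal 1 * A f" by (intro mult_right_mono ennreal_leI) (auto simp: field_simps)
  then show "ennreal (1 / max 1 C) * A f \<le> B f" using assms(2)[OF f] by simp
  have "ennreal C * A f \<le> ennreal (max 1 C) * A f" by (intro mult_right_mono ennreal_leI) auto
  then show "B f \<le> ennreal (max 1 C) * A f" using assms(3)[OF f] by (rule order_trans[rotated])
qed

theorem theorem1p2:
  fixes V :: "real^'n \<Rightarrow> real"
    and D :: "(real^'n \<Rightarrow> complex) set"
    and H :: "(real^'n \<Rightarrow> complex) \<Rightarrow> real^'n \<Rightarrow> complex"
    and E :: "real set \<Rightarrow> (real^'n \<Rightarrow> complex) \<Rightarrow> real^'n \<Rightarrow> complex"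
    and \<phi> :: "int \<Rightarrow> real \<Rightarrow> complex"
  assumes H: "schroedinger_operator V D H"
    and E: "is_spectral_measure_of E D H"
    and decay: "kernel_decay E"
    and \<phi>: "dyadic_system \<phi>"
  shows "(\<forall>(p::ennreal) (q::ennreal) (\<alpha>::real) (s::real).
            0 < p \<longrightarrow> 0 < q \<longrightarrow> 0 < s \<longrightarrow> of_nat CARD('n) / p < ennreal s \<longrightarrow>
            comparable_on schwartz_class
              (besov_qnorm E \<phi> \<alpha> p q)
              (\<lambda>f. lq_qnorm q (\<lambda>j. ennreal (2 powr (real_of_int j * \<alpha>)) *
                      Lp_qnorm p (peetre_maximal E \<phi> j s f))))
       \<and> (\<forall>(p::ennreal) (q::ennreal) (\<alpha>::real) (s::real).
            0 < p \<longrightarrow> p < \<infinity> \<longrightarrow> 0 < q \<longrightarrow> 0 < s \<longrightarrow> of_nat CARD('n) / min p q < ennreal s \<longrightarrow>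
            comparable_on schwartz_class
              (triebel_lizorkin_qnorm E \<phi> \<alpha> p q)
              (\<lambda>f. Lp_qnorm p (\<lambda>x. lq_qnorm q (\<lambda>j. ennreal (2 powr (real_of_int j * \<alpha>)) *
                      peetre_maximal E \<phi> j s f x))))"
proof (intro conjI allI impI)
  have pvm: "projection_valued_measure E" using E by (simp add: is_spectral_measure_of_def)
  have repr: "\<exists>C\<ge>0. \<forall>f\<in>schwartz_class. \<forall>j. reproducing N C j (\<lambda>x. norm (fun_calc E (\<phi> j) f x))" for N
    by (rule fun_calc_reproducing_bound[OF pvm decay \<phi>])
  \<comment> \<open>Measurability is read off from the reproducing property; the value of N is
    immaterial here, and 0 is taken.\<close>
  have meas: "(\<lambda>x. ennreal (norm (fun_calc E (\<phi> j) f x))) \<in> borel_measurable borel" if f: "f \<in> schwartz_class" for f j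
  proof -
    obtain C where "\<forall>f\<in>schwartz_class. \<forall>j. reproducing 0 C j (\<lambda>x. norm (fun_calc E (\<phi> j) f x))"
      using repr[of 0] by (elim exE conjE)
    then have "(\<lambda>x. norm (fun_calc E (\<phi> j) f x)) \<in> borel_measurable borel"
      using f by (intro reproducing_measurable[of 0 C j]) blast
    then show ?thesis by (rule measurable_compose) simp
  qed
  {
    fix p q :: ennreal and \<alpha> s :: real
    assume p: "0 < p" and q: "0 < q" and s: "0 < s" "of_nat CARD('n) / p < ennreal s"
    \<comment> \<open>The order of choices matters: N comes from the exponents, then C0 from N and
      the operator, then C from C0. All are fixed before f.\<close>
    obtain N where N: "\<forall>C0\<ge>0. \<exists>C\<ge>0. \<forall>g :: int \<Rightarrow> real^'n \<Rightarrow> real. (\<forall>j. reproducing N C0 j (g j)) \<longrightarrow>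
      lq_qnorm q (\<lambda>j. ennreal (2 powr (real_of_int j * \<alpha>)) * Lp_qnorm p (peetre_sup (2 powr (j/2)) s (g j)))
        \<le> ennreal C * lq_qnorm q (\<lambda>j. ennreal (2 powr (real_of_int j * \<alpha>)) * Lp_qnorm p (\<lambda>x. ennreal (g j x)))"
      using besov_peetre_bound[where 'a = "real^'n", OF p q s(1), of "\<lambda>j. ennreal (2 powr (real_of_int j * \<alpha>))"] s(2) by auto
    obtain C0 where C0: "0 \<le> C0" "\<And>f j. f \<in> schwartz_class \<Longrightarrow> reproducing N C0 j (\<lambda>x. norm (fun_calc E (\<phi> j) f x))"
      using repr[of N] by blast
    obtain C where C: "0 \<le> C" "\<And>g :: int \<Rightarrow> real^'n \<Rightarrow> real. (\<forall>j. reproducing N C0 j (g j)) \<Longrightarrow>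
      lq_qnorm q (\<lambda>j. ennreal (2 powr (real_of_int j * \<alpha>)) * Lp_qnorm p (peetre_sup (2 powr (j/2)) s (g j)))
        \<le> ennreal C * lq_qnorm q (\<lambda>j. ennreal (2 powr (real_of_int j * \<alpha>)) * Lp_qnorm p (\<lambda>x. ennreal (g j x)))"
      using N C0(1) by blast
    show "comparable_on schwartz_class (besov_qnorm E \<phi> \<alpha> p q)
      (\<lambda>f. lq_qnorm q (\<lambda>j. ennreal (2 powr (real_of_int j * \<alpha>)) * Lp_qnorm p (peetre_maximal E \<phi> j s f)))"
    proof (rule comparable_onI[OF C(1)])
      fix f :: "real^'n \<Rightarrow> complex" assume f: "f \<in> schwartz_class"
      show "besov_qnorm E \<phi> \<alpha> p q f \<le> lq_qnorm q (\<lambda>j. ennreal (2 powr (real_of_int j * \<alpha>)) * Lp_qnorm p (peetre_maximal E \<phi> j s f))"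
        unfolding besov_qnorm_def peetre_maximal_eq
        by (intro lq_qnorm_mono mult_left_mono Lp_qnorm_mono le_peetre_sup meas f) auto
      show "lq_qnorm q (\<lambda>j. ennreal (2 powr (real_of_int j * \<alpha>)) * Lp_qnorm p (peetre_maximal E \<phi> j s f)) \<le> ennreal C * besov_qnorm E \<phi> \<alpha> p q f"
        unfolding besov_qnorm_def peetre_maximal_eq using C0(2)[OF f] by (intro C(2)) auto
    qed
  }
  {
    fix p q :: ennreal and \<alpha> s :: real
    assume p: "0 < p" "p < \<infinity>" and q: "0 < q" and s: "0 < s" "of_nat CARD('n) / min p q < ennreal s"
    obtain N where N: "\<forall>C0\<ge>0. \<exists>C\<ge>0. \<forall>g :: int \<Rightarrow> real^'n \<Rightarrow> real. (\<forall>j. reproducing N C0 j (g j)) \<longrightarrow>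
      Lp_qnorm p (\<lambda>x. lq_qnorm q (\<lambda>j. ennreal (2 powr (real_of_int j * \<alpha>)) * peetre_sup (2 powr (j/2)) s (g j) x))
        \<le> ennreal C * Lp_qnorm p (\<lambda>x. lq_qnorm q (\<lambda>j. ennreal (2 powr (real_of_int j * \<alpha>)) * ennreal (g j x)))"
      using triebel_lizorkin_peetre_bound[where 'a = "real^'n", OF p(1) _ q s(1), of "\<lambda>j. ennreal (2 powr (real_of_int j * \<alpha>))"] p(2) s(2) by auto
    obtain C0 where C0: "0 \<le> C0" "\<And>f j. f \<in> schwartz_class \<Longrightarrow> reproducing N C0 j (\<lambda>x. norm (fun_calc E (\<phi> j) f x))"
      using repr[of N] by blast
    obtain C where C: "0 \<le> C" "\<And>g :: int \<Rightarrow> real^'n \<Rightarrow> real. (\<forall>j. reproducing N C0 j (g j)) \<Longrightarrow>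
      Lp_qnorm p (\<lambda>x. lq_qnorm q (\<lambda>j. ennreal (2 powr (real_of_int j * \<alpha>)) * peetre_sup (2 powr (j/2)) s (g j) x))
        \<le> ennreal C * Lp_qnorm p (\<lambda>x. lq_qnorm q (\<lambda>j. ennreal (2 powr (real_of_int j * \<alpha>)) * ennreal (g j x)))"
      using N C0(1) by blast
    show "comparable_on schwartz_class (triebel_lizorkin_qnorm E \<phi> \<alpha> p q)
      (\<lambda>f. Lp_qnorm p (\<lambda>x. lq_qnorm q (\<lambda>j. ennreal (2 powr (real_of_int j * \<alpha>)) * peetre_maximal E \<phi> j s f x)))"
    proof (rule comparable_onI[OF C(1)])
      fix f :: "real^'n \<Rightarrow> complex" assume f: "f \<in> schwartz_class"
      note [measurable] = meas[OF f]
      show "triebel_lizorkin_qnorm E \<phi> \<alpha> p q f \<le> Lp_qnorm p (\<lambda>x. lq_qnorm q (\<lambda>j. ennreal (2 powr (real_of_int j * \<alpha>)) * peetre_maximal E \<phi> j s f x))"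
        unfolding triebel_lizorkin_qnorm_def peetre_maximal_eq
        by (intro Lp_qnorm_mono lq_qnorm_mono mult_left_mono le_peetre_sup) (auto intro!: lq_qnorm_measurable)
      show "Lp_qnorm p (\<lambda>x. lq_qnorm q (\<lambda>j. ennreal (2 powr (real_of_int j * \<alpha>)) * peetre_maximal E \<phi> j s f x)) \<le> ennreal C * triebel_lizorkin_qnorm E \<phi> \<alpha> p q f"
        unfolding triebel_lizorkin_qnorm_def peetre_maximal_eq using C0(2)[OF f] by (intro C(2)) auto
    qed
  }
qed

end
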